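(* Let $n\ge2$, let $p<0$, and let $\mu$ be a nonzero finite even discrete Borel measure on $S^{n-1}$. There exists an origin-symmetric $n$-dimensional polytope $K\subset\mathbb{R}^n$ such that $$S_p(K,\cdot)=\mu$$ if and only if $\mu$ is not concentrated on any great subsphere.
   Context: $S^{n-1}$ is the unit sphere of $\mathbb{R}^n$. A discrete measure is a positive Borel measure with finite support. A measure $\mu$ on $S^{n-1}$ is even if $\mu(-\omega)=\mu(\omega)$ for all Borel $\omega$. A great subsphere is $S^{n-1}\cap H$ with $H$ a linear hyperplane; $\mu$ is concentrated on it if its complement has $\mu$-measure $0$. Origin-symmetric means $K=-K$. For a convex body (compact convex set with nonempty interior) $K\subset\mathbb{R}^n$ containing the origin in its interior, $h_K(u)=\max_{x\in K}\langle x,u\rangle$ is the support function, $S_K$ is the surface area measure on $S^{n-1}$, i.e. $S_K(\omega)=\mathcal{H}^{n-1}(\nu_K^{-1}(\omega))$ with $\nu_K$ the $\mathcal{H}^{n-1}$-a.e. defined outer unit normal map on $\partial K$, and the $L_p$ surface area measure is $dS_p(K,\cdot)=h_K^{1-p}\,dS_K$. For a polytope $P$ with the origin in its interior and a facet with outer unit normal $u$ and area $a_P(u)$, $S_p(P,\{u\})=h_P(u)^{1-p}a_P(u)$. *)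

theory Defs
  imports "HOL-Analysis.Analysis"
begin

section \<open>Hausdorff measure\<close>

text \<open>The normalisation is the usual one, for which the \<open>d\<close>-dimensional Hausdorff measure agrees
  with the \<open>d\<close>-dimensional area on subsets of \<open>d\<close>-dimensional planes. Empty covering sets contribute
  nothing also for \<open>d = 0\<close>. The covering sets must be required to be bounded explicitly, because
  \<^const>\<open>diameter\<close> is unspecified on unbounded sets.\<close>

definition hausdorff_premeasure :: "nat \<Rightarrow> real \<Rightarrow> 'a::metric_space set \<Rightarrow> ennreal" where
  "hausdorff_premeasure d \<delta> A =
    (INF C \<in> {C :: nat \<Rightarrow> 'a set. A \<subseteq> (\<Union>i. C i) \<and> (\<forall>i. bounded (C i) \<and> diameter (C i) \<le> \<delta>)}.
      \<Sum>i. if C i = {} then 0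
          else ennreal (unit_ball_vol (real d) * (diameter (C i) / 2) ^ d))"

definition hausdorff_measure :: "nat \<Rightarrow> 'a::metric_space set \<Rightarrow> ennreal" where
  "hausdorff_measure d A = (SUP \<delta> \<in> {0<..}. hausdorff_premeasure d \<delta> A)"

section \<open>Borel measures on the unit sphere\<close>

definition borel_sphere :: "'a::euclidean_space measure" where
  "borel_sphere = restrict_space borel (sphere 0 1)"

definition measure_support :: "'a::topological_space measure \<Rightarrow> 'a set" where
  "measure_support M =
    {x \<in> space M. \<forall>U. open U \<longrightarrow> x \<in> U \<longrightarrow> emeasure M (U \<inter> space M) \<noteq> 0}"

definition discrete_measure :: "'a::topological_space measure \<Rightarrow> bool" where
  "discrete_measure M \<longleftrightarrow> finite (measure_support M)"

definition even_measure :: "'a::ab_group_add measure \<Rightarrow> bool" where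
  "even_measure M \<longleftrightarrow> (\<forall>\<omega>\<in>sets M. emeasure M (uminus ` \<omega>) = emeasure M \<omega>)"

definition great_subsphere :: "'a::euclidean_space set \<Rightarrow> bool" where
  "great_subsphere S \<longleftrightarrow>
    (\<exists>H. subspace H \<and> dim H = DIM('a) - 1 \<and> S = sphere 0 1 \<inter> H)"

definition concentrated_on :: "'a measure \<Rightarrow> 'a set \<Rightarrow> bool" where
  "concentrated_on M S \<longleftrightarrow> emeasure M (space M - S) = 0"

section \<open>Surface area measures\<close>

definition support_function :: "'a::euclidean_space set \<Rightarrow> 'a \<Rightarrow> real" where
  "support_function K u = (SUP x\<in>K. x \<bullet> u)"

definition outer_unit_normal :: "'a::euclidean_space set \<Rightarrow> 'a \<Rightarrow> 'a \<Rightarrow> bool" where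
  "outer_unit_normal K x u \<longleftrightarrow> norm u = 1 \<and> (\<forall>y\<in>K. y \<bullet> u \<le> x \<bullet> u)"

text \<open>The outer unit normal map \<open>\<nu>\<^sub>K\<close> is defined at the boundary points that have exactly one outer
  unit normal; for a convex body these are almost all boundary points.\<close>

definition regular_boundary :: "'a::euclidean_space set \<Rightarrow> 'a set" where
  "regular_boundary K = {x \<in> frontier K. \<exists>!u. outer_unit_normal K x u}"

definition normal_map :: "'a::euclidean_space set \<Rightarrow> 'a \<Rightarrow> 'a" where
  "normal_map K x = (THE u. outer_unit_normal K x u)"

definition surface_area_measure :: "'a::euclidean_space set \<Rightarrow> 'a measure" where
  "surface_area_measure K =
    measure_of (space borel_sphere) (sets borel_sphere)
      (\<lambda>\<omega>. hausdorff_measure (DIM('a) - 1) {x \<in> regular_boundary K. normal_map K x \<in> \<omega>})"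

definition Lp_surface_area_measure :: "real \<Rightarrow> 'a::euclidean_space set \<Rightarrow> 'a measure" where
  "Lp_surface_area_measure p K =
    density (surface_area_measure K) (\<lambda>u. ennreal (support_function K u powr (1 - p)))"

end

theory Submission
  imports Defs
begin

text \<open>Let \<open>\<plusminus> u i\<close>, \<open>i < N\<close>, be the support of \<open>\<mu>\<close> and \<open>q = - p\<close>. For \<open>h\<close> in the positive orthant let \<open>V h\<close>
  be the volume of the body \<open>{x. \<forall>i<N. \<bar>x \<bullet> u i\<bar> \<le> h i}\<close>, whose derivative along \<open>h i\<close> is twice the area of
  the facet with normal \<open>u i\<close>. A critical point of the energy \<open>V h + 2 / q * (\<Sum>i<N. c i * h i powr (- q))\<close>
  solves the problem, every facet being present automatically. It is a saddle: one minimizes over the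
  parallelotopes spanned by a basis of normals and maximizes in the remaining directions. The
  parallelotopes with normals in a fixed basis form an \<open>n\<close>-dimensional cell, the ridge, on which the energy is
  coercive. An ordering of the basis assigns every normal to one of \<open>n\<close> classes such that choosing one
  normal from each class gives a basis again. The set where the minimum of \<open>h\<close> over each class is 1 links
  the boundary of the ridge by the Poincare--Miranda theorem, and the energy is bounded on it. Without
  critical points an ascending gradient flow would push the ridge beyond this bound.

  Only the proportionality of the Hausdorff measure to the area on hyperplanes is needed, with a
  constant in \<open>(0, \<infinity>)\<close> that is absorbed in the weights \<open>c i\<close>; hence the isodiametric inequality is avoided.
  The area of a subset of a hyperplane is taken to be the volume of the right prism of height 1 over it.\<close>

section \<open>Hausdorff measure\<close>

text \<open>Direct minimization may lose facets: the energy explodes when some \<open>h i\<close>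
  tends to 0, but its derivative along \<open>h i\<close> turns negative again once the slab is too
  wide to touch the body. This is also the only failure of compactness, and it is harmless for an
  ascending flow. At bounded energy every \<open>h i\<close> is bounded below, so the body contains
  a fixed ball; then bounded volume bounds its diameter, and a wider slab has an empty face and a
  negative derivative, so that the flow pulls it back. On the linking set all \<open>h i\<close> are
  at least 1, which controls the singular terms, and the value 1 is attained in each class, which
  encloses the body in one of finitely many bounded intersections of slabs. At a critical point the
  area \<open>c i * h i powr (p - 1)\<close> is positive, so each face is nonempty and
  \<open>h i\<close> is the true support number. Working with slabs instead of half-spaces builds in
  the symmetry. Conversely, if all facet normals lay in one hyperplane, the polytope would contain
  the line orthogonal to it.\<close>

definition hausdorff_gauge :: "nat \<Rightarrow> 'a::metric_space set \<Rightarrow> ennreal" where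
  "hausdorff_gauge d C = (if C = {} then 0 else ennreal (unit_ball_vol (real d) * (diameter C / 2) ^ d))"

lemma hausdorff_gauge_empty [simp]: "hausdorff_gauge d {} = 0"
  by (simp add: hausdorff_gauge_def)

lemma hausdorff_premeasure_le:
  assumes "A \<subseteq> (\<Union>i. C i)" "\<And>i::nat. bounded (C i)" "\<And>i. diameter (C i) \<le> \<delta>"
  shows "hausdorff_premeasure d \<delta> A \<le> (\<Sum>i. hausdorff_gauge d (C i))"
  unfolding hausdorff_premeasure_def hausdorff_gauge_def
  by (rule INF_lower) (use assms in auto)

lemma hausdorff_premeasure_greatest:
  assumes "\<And>C :: nat \<Rightarrow> _. A \<subseteq> (\<Union>i. C i) \<Longrightarrow> (\<And>i. bounded (C i)) \<Longrightarrow> (\<And>i. diameter (C i) \<le> \<delta>)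
     \<Longrightarrow> x \<le> (\<Sum>i. hausdorff_gauge d (C i))"
  shows "x \<le> hausdorff_premeasure d \<delta> A"
  unfolding hausdorff_premeasure_def
  by (rule INF_greatest) (use assms in \<open>auto simp: hausdorff_gauge_def\<close>)

lemma hausdorff_premeasure_mono:
  "A \<subseteq> B \<Longrightarrow> hausdorff_premeasure d \<delta> A \<le> hausdorff_premeasure d \<delta> B"
  by (rule hausdorff_premeasure_greatest, rule hausdorff_premeasure_le) auto

lemma hausdorff_premeasure_antimono:
  "\<delta> \<le> \<delta>' \<Longrightarrow> hausdorff_premeasure d \<delta>' A \<le> hausdorff_premeasure d \<delta> A"
  by (rule hausdorff_premeasure_greatest, rule hausdorff_premeasure_le) (auto intro: order_trans)

lemma hausdorff_measure_upper:
  "\<delta> > 0 \<Longrightarrow> hausdorff_premeasure d \<delta> A \<le> hausdorff_measure d A"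
  unfolding hausdorff_measure_def by (rule SUP_upper) auto

lemma hausdorff_measure_least:
  "(\<And>\<delta>. \<delta> > 0 \<Longrightarrow> hausdorff_premeasure d \<delta> A \<le> x) \<Longrightarrow> hausdorff_measure d A \<le> x"
  unfolding hausdorff_measure_def by (rule SUP_least) auto

lemma hausdorff_measure_mono:
  "A \<subseteq> B \<Longrightarrow> hausdorff_measure d A \<le> hausdorff_measure d B"
  by (rule hausdorff_measure_least)
    (meson hausdorff_measure_upper hausdorff_premeasure_mono order_trans)

section \<open>Lipschitz images and finite unions\<close>

lemma diameter_Lipschitz_image_le:
  fixes f :: "'a::metric_space \<Rightarrow> 'b::real_normed_vector"
  assumes "bounded S" "\<And>x y. dist (f x) (f y) \<le> c * dist x y" "0 \<le> c"
  shows "bounded (f ` S)" "diameter (f ` S) \<le> c * diameter S"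
proof -
  have *: "dist (f x) (f y) \<le> c * diameter S" if "x \<in> S" "y \<in> S" for x y
    using assms diameter_bounded_bound[OF assms(1) that] by (meson mult_left_mono order_trans)
  show "bounded (f ` S)"
    unfolding bounded_two_points using * by blast
  have "0 \<le> c * diameter S"
    using assms by (simp add: diameter_ge_0)
  then show "diameter (f ` S) \<le> c * diameter S"
    using * by (intro diameter_le) (auto simp: dist_norm)
qed

lemma hausdorff_gauge_Lipschitz:
  fixes f :: "'a::metric_space \<Rightarrow> 'b::real_normed_vector"
  assumes "bounded S" "\<And>x y. dist (f x) (f y) \<le> c * dist x y" "0 \<le> c"
  shows "hausdorff_gauge d (f ` S) \<le> ennreal (c ^ d) * hausdorff_gauge d S"
proof -
  have "(diameter (f ` S) / 2) ^ d \<le> (c * diameter S / 2) ^ d"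
    using diameter_Lipschitz_image_le[OF assms] by (intro power_mono) (auto simp: diameter_ge_0)
  also have "\<dots> = c ^ d * (diameter S / 2) ^ d"
    by (simp add: power_mult_distrib power_divide)
  finally have "unit_ball_vol d * (diameter (f ` S) / 2) ^ d \<le> c ^ d * (unit_ball_vol d * (diameter S / 2) ^ d)"
    by (metis mult.left_commute mult_left_mono of_nat_0_le_iff unit_ball_vol_nonneg)
  then show ?thesis
    using assms by (auto simp: hausdorff_gauge_def ennreal_mult[symmetric] diameter_ge_0 intro!: ennreal_leI)
qed

lemma hausdorff_measure_Lipschitz_image:
  fixes f :: "'a::metric_space \<Rightarrow> 'b::real_normed_vector"
  assumes f: "\<And>x y. dist (f x) (f y) \<le> c * dist x y" and "0 < c"
  shows "hausdorff_measure d (f ` A) \<le> ennreal (c ^ d) * hausdorff_measure d A"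
proof (rule hausdorff_measure_least)
  fix \<delta> :: real assume "\<delta> > 0"
  \<comment> \<open>The constant stands on the left so that the right-hand side is an infimum over
    covers of A alone; a cover of mesh \<delta> / c is mapped to a cover of the image of mesh
    \<delta>.\<close>
  have "ennreal (1 / c ^ d) * hausdorff_premeasure d \<delta> (f ` A) \<le> hausdorff_premeasure d (\<delta> / c) A"
  proof (rule hausdorff_premeasure_greatest)
    fix C :: "nat \<Rightarrow> 'a set"
    assume C: "A \<subseteq> (\<Union>i. C i)" "\<And>i. bounded (C i)" "\<And>i. diameter (C i) \<le> \<delta> / c"
    have "hausdorff_premeasure d \<delta> (f ` A) \<le> (\<Sum>i. hausdorff_gauge d (f ` C i))"
    proof (rule hausdorff_premeasure_le)
      fix i
      show "bounded (f ` C i)"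
        using diameter_Lipschitz_image_le(1)[OF C(2) f] \<open>0 < c\<close> by auto
      have "diameter (f ` C i) \<le> c * diameter (C i)"
        using diameter_Lipschitz_image_le(2)[OF C(2) f] \<open>0 < c\<close> by auto
      also have "\<dots> \<le> \<delta>"
        using C(3)[of i] \<open>0 < c\<close> by (simp add: field_simps)
      finally show "diameter (f ` C i) \<le> \<delta>" .
    qed (use C(1) in blast)
    also have "\<dots> \<le> (\<Sum>i. ennreal (c ^ d) * hausdorff_gauge d (C i))"
      using \<open>0 < c\<close> by (intro suminf_le hausdorff_gauge_Lipschitz C f) auto
    also have "\<dots> = ennreal (c ^ d) * (\<Sum>i. hausdorff_gauge d (C i))"
      by simp
    finally have "ennreal (1 / c ^ d) * hausdorff_premeasure d \<delta> (f ` A)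
        \<le> ennreal (1 / c ^ d) * (ennreal (c ^ d) * (\<Sum>i. hausdorff_gauge d (C i)))"
      by (rule mult_left_mono) auto
    also have "\<dots> = (\<Sum>i. hausdorff_gauge d (C i))"
      using \<open>0 < c\<close> by (simp add: mult.assoc[symmetric] ennreal_mult[symmetric])
    finally show "ennreal (1 / c ^ d) * hausdorff_premeasure d \<delta> (f ` A)
        \<le> (\<Sum>i. hausdorff_gauge d (C i))" .
  qed
  also have "\<dots> \<le> hausdorff_measure d A"
    using \<open>0 < c\<close> \<open>\<delta> > 0\<close> by (intro hausdorff_measure_upper) auto
  finally have "ennreal (c ^ d) * (ennreal (1 / c ^ d) * hausdorff_premeasure d \<delta> (f ` A))
      \<le> ennreal (c ^ d) * hausdorff_measure d A"
    by (rule mult_left_mono) auto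
  then show "hausdorff_premeasure d \<delta> (f ` A) \<le> ennreal (c ^ d) * hausdorff_measure d A"
    using \<open>0 < c\<close> by (simp add: mult.assoc[symmetric] ennreal_mult[symmetric])
qed

text \<open>The reverse inequality is the Lipschitz bound for the inverse map, which by surjectivity
  is Lipschitz with constant 1 / c on the whole space.\<close>

lemma hausdorff_measure_similarity:
  fixes f :: "'a::real_normed_vector \<Rightarrow> 'b::real_normed_vector"
  assumes f: "\<And>x y. dist (f x) (f y) = c * dist x y" and "0 < c" and "surj f"
  shows "hausdorff_measure d (f ` A) = ennreal (c ^ d) * hausdorff_measure d A"
proof (rule antisym)
  show "hausdorff_measure d (f ` A) \<le> ennreal (c ^ d) * hausdorff_measure d A"
    by (rule hausdorff_measure_Lipschitz_image) (use assms in auto)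
  have inj: "inj f"
    by (rule injI) (metis assms(2) dist_eq_0_iff f less_irrefl mult_eq_0_iff)
  have "dist (inv f x) (inv f y) \<le> (1 / c) * dist x y" for x y
    using f[of "inv f x" "inv f y"] \<open>0 < c\<close> \<open>surj f\<close> by (simp add: surj_f_inv_f)
  then have "hausdorff_measure d (inv f ` f ` A) \<le> ennreal ((1 / c) ^ d) * hausdorff_measure d (f ` A)"
    by (rule hausdorff_measure_Lipschitz_image) (use assms in auto)
  moreover have "inv f ` f ` A = A"
    using inj by (simp add: image_inv_f_f)
  ultimately have "ennreal (c ^ d) * hausdorff_measure d A
      \<le> ennreal (c ^ d) * (ennreal ((1 / c) ^ d) * hausdorff_measure d (f ` A))"
    by (intro mult_left_mono) auto
  also have "\<dots> = hausdorff_measure d (f ` A)"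
    using \<open>0 < c\<close> by (simp add: mult.assoc[symmetric] ennreal_mult[symmetric] power_divide)
  finally show "ennreal (c ^ d) * hausdorff_measure d A \<le> hausdorff_measure d (f ` A)" .
qed

text \<open>A cover of A at the even indices and a cover of B at the odd ones interleave to a cover
  of the union. The two infima are then taken one after the other, moving the other summand across
  by subtraction; in \<open>ennreal\<close> this forces the value infinity to be treated
  apart.\<close>

lemma hausdorff_premeasure_Un_le:
  "hausdorff_premeasure d \<delta> (A \<union> B) \<le> hausdorff_premeasure d \<delta> A + hausdorff_premeasure d \<delta> B"
proof -
  have *: "hausdorff_premeasure d \<delta> (A \<union> B) \<le> (\<Sum>i. hausdorff_gauge d (C i)) + (\<Sum>i. hausdorff_gauge d (D i))"
    if C: "A \<subseteq> (\<Union>i. C i)" "\<And>i::nat. bounded (C i)" "\<And>i. diameter (C i) \<le> \<delta>"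
      and D: "B \<subseteq> (\<Union>i. D i)" "\<And>i::nat. bounded (D i)" "\<And>i. diameter (D i) \<le> \<delta>" for C D
  proof -
    define E where "E i = (if even i then C (i div 2) else D (i div 2))" for i
    have "C i \<subseteq> (\<Union>i. E i)" "D i \<subseteq> (\<Union>i. E i)" for i
      using UN_upper[of "2 * i" UNIV E] UN_upper[of "2 * i + 1" UNIV E] by (auto simp: E_def)
    then have "(\<Union>i. C i) \<subseteq> (\<Union>i. E i)" "(\<Union>i. D i) \<subseteq> (\<Union>i. E i)"
      by (simp_all only: UN_least)
    then have "A \<union> B \<subseteq> (\<Union>i. E i)"
      using C(1) D(1) by (metis Un_least order_trans)
    moreover have "bounded (E i)" "diameter (E i) \<le> \<delta>" for i
      using C(2,3) D(2,3) by (simp_all add: E_def)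
    ultimately have "hausdorff_premeasure d \<delta> (A \<union> B) \<le> (\<Sum>i. hausdorff_gauge d (E i))"
      by (rule hausdorff_premeasure_le)
    also have "\<dots> \<le> (\<Sum>i. hausdorff_gauge d (C i)) + (\<Sum>i. hausdorff_gauge d (D i))"
    proof (rule suminf_le_const)
      fix n
      \<comment> \<open>At the even cut 2 * n the interleaved sum splits exactly into the two
        partial sums.\<close>
      have "(\<Sum>i<n. hausdorff_gauge d (E i)) \<le> (\<Sum>i<2*n. hausdorff_gauge d (E i))"
        by (rule sum_mono2) auto
      also have "\<dots> = (\<Sum>i<n. hausdorff_gauge d (C i)) + (\<Sum>i<n. hausdorff_gauge d (D i))"
        by (induction n) (simp_all add: E_def ac_simps)
      also have "\<dots> \<le> (\<Sum>i. hausdorff_gauge d (C i)) + (\<Sum>i. hausdorff_gauge d (D i))"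
        by (intro add_mono sum_le_suminf) auto
      finally show "(\<Sum>i<n. hausdorff_gauge d (E i))
          \<le> (\<Sum>i. hausdorff_gauge d (C i)) + (\<Sum>i. hausdorff_gauge d (D i))" .
    qed auto
    finally show ?thesis .
  qed
  have **: "x \<le> a + y" if "x - y \<le> a" for x y a :: ennreal
    using that by (auto simp: ennreal_minus_le_iff add.commute)
  show ?thesis
  proof (cases "hausdorff_premeasure d \<delta> B = top")
    case False
    have "hausdorff_premeasure d \<delta> (A \<union> B) - hausdorff_premeasure d \<delta> B \<le> hausdorff_premeasure d \<delta> A"
    proof (rule hausdorff_premeasure_greatest)
      fix C :: "nat \<Rightarrow> 'a set"
      assume C: "A \<subseteq> (\<Union>i. C i)" "\<And>i::nat. bounded (C i)" "\<And>i. diameter (C i) \<le> \<delta>"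
      show "hausdorff_premeasure d \<delta> (A \<union> B) - hausdorff_premeasure d \<delta> B \<le> (\<Sum>i. hausdorff_gauge d (C i))"
      proof (cases "(\<Sum>i. hausdorff_gauge d (C i)) = top")
        case C': False
        have "hausdorff_premeasure d \<delta> (A \<union> B) - (\<Sum>i. hausdorff_gauge d (C i)) \<le> hausdorff_premeasure d \<delta> B"
          using C' C by (intro hausdorff_premeasure_greatest) (simp add: ennreal_minus_le_iff *)
        then show ?thesis
          using ** False by (fastforce simp: ennreal_minus_le_iff)
      qed simp
    qed
    then show ?thesis
      by (rule **)
  qed simp
qed

lemma hausdorff_measure_Un_le:
  "hausdorff_measure d (A \<union> B) \<le> hausdorff_measure d A + hausdorff_measure d B"
  by (rule hausdorff_measure_least)
    (meson add_mono hausdorff_measure_upper hausdorff_premeasure_Un_le order_trans)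

lemma hausdorff_measure_empty [simp]: "hausdorff_measure d {} = 0"
proof -
  have "hausdorff_premeasure d \<delta> ({}::'a set) \<le> (\<Sum>i. hausdorff_gauge d ({}::'a set))" if "\<delta> > 0" for \<delta>
    using that by (intro hausdorff_premeasure_le) auto
  then have "hausdorff_measure d ({}::'a set) \<le> 0"
    by (intro hausdorff_measure_least) simp
  then show ?thesis by simp
qed

lemma hausdorff_measure_UN_le:
  "finite I \<Longrightarrow> hausdorff_measure d (\<Union>i\<in>I. A i) \<le> (\<Sum>i\<in>I. hausdorff_measure d (A i))"
proof (induction I rule: finite_induct)
  case (insert i I)
  have "hausdorff_measure d (\<Union>i\<in>insert i I. A i) \<le> hausdorff_measure d (A i) + hausdorff_measure d (\<Union>i\<in>I. A i)"
    using hausdorff_measure_Un_le by auto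
  with insert show ?case
    by simp (meson add_left_mono order_trans)
qed simp

text \<open>Covering sets of diameter below \<open>r\<close> meet at most one of two sets at distance \<open>r\<close>.\<close>

lemma hausdorff_measure_Un_separated:
  assumes sep: "\<And>x y. x \<in> A \<Longrightarrow> y \<in> B \<Longrightarrow> r \<le> dist x y" and "r > 0"
  shows "hausdorff_measure d A + hausdorff_measure d B \<le> hausdorff_measure d (A \<union> B)"
proof -
  have *: "hausdorff_premeasure d \<delta> A + hausdorff_premeasure d \<delta> B \<le> hausdorff_premeasure d \<delta> (A \<union> B)"
    if "0 < \<delta>" "\<delta> < r" for \<delta>
  proof (rule hausdorff_premeasure_greatest)
    fix C :: "nat \<Rightarrow> 'a set"
    assume C: "A \<union> B \<subseteq> (\<Union>i. C i)" "\<And>i. bounded (C i)" "\<And>i. diameter (C i) \<le> \<delta>"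
    define CA where "CA i = (if C i \<inter> A = {} then {} else C i)" for i
    define CB where "CB i = (if C i \<inter> B = {} then {} else C i)" for i
    have "C i \<inter> A = {} \<or> C i \<inter> B = {}" for i
    proof (rule ccontr)
      assume "\<not> ?thesis"
      then obtain x y where "x \<in> C i" "x \<in> A" "y \<in> C i" "y \<in> B" by blast
      then show False
        using sep[of x y] diameter_bounded_bound[OF C(2)[of i], of x y] C(3)[of i] that by auto
    qed
    then have le: "hausdorff_gauge d (CA i) + hausdorff_gauge d (CB i) \<le> hausdorff_gauge d (C i)" for i
      by (auto simp: CA_def CB_def)
    have "hausdorff_premeasure d \<delta> A \<le> (\<Sum>i. hausdorff_gauge d (CA i))"
    proof (rule hausdorff_premeasure_le)
      show "A \<subseteq> (\<Union>i. CA i)"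
        using C(1) by (force simp: CA_def)
    qed (use C that in \<open>auto simp: CA_def\<close>)
    moreover have "hausdorff_premeasure d \<delta> B \<le> (\<Sum>i. hausdorff_gauge d (CB i))"
    proof (rule hausdorff_premeasure_le)
      show "B \<subseteq> (\<Union>i. CB i)"
        using C(1) by (force simp: CB_def)
    qed (use C that in \<open>auto simp: CB_def\<close>)
    ultimately have "hausdorff_premeasure d \<delta> A + hausdorff_premeasure d \<delta> B
        \<le> (\<Sum>i. hausdorff_gauge d (CA i)) + (\<Sum>i. hausdorff_gauge d (CB i))"
      by (rule add_mono)
    also have "\<dots> = (\<Sum>i. hausdorff_gauge d (CA i) + hausdorff_gauge d (CB i))"
      by (rule suminf_add) auto
    also have "\<dots> \<le> (\<Sum>i. hausdorff_gauge d (C i))"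
      by (rule suminf_le) (use le in auto)
    finally show "hausdorff_premeasure d \<delta> A + hausdorff_premeasure d \<delta> B \<le> (\<Sum>i. hausdorff_gauge d (C i))" .
  qed
  \<comment> \<open>A sum of two suprema over the mesh is a supremum over pairs of meshes; one
    common mesh below both of them and below r serves the two sets.\<close>
  have **: "hausdorff_premeasure d \<delta> A + hausdorff_premeasure d \<delta>' B \<le> hausdorff_measure d (A \<union> B)"
    if "0 < \<delta>" "0 < \<delta>'" for \<delta> \<delta>'
  proof -
    define \<delta>'' where "\<delta>'' = min (min \<delta> \<delta>') (r / 2)"
    have "hausdorff_premeasure d \<delta> A + hausdorff_premeasure d \<delta>' B
        \<le> hausdorff_premeasure d \<delta>'' A + hausdorff_premeasure d \<delta>'' B"
      by (intro add_mono hausdorff_premeasure_antimono) (auto simp: \<delta>''_def)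
    also have "\<dots> \<le> hausdorff_premeasure d \<delta>'' (A \<union> B)"
      using that \<open>r > 0\<close> by (intro *) (auto simp: \<delta>''_def)
    also have "\<dots> \<le> hausdorff_measure d (A \<union> B)"
      using that \<open>r > 0\<close> by (intro hausdorff_measure_upper) (auto simp: \<delta>''_def)
    finally show ?thesis .
  qed
  have "hausdorff_measure d A + hausdorff_measure d B
      = (SUP \<delta>\<in>{0<..}. SUP \<delta>'\<in>{0<..}. hausdorff_premeasure d \<delta> A + hausdorff_premeasure d \<delta>' B)"
    unfolding hausdorff_measure_def
    by (subst ennreal_SUP_add_left[symmetric], simp)
       (subst ennreal_SUP_add_right[symmetric], auto)
  also have "\<dots> \<le> hausdorff_measure d (A \<union> B)"
    using ** by (intro SUP_least) auto
  finally show ?thesis .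
qed

lemma hausdorff_measure_UN_separated:
  assumes "finite I" and "r > 0"
    and "\<And>i j x y. i \<in> I \<Longrightarrow> j \<in> I \<Longrightarrow> i \<noteq> j \<Longrightarrow> x \<in> A i \<Longrightarrow> y \<in> A j \<Longrightarrow> r \<le> dist x y"
  shows "(\<Sum>i\<in>I. hausdorff_measure d (A i)) \<le> hausdorff_measure d (\<Union>i\<in>I. A i)"
  using assms
proof (induction I rule: finite_induct)
  case (insert i I)
  have "(\<Sum>i\<in>insert i I. hausdorff_measure d (A i)) \<le> hausdorff_measure d (A i) + hausdorff_measure d (\<Union>i\<in>I. A i)"
    unfolding sum.insert[OF insert.hyps]
    by (rule add_left_mono, rule insert.IH[OF \<open>r > 0\<close>], rule insert.prems(2)) simp_all
  also have "\<dots> \<le> hausdorff_measure d (A i \<union> (\<Union>i\<in>I. A i))"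
  proof (rule hausdorff_measure_Un_separated[OF _ \<open>r > 0\<close>])
    fix x y assume "x \<in> A i" "y \<in> (\<Union>i\<in>I. A i)"
    then show "r \<le> dist x y" using insert.hyps insert.prems(2) by blast
  qed
  finally show ?case by simp
qed simp

section \<open>Areas in hyperplanes\<close>

text \<open>For a unit vector u, the point \<open>x + (h - x \<bullet> u) *\<^sub>R u\<close> is the
  projection of x to the hyperplane at height h. Hence only the slice of F at height h counts, F may
  be a whole body instead of its facet, and the prism lies over the heights from 0 to 1 whatever h
  is.\<close>

definition prism :: "'a::euclidean_space \<Rightarrow> real \<Rightarrow> 'a set \<Rightarrow> 'a set" where
  "prism u h F = {x. 0 \<le> x \<bullet> u \<and> x \<bullet> u \<le> 1 \<and> x + (h - x \<bullet> u) *\<^sub>R u \<in> F}"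

text \<open>Half-open, so that the grid cells partition the coordinate hyperplane.\<close>

definition unit_cell :: "'n::finite \<Rightarrow> (real ^ 'n) set" where
  "unit_cell k = {x. x $ k = 0 \<and> (\<forall>j. j \<noteq> k \<longrightarrow> 0 \<le> x $ j \<and> x $ j < 1)}"

text \<open>The parameter \<open>\<theta> < 1\<close> shrinks the cells of the grid of mesh \<open>1 / m\<close>, which makes them positively separated.\<close>

definition grid_map :: "real \<Rightarrow> real \<Rightarrow> ('n::finite \<Rightarrow> int) \<Rightarrow> real ^ 'n \<Rightarrow> real ^ 'n" where
  "grid_map m \<theta> z x = (\<chi> j. (\<theta> * x $ j + of_int (z j)) / m)"

text \<open>The entry at k is normalized to 0, so that distinct indices stand for disjoint
  cells.\<close>

definition grid_index :: "'n::finite \<Rightarrow> real \<Rightarrow> real ^ 'n \<Rightarrow> 'n \<Rightarrow> int" where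
  "grid_index k m x = (\<lambda>j. if j = k then 0 else \<lfloor>m * x $ j\<rfloor>)"

text \<open>The factor between Hausdorff measure and prism volume, since the prism over the unit
  cell has volume 1. All that is established about its value is that it lies strictly between 0 and
  infinity.\<close>

definition cell_measure :: "'n::finite \<Rightarrow> ennreal" where
  "cell_measure k = hausdorff_measure (CARD('n) - 1) (unit_cell k)"

lemma prod_If_eq_power:
  "(\<Prod>i\<in>UNIV. if i = (k::'n::finite) then 1 else c::'a::comm_monoid_mult) = c ^ (CARD('n) - 1)"
proof -
  have "(\<Prod>i\<in>UNIV. if i = k then 1 else c) = (\<Prod>i\<in>UNIV - {k}. if i = k then 1 else c)"
    by (subst prod.remove[of UNIV k]) auto
  also have "\<dots> = (\<Prod>i\<in>UNIV - {k}. c)"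
    by (rule prod.cong) auto
  finally show ?thesis
    by (simp add: card_Diff_singleton)
qed

lemma emeasure_lborel_cart_between:
  fixes a b :: "real ^ 'n"
  assumes "\<And>i. a $ i \<le> b $ i" "box a b \<subseteq> S" "S \<subseteq> cbox a b" "S \<in> sets borel"
  shows "emeasure lborel S = ennreal (\<Prod>i\<in>UNIV. b $ i - a $ i)"
proof -
  have ne: "cbox a b \<noteq> {}"
    using assms(1) by (auto simp: interval_ne_empty_cart)
  have le: "\<forall>i\<in>Basis. a \<bullet> i \<le> b \<bullet> i"
    using ne box_ne_empty(1) by blast
  have c: "emeasure lborel (cbox a b) = ennreal (\<Prod>i\<in>UNIV. b $ i - a $ i)"
    using content_cbox_cart[OF ne] emeasure_eq_ennreal_measure[of lborel "cbox a b"]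
      emeasure_lborel_cbox_finite[of a b] by (simp add: less_top)
  have "emeasure lborel (box a b) = emeasure lborel (cbox a b)"
    using le by (simp add: emeasure_lborel_cbox_eq emeasure_lborel_box_eq)
  moreover have "emeasure lborel (box a b) \<le> emeasure lborel S" "emeasure lborel S \<le> emeasure lborel (cbox a b)"
    using assms by (auto intro!: emeasure_mono)
  ultimately show ?thesis
    using c by auto
qed

section \<open>Counting the cells of a grid in a coordinate hyperplane\<close>

context
  fixes k :: "'n::finite" and m :: real
  assumes m: "m > 0"
begin

lemma grid_map_cell_iff:
  assumes "z k = 0"
  shows "x \<in> grid_map m 1 z ` unit_cell k \<longleftrightarrow>
    x $ k = 0 \<and> (\<forall>j. j \<noteq> k \<longrightarrow> of_int (z j) \<le> m * x $ j \<and> m * x $ j < of_int (z j) + 1)" (is "_ \<longleftrightarrow> ?R x")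
proof
  assume "x \<in> grid_map m 1 z ` unit_cell k"
  then show "?R x"
    using m assms by (auto simp: grid_map_def unit_cell_def)
next
  assume R: "?R x"
  have "x = grid_map m 1 z (\<chi> j. m * x $ j - of_int (z j))"
    using m by (auto simp: grid_map_def vec_eq_iff)
  moreover have "(\<chi> j. m * x $ j - of_int (z j)) \<in> unit_cell k"
    using R assms by (auto simp: unit_cell_def)
  ultimately show "x \<in> grid_map m 1 z ` unit_cell k" by blast
qed

lemma mem_grid_cell_index:
  "x $ k = 0 \<Longrightarrow> x \<in> grid_map m 1 (grid_index k m x) ` unit_cell k"
  by (subst grid_map_cell_iff) (auto simp: grid_index_def)

lemma grid_index_eqI:
  assumes "z k = 0" "x \<in> grid_map m 1 z ` unit_cell k"
  shows "grid_index k m x = z"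
proof
  fix j
  show "grid_index k m x j = z j"
    using assms(2) assms(1) unfolding grid_map_cell_iff[where z = z, OF assms(1)]
    by (auto simp: grid_index_def intro!: floor_unique)
qed

lemma grid_index_self [simp]: "grid_index k m x k = 0"
  by (simp add: grid_index_def)

lemma hausdorff_measure_grid_cell:
  assumes "\<theta> > 0"
  shows "hausdorff_measure (CARD('n) - 1) (grid_map m \<theta> z ` unit_cell k)
    = ennreal ((\<theta> / m) ^ (CARD('n) - 1)) * cell_measure k"
  unfolding cell_measure_def
proof (rule hausdorff_measure_similarity)
  fix x y :: "real ^ 'n"
  have "grid_map m \<theta> z x - grid_map m \<theta> z y = (\<theta> / m) *\<^sub>R (x - y)"
    by (simp add: grid_map_def vec_eq_iff diff_divide_distrib[symmetric] algebra_simps)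
  then show "dist (grid_map m \<theta> z x) (grid_map m \<theta> z y) = \<theta> / m * dist x y"
    using m assms by (simp add: dist_norm)
next
  have "y = grid_map m \<theta> z (\<chi> j. (m * y $ j - of_int (z j)) / \<theta>)" for y
    using m assms by (simp add: grid_map_def vec_eq_iff)
  then show "surj (grid_map m \<theta> z)" by (rule surjI[OF sym])
qed (use assms m in auto)

lemma finite_grid_index:
  assumes "bounded F"
  shows "finite (grid_index k m ` F)"
proof -
  obtain B where B: "\<And>x. x \<in> F \<Longrightarrow> norm x \<le> B"
    using assms bounded_iff by blast
  define c where "c = \<lceil>m * B\<rceil> + 1"
  have *: "- c \<le> \<lfloor>m * x $ j\<rfloor> \<and> \<lfloor>m * x $ j\<rfloor> \<le> c" if "x \<in> F" for x j
  proof -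
    have "\<bar>m * x $ j\<bar> \<le> m * B"
      using component_le_norm_cart[of x j] B[OF \<open>x \<in> F\<close>] m by (simp add: abs_mult)
    then show ?thesis
      unfolding c_def by linarith
  qed
  have "grid_index k m ` F \<subseteq> (UNIV \<rightarrow>\<^sub>E {- c..c} \<union> {0})"
    using * by (auto simp: grid_index_def)
  moreover have "finite ((UNIV::'n set) \<rightarrow>\<^sub>E {- c..c} \<union> {0})"
    by (rule finite_PiE) auto
  ultimately show ?thesis
    by (rule finite_subset)
qed

lemma hausdorff_measure_le_grid:
  assumes "bounded F" "\<And>x. x \<in> F \<Longrightarrow> x $ k = 0"
  shows "hausdorff_measure (CARD('n) - 1) F
    \<le> of_nat (card (grid_index k m ` F)) * (ennreal ((1 / m) ^ (CARD('n) - 1)) * cell_measure k)"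
proof -
  let ?C = "\<lambda>z. grid_map m 1 z ` unit_cell k" and ?Z = "grid_index k m ` F"
  have "F \<subseteq> (\<Union>z\<in>?Z. ?C z)"
    using mem_grid_cell_index assms(2) by auto
  then have "hausdorff_measure (CARD('n) - 1) F \<le> hausdorff_measure (CARD('n) - 1) (\<Union>z\<in>?Z. ?C z)"
    by (rule hausdorff_measure_mono)
  also have "\<dots> \<le> (\<Sum>z\<in>?Z. hausdorff_measure (CARD('n) - 1) (?C z))"
    by (intro hausdorff_measure_UN_le finite_grid_index assms)
  also have "\<dots> = of_nat (card ?Z) * (ennreal ((1 / m) ^ (CARD('n) - 1)) * cell_measure k)"
    using hausdorff_measure_grid_cell[of 1] by simp
  finally show ?thesis .
qed

text \<open>The shrunk cells are positively separated, so their measures add up: within a shrunk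
  cell a coordinate varies by at most \<theta> / m, and cells with different indices are offset by
  at least 1 / m in some coordinate, which leaves a gap of (1 - \<theta>) / m.\<close>

lemma grid_le_hausdorff_measure_shrunk:
  assumes "finite Z" "\<And>z. z \<in> Z \<Longrightarrow> z k = 0" "\<And>z. z \<in> Z \<Longrightarrow> grid_map m 1 z ` unit_cell k \<subseteq> M"
    and \<theta>: "0 < \<theta>" "\<theta> < 1"
  shows "of_nat (card Z) * (ennreal ((\<theta> / m) ^ (CARD('n) - 1)) * cell_measure k)
    \<le> hausdorff_measure (CARD('n) - 1) M"
proof -
  let ?C = "\<lambda>z. grid_map m \<theta> z ` unit_cell k"
  have "of_nat (card Z) * (ennreal ((\<theta> / m) ^ (CARD('n) - 1)) * cell_measure k)
      = (\<Sum>z\<in>Z. hausdorff_measure (CARD('n) - 1) (?C z))"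
    using hausdorff_measure_grid_cell[of \<theta>] \<theta> by simp
  also have "\<dots> \<le> hausdorff_measure (CARD('n) - 1) (\<Union>z\<in>Z. ?C z)"
  proof (rule hausdorff_measure_UN_separated[where r = "(1 - \<theta>) / m"])
    fix z z' x' y' assume z: "z \<in> Z" "z' \<in> Z" "z \<noteq> z'" and "x' \<in> ?C z" "y' \<in> ?C z'"
    then obtain x y where x: "x \<in> unit_cell k" "x' = grid_map m \<theta> z x"
      and y: "y \<in> unit_cell k" "y' = grid_map m \<theta> z' y" by blast
    obtain j where j: "z j \<noteq> z' j" using z(3) by blast
    then have "j \<noteq> k" using assms(2)[OF z(1)] assms(2)[OF z(2)] by metis
    then have *: "0 \<le> x $ j" "x $ j < 1" "0 \<le> y $ j" "y $ j < 1"
      using x(1) y(1) by (auto simp: unit_cell_def)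
    have "\<theta> * \<bar>x $ j - y $ j\<bar> \<le> \<theta> * 1"
      using * \<theta> by (intro mult_left_mono) auto
    then have "\<bar>\<theta> * x $ j - \<theta> * y $ j\<bar> \<le> \<theta>"
      using \<theta> by (simp add: abs_mult right_diff_distrib[symmetric])
    moreover have "1 \<le> \<bar>real_of_int (z j) - real_of_int (z' j)\<bar>"
      using j by linarith
    ultimately have "1 - \<theta> \<le> \<bar>(\<theta> * x $ j + of_int (z j)) - (\<theta> * y $ j + of_int (z' j))\<bar>"
      by linarith
    then have "(1 - \<theta>) / m \<le> \<bar>(x' - y') $ j\<bar>"
      using m unfolding x y grid_map_def
      by (simp add: diff_divide_distrib[symmetric] abs_divide divide_right_mono)
    also have "\<dots> \<le> dist x' y'"
      unfolding dist_norm by (rule component_le_norm_cart)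
    finally show "(1 - \<theta>) / m \<le> dist x' y'" .
  qed (use assms m in auto)
  also have "\<dots> \<le> hausdorff_measure (CARD('n) - 1) M"
  proof (rule hausdorff_measure_mono)
    have "?C z \<subseteq> grid_map m 1 z ` unit_cell k" for z
    proof
      fix x' assume "x' \<in> ?C z"
      then obtain x where x: "x \<in> unit_cell k" "x' = grid_map m \<theta> z x" by blast
      have "\<theta> *\<^sub>R x \<in> unit_cell k"
        using x(1) \<theta> mult_strict_mono'[of \<theta> 1 _ 1] by (auto simp: unit_cell_def)
      then show "x' \<in> grid_map m 1 z ` unit_cell k"
        by (rule rev_image_eqI) (use x(2) in \<open>simp add: grid_map_def vec_eq_iff\<close>)
    qed
    then show "(\<Union>z\<in>Z. ?C z) \<subseteq> M"
      using assms(3) by blast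
  qed
  finally show ?thesis .
qed

lemma prism_grid_cell:
  assumes "z k = 0"
  shows "prism (axis k 1) 0 (grid_map m 1 z ` unit_cell k) = {x. 0 \<le> x $ k \<and> x $ k \<le> 1 \<and>
    (\<forall>j. j \<noteq> k \<longrightarrow> of_int (z j) \<le> m * x $ j \<and> m * x $ j < of_int (z j) + 1)}"
  unfolding prism_def grid_map_cell_iff[where z = z, OF assms]
  by (auto simp: inner_axis) (auto simp: axis_def)

lemma sets_prism_grid_cell:
  assumes "z k = 0"
  shows "prism (axis k 1) 0 (grid_map m 1 z ` unit_cell k) \<in> sets borel"
  unfolding prism_grid_cell[where z = z, OF assms] by measurable

lemma emeasure_prism_grid_cell:
  assumes "z k = 0"
  shows "emeasure lborel (prism (axis k 1) 0 (grid_map m 1 z ` unit_cell k))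
    = ennreal ((1 / m) ^ (CARD('n) - 1))"
proof -
  define a :: "real ^ 'n" where "a = (\<chi> j. if j = k then 0 else of_int (z j) / m)"
  define b :: "real ^ 'n" where "b = (\<chi> j. if j = k then 1 else (of_int (z j) + 1) / m)"
  have "emeasure lborel (prism (axis k 1) 0 (grid_map m 1 z ` unit_cell k)) = ennreal (\<Prod>i\<in>UNIV. b $ i - a $ i)"
  proof (rule emeasure_lborel_cart_between)
    show "a $ i \<le> b $ i" for i
      using m by (simp add: a_def b_def divide_right_mono)
    show "box a b \<subseteq> prism (axis k 1) 0 (grid_map m 1 z ` unit_cell k)"
      unfolding prism_grid_cell[where z = z, OF assms]
    proof clarsimp
      fix x :: "real ^ 'n" assume x: "x \<in> box a b"
      have "x $ k > 0" "x $ k < 1" using x by (auto simp: mem_box_cart a_def b_def dest: spec[of _ k])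
      moreover have "of_int (z j) / m < x $ j \<and> x $ j < (of_int (z j) + 1) / m" if "j \<noteq> k" for j
        using x that by (auto simp: mem_box_cart a_def b_def dest: spec[of _ j])
      ultimately show "0 \<le> x $ k \<and> x $ k \<le> 1 \<and>
        (\<forall>j. j \<noteq> k \<longrightarrow> of_int (z j) \<le> m * x $ j \<and> m * x $ j < of_int (z j) + 1)"
        using m by (force simp: field_simps)
    qed
    show "prism (axis k 1) 0 (grid_map m 1 z ` unit_cell k) \<subseteq> cbox a b"
      unfolding prism_grid_cell[where z = z, OF assms] using m
      by (force simp: mem_box_cart a_def b_def field_simps)
  qed (rule sets_prism_grid_cell[where z = z, OF assms])
  also have "(\<Prod>i\<in>UNIV. b $ i - a $ i) = (\<Prod>i\<in>UNIV. if i = k then 1 else 1 / m)"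
    using m by (intro prod.cong) (auto simp: a_def b_def field_simps)
  finally show ?thesis
    by (simp only: prod_If_eq_power)
qed

text \<open>The same number of cells that bounds the Hausdorff measure bounds the prism volume, the
  weight of a cell differing only by the factor \<open>cell_measure k\<close>. The proportionality
  comes from comparing both quantities with this number.\<close>

lemma emeasure_prism_le_grid:
  assumes "bounded F" "\<And>x. x \<in> F \<Longrightarrow> x $ k = 0"
  shows "emeasure lborel (prism (axis k 1) 0 F)
    \<le> of_nat (card (grid_index k m ` F)) * ennreal ((1 / m) ^ (CARD('n) - 1))"
proof -
  let ?P = "\<lambda>z. prism (axis k 1) 0 (grid_map m 1 z ` unit_cell k)" and ?Z = "grid_index k m ` F"
  have "prism (axis k 1) 0 F \<subseteq> (\<Union>z\<in>?Z. ?P z)"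
  proof
    fix x assume x: "x \<in> prism (axis k 1) 0 F"
    let ?y = "x + (0 - x \<bullet> axis k 1) *\<^sub>R axis k 1"
    have "?y \<in> F" using x by (simp add: prism_def)
    moreover from this have "x \<in> ?P (grid_index k m ?y)"
      using x mem_grid_cell_index[of ?y] assms(2)[of ?y] by (simp add: prism_def)
    ultimately show "x \<in> (\<Union>z\<in>?Z. ?P z)" by blast
  qed
  then have "emeasure lborel (prism (axis k 1) 0 F) \<le> emeasure lborel (\<Union>z\<in>?Z. ?P z)"
    using finite_grid_index[OF assms(1)] by (intro emeasure_mono sets.finite_UN) (auto simp: sets_prism_grid_cell)
  also have "\<dots> \<le> (\<Sum>z\<in>?Z. emeasure lborel (?P z))"
    using finite_grid_index[OF assms(1)] by (intro emeasure_subadditive_finite) (auto intro!: sets_prism_grid_cell)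
  also have "\<dots> = of_nat (card ?Z) * ennreal ((1 / m) ^ (CARD('n) - 1))"
    by (subst sum.cong[OF refl emeasure_prism_grid_cell]) auto
  finally show ?thesis .
qed

lemma grid_le_emeasure_prism:
  assumes "finite Z" "\<And>z. z \<in> Z \<Longrightarrow> z k = 0" "\<And>z. z \<in> Z \<Longrightarrow> grid_map m 1 z ` unit_cell k \<subseteq> F"
    and "prism (axis k 1) 0 F \<in> sets borel"
  shows "of_nat (card Z) * ennreal ((1 / m) ^ (CARD('n) - 1)) \<le> emeasure lborel (prism (axis k 1) 0 F)"
proof -
  let ?P = "\<lambda>z. prism (axis k 1) 0 (grid_map m 1 z ` unit_cell k)"
  have "of_nat (card Z) * ennreal ((1 / m) ^ (CARD('n) - 1)) = (\<Sum>z\<in>Z. emeasure lborel (?P z))"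
    using assms(2) by (subst sum.cong[OF refl emeasure_prism_grid_cell]) auto
  also have "\<dots> = emeasure lborel (\<Union>z\<in>Z. ?P z)"
  proof (rule sum_emeasure)
    show "disjoint_family_on ?P Z"
      unfolding disjoint_family_on_def
    proof (intro ballI impI)
      fix z z' assume "z \<in> Z" "z' \<in> Z" "z \<noteq> z'"
      then have "grid_map m 1 z ` unit_cell k \<inter> grid_map m 1 z' ` unit_cell k = {}"
        using grid_index_eqI assms(2) by (metis disjoint_iff)
      then show "?P z \<inter> ?P z' = {}"
        unfolding prism_def by blast
    qed
  qed (use assms sets_prism_grid_cell in auto)
  also have "\<dots> \<le> emeasure lborel (prism (axis k 1) 0 F)"
    using assms(3,4) by (intro emeasure_mono) (auto simp: prism_def)
  finally show ?thesis .
qed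

lemma dist_grid_cell_le:
  assumes "z k = 0" "x \<in> grid_map m 1 z ` unit_cell k" "y \<in> grid_map m 1 z ` unit_cell k"
  shows "dist x y \<le> CARD('n) / m"
proof -
  have "\<bar>(x - y) $ j\<bar> \<le> 1 / m" for j
  proof (cases "j = k")
    case True
    then show ?thesis using assms(2,3) m unfolding grid_map_cell_iff[where z = z, OF assms(1)] by simp
  next
    case False
    then have "of_int (z j) \<le> m * x $ j \<and> m * x $ j < of_int (z j) + 1"
      "of_int (z j) \<le> m * y $ j \<and> m * y $ j < of_int (z j) + 1"
      using assms(2,3) unfolding grid_map_cell_iff[where z = z, OF assms(1)] by auto
    then have "\<bar>m * (x - y) $ j\<bar> \<le> 1"
      by (simp add: right_diff_distrib) linarith
    then show ?thesis
      using m by (simp add: abs_mult pos_le_divide_eq mult.commute)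
  qed
  then have "(\<Sum>j\<in>UNIV. \<bar>(x - y) $ j\<bar>) \<le> (\<Sum>j\<in>(UNIV::'n set). 1 / m)"
    by (intro sum_mono) auto
  then show ?thesis
    using norm_le_l1_cart[of "x - y"] by (simp add: dist_norm)
qed

end

text \<open>The library states the change of variables formula for linear maps only for index types of class
  \<^class>\<open>wellorder\<close>; a well-ordered copy of the index type transfers it to an arbitrary finite one.\<close>

typedef (overloaded) 'a wo_copy = "UNIV :: 'a set" by simp

instance wo_copy :: (finite) finite
proof
  have "(UNIV :: 'a wo_copy set) = Abs_wo_copy ` UNIV"
    by (metis Abs_wo_copy_cases UNIV_I surj_def)
  then show "finite (UNIV :: 'a wo_copy set)"
    by (metis finite finite_imageI)
qed

instantiation wo_copy :: (finite) wellorder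
begin

definition less_eq_wo_copy :: "'a wo_copy \<Rightarrow> 'a wo_copy \<Rightarrow> bool" where
  "less_eq_wo_copy x y \<longleftrightarrow> to_nat (Rep_wo_copy x) \<le> to_nat (Rep_wo_copy y)"

definition less_wo_copy :: "'a wo_copy \<Rightarrow> 'a wo_copy \<Rightarrow> bool" where
  "less_wo_copy x y \<longleftrightarrow> to_nat (Rep_wo_copy x) < to_nat (Rep_wo_copy y)"

instance
proof
  fix P :: "'a wo_copy \<Rightarrow> bool" and a
  assume "\<And>x. (\<And>y. y < x \<Longrightarrow> P y) \<Longrightarrow> P x"
  then show "P a"
    unfolding less_wo_copy_def
    by (rule measure_induct_rule[where f = "\<lambda>x. to_nat (Rep_wo_copy x)"]) blast
qed (auto simp: less_eq_wo_copy_def less_wo_copy_def Rep_wo_copy_inject)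

end

section \<open>Volumes under linear bijections\<close>

definition to_wo :: "real ^ 'n \<Rightarrow> real ^ 'n::finite wo_copy" where
  "to_wo x = (\<chi> i. x $ Rep_wo_copy i)"

definition of_wo :: "real ^ 'n::finite wo_copy \<Rightarrow> real ^ 'n" where
  "of_wo y = (\<chi> i. y $ Abs_wo_copy i)"

lemma to_wo_of_wo [simp]: "to_wo (of_wo y) = y" and of_wo_to_wo [simp]: "of_wo (to_wo x) = x"
  by (simp_all add: to_wo_def of_wo_def vec_eq_iff Rep_wo_copy_inverse Abs_wo_copy_inverse)

lemma linear_to_wo: "linear to_wo" and linear_of_wo: "linear of_wo"
  by (auto simp: to_wo_def of_wo_def vec_eq_iff intro!: linearI)

lemma continuous_to_wo: "continuous_on A to_wo" and continuous_of_wo: "continuous_on B of_wo"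
  using linear_continuous_on linear_to_wo linear_of_wo linear_conv_bounded_linear by blast+

lemma bij_Rep_wo_copy: "bij (Rep_wo_copy :: 'n wo_copy \<Rightarrow> 'n)"
  by (rule bijI') (auto simp: Rep_wo_copy_inject intro: Abs_wo_copy_inverse[symmetric])

lemma inner_to_wo: "to_wo x \<bullet> to_wo y = x \<bullet> (y :: real ^ 'n)"
  unfolding inner_vec_def to_wo_def vec_lambda_beta
  using sum.reindex_bij_betw[OF bij_Rep_wo_copy, of "\<lambda>i. x $ i \<bullet> y $ i"] by simp

lemma lborel_distr_to_wo: "lborel = distr lborel borel (to_wo :: real ^ 'n \<Rightarrow> _)"
proof (rule lborel_eqI)
  fix l u :: "real ^ 'n wo_copy"
  assume le: "\<And>b. b \<in> Basis \<Longrightarrow> l \<bullet> b \<le> u \<bullet> b"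
  then have le': "l $ i \<le> u $ i" for i
    by (simp add: cart_eq_inner_axis axis_in_Basis_iff)
  have "(to_wo :: real ^ 'n \<Rightarrow> _) -` box l u = box (of_wo l) (of_wo u)"
  proof (intro set_eqI)
    fix x :: "real ^ 'n"
    have "x \<in> to_wo -` box l u \<longleftrightarrow> (\<forall>i. l $ i < x $ Rep_wo_copy i \<and> x $ Rep_wo_copy i < u $ i)"
      by (auto simp: mem_box_cart to_wo_def)
    also have "\<dots> \<longleftrightarrow> (\<forall>i. l $ Abs_wo_copy i < x $ i \<and> x $ i < u $ Abs_wo_copy i)"
      by (metis Abs_wo_copy_inverse Rep_wo_copy_inverse UNIV_I)
    finally show "x \<in> to_wo -` box l u \<longleftrightarrow> x \<in> box (of_wo l) (of_wo u)"
      by (auto simp: mem_box_cart of_wo_def)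
  qed
  then have "emeasure (distr lborel borel (to_wo :: real ^ 'n \<Rightarrow> _)) (box l u) = emeasure lborel (box (of_wo l) (of_wo u))"
    by (subst emeasure_distr) (auto intro!: borel_measurable_continuous_onI continuous_to_wo)
  also have "\<dots> = ennreal (\<Prod>i\<in>UNIV. of_wo u $ i - of_wo l $ i)"
    using le' by (intro emeasure_lborel_cart_between) (auto simp: of_wo_def box_subset_cbox)
  also have "(\<Prod>i\<in>UNIV. of_wo u $ i - of_wo l $ i) = (\<Prod>i\<in>UNIV. u $ i - l $ i)"
    using prod.reindex_bij_betw[OF bij_Rep_wo_copy, of "\<lambda>i. of_wo u $ i - of_wo l $ i"]
    by (simp add: of_wo_def Rep_wo_copy_inverse)
  also have "ennreal \<dots> = emeasure lborel (box l u)"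
    using le' by (intro emeasure_lborel_cart_between[symmetric]) (auto simp: box_subset_cbox)
  also have "\<dots> = ennreal (\<Prod>b\<in>Basis. (u - l) \<bullet> b)"
    using le by (rule emeasure_lborel_box)
  finally show "emeasure (distr lborel borel (to_wo :: real ^ 'n \<Rightarrow> _)) (box l u) = ennreal (\<Prod>b\<in>Basis. (u - l) \<bullet> b)" .
qed simp

lemma compact_to_wo: "compact S \<Longrightarrow> compact (to_wo ` S)"
  by (intro compact_continuous_image continuous_to_wo)

lemma emeasure_to_wo_image:
  assumes "compact S"
  shows "emeasure lborel (to_wo ` S) = emeasure lborel (S :: (real ^ 'n) set)"
proof -
  have "emeasure lborel (to_wo ` S) = emeasure (distr lborel borel (to_wo :: real ^ 'n \<Rightarrow> _)) (to_wo ` S)"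
    using lborel_distr_to_wo by metis
  also have "\<dots> = emeasure lborel (to_wo -` to_wo ` S)"
    using borel_compact[OF compact_to_wo[OF assms]]
    by (subst emeasure_distr) (auto intro!: borel_measurable_continuous_onI continuous_to_wo)
  also have "to_wo -` to_wo ` S = S"
    by (auto dest: arg_cong[where f = of_wo])
  finally show ?thesis .
qed

text \<open>Conjugation by the volume-preserving \<open>to_wo\<close> leads to the determinant
  formula. Compactness keeps all the images Borel. The orthogonal case is recorded with c = 1
  because a change of frame must preserve areas.\<close>

lemma emeasure_linear_image_compact:
  fixes f :: "real ^ 'n \<Rightarrow> real ^ 'n"
  assumes "linear f" "inj f"
  obtains c where "c > 0" "orthogonal_transformation f \<Longrightarrow> c = 1"
    "\<And>S. compact S \<Longrightarrow> emeasure lborel (f ` S) = ennreal c * emeasure lborel S"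
proof -
  define g where "g = to_wo \<circ> f \<circ> of_wo"
  have g: "linear g" "inj g"
    using assms unfolding g_def
    by (auto intro!: linear_compose linear_to_wo linear_of_wo inj_compose) (metis injI to_wo_of_wo of_wo_to_wo)+
  have cont: "continuous_on S f" for S
    using assms linear_continuous_on linear_conv_bounded_linear by blast
  define c where "c = \<bar>det (matrix g)\<bar>"
  have c: "c > 0"
    using g det_nz_iff_inj[of g] by (simp add: c_def)
  have lm: "compact S \<Longrightarrow> S \<in> lmeasurable" for S :: "(real ^ 'n wo_copy) set"
    by (rule lmeasurable_compact)
  have eq: "emeasure lborel T = ennreal (measure lebesgue T)" if "compact T" for T :: "(real ^ 'n wo_copy) set"
    using that by (simp add: borel_compact emeasure_eq_ennreal_measure emeasure_compact_finite[THEN less_imp_neq, unfolded infinity_ennreal_def])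
  have img: "to_wo ` f ` S = g ` to_wo ` S" for S
    by (auto simp: g_def image_image)
  have main: "emeasure lborel (f ` S) = ennreal (measure lebesgue (g ` to_wo ` S))" if "compact S" for S
  proof -
    have "compact (f ` S)" using that cont by (rule compact_continuous_image[rotated])
    then have "emeasure lborel (f ` S) = emeasure lborel (to_wo ` f ` S)"
      by (rule emeasure_to_wo_image[symmetric])
    also have "\<dots> = ennreal (measure lebesgue (to_wo ` f ` S))"
      using \<open>compact (f ` S)\<close> by (intro eq compact_to_wo)
    finally show ?thesis by (simp add: img)
  qed
  have main': "emeasure lborel S = ennreal (measure lebesgue (to_wo ` S))" if "compact S" for S :: "(real ^ 'n) set"
    using emeasure_to_wo_image[OF that] eq[OF compact_to_wo[OF that]] by simp
  show ?thesis
  proof (cases "orthogonal_transformation f")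
    case True
    have "of_wo x \<bullet> of_wo y = x \<bullet> y" for x y :: "real ^ 'n wo_copy"
      using inner_to_wo[of "of_wo x" "of_wo y"] by simp
    then have "orthogonal_transformation g"
      using True g by (simp add: orthogonal_transformation_def g_def inner_to_wo)
    then have "measure lebesgue (g ` to_wo ` S) = measure lebesgue (to_wo ` S)" if "compact S" for S
      using that by (intro measure_orthogonal_image lm compact_to_wo)
    then show ?thesis
      using main main' by (intro that[of 1]) auto
  next
    case False
    show ?thesis
    proof (rule that[OF c])
      fix S :: "(real ^ 'n) set" assume S: "compact S"
      have "measure lebesgue (g ` to_wo ` S) = c * measure lebesgue (to_wo ` S)"
        unfolding c_def using S g by (intro measure_linear_image lm compact_to_wo)
      then show "emeasure lborel (f ` S) = ennreal c * emeasure lborel S"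
        using main[OF S] main'[OF S] c by (simp add: ennreal_mult')
    qed (use False in simp)
  qed
qed

section \<open>The constant is finite and positive\<close>

lemma hausdorff_premeasure_UN_le:
  assumes "finite I" "\<delta> \<ge> 0" "\<And>i. i \<in> I \<Longrightarrow> bounded (A i) \<and> diameter (A i) \<le> \<delta>"
  shows "hausdorff_premeasure d \<delta> (\<Union>i\<in>I. A i) \<le> (\<Sum>i\<in>I. hausdorff_gauge d (A i))"
  using assms
proof (induction I rule: finite_induct)
  case empty
  have "hausdorff_premeasure d \<delta> ({} :: 'b set) \<le> (\<Sum>i. hausdorff_gauge d ({} :: 'b set))"
    using empty by (intro hausdorff_premeasure_le) auto
  then show ?case by simp
next
  case (insert i I)
  have "hausdorff_premeasure d \<delta> (A i) \<le> (\<Sum>j. hausdorff_gauge d (if j = 0 then A i else {}))"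
    using insert.prems by (intro hausdorff_premeasure_le) (auto split: if_splits)
  also have "\<dots> = hausdorff_gauge d (A i)"
    by (subst suminf_finite[of "{0::nat}"]) auto
  finally have "hausdorff_premeasure d \<delta> (A i) \<le> hausdorff_gauge d (A i)" .
  moreover have "hausdorff_premeasure d \<delta> (\<Union>j\<in>I. A j) \<le> (\<Sum>j\<in>I. hausdorff_gauge d (A j))"
    using insert.prems by (intro insert.IH) auto
  moreover have "hausdorff_premeasure d \<delta> (\<Union>j\<in>insert i I. A j)
      \<le> hausdorff_premeasure d \<delta> (A i) + hausdorff_premeasure d \<delta> (\<Union>j\<in>I. A j)"
    using hausdorff_premeasure_Un_le[of d \<delta> "A i"] by simp
  ultimately show ?case
    using insert.hyps by simp (meson add_mono order_trans)
qed

lemma sets_prism: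
  assumes "F \<in> sets borel"
  shows "prism u h F \<in> sets borel"
proof -
  have "(\<lambda>x. x + (h - x \<bullet> u) *\<^sub>R u) -` F \<in> sets borel"
    using measurable_sets[OF _ assms, of "\<lambda>x. x + (h - x \<bullet> u) *\<^sub>R u" borel] by simp
  moreover have "closed {x. 0 \<le> x \<bullet> u \<and> x \<bullet> u \<le> 1}"
    by (intro closed_Collect_conj closed_Collect_le continuous_intros)
  ultimately have "{x. 0 \<le> x \<bullet> u \<and> x \<bullet> u \<le> 1} \<inter> (\<lambda>x. x + (h - x \<bullet> u) *\<^sub>R u) -` F \<in> sets borel"
    by (simp add: borel_closed sets.Int)
  also have "{x. 0 \<le> x \<bullet> u \<and> x \<bullet> u \<le> 1} \<inter> (\<lambda>x. x + (h - x \<bullet> u) *\<^sub>R u) -` F = prism u h F"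
    by (auto simp: prism_def)
  finally show ?thesis .
qed

lemma bounded_prism:
  assumes "bounded F"
  shows "bounded (prism u h F)"
proof -
  obtain B where B: "\<And>x. x \<in> F \<Longrightarrow> norm x \<le> B"
    using assms bounded_iff by blast
  have "norm x \<le> B + (\<bar>h\<bar> + 1) * norm u" if "x \<in> prism u h F" for x
  proof -
    have "x = (x + (h - x \<bullet> u) *\<^sub>R u) - (h - x \<bullet> u) *\<^sub>R u" by simp
    then have "norm x \<le> norm (x + (h - x \<bullet> u) *\<^sub>R u) + norm ((h - x \<bullet> u) *\<^sub>R u)"
      by (metis norm_triangle_ineq4)
    also have "\<dots> \<le> B + (\<bar>h\<bar> + 1) * norm u"
      using that by (intro add_mono B) (auto simp: prism_def intro!: mult_right_mono)
    finally show ?thesis .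
  qed
  then show ?thesis
    using bounded_iff by blast
qed

lemma compact_prism:
  assumes "compact F"
  shows "compact (prism u h F)"
proof -
  have "closed ((\<lambda>x. x + (h - x \<bullet> u) *\<^sub>R u) -` F)"
    by (intro closed_vimage compact_imp_closed assms continuous_intros)
  moreover have "closed {x. 0 \<le> x \<bullet> u \<and> x \<bullet> u \<le> 1}"
    by (intro closed_Collect_conj closed_Collect_le continuous_intros)
  ultimately have "closed ({x. 0 \<le> x \<bullet> u \<and> x \<bullet> u \<le> 1} \<inter> (\<lambda>x. x + (h - x \<bullet> u) *\<^sub>R u) -` F)"
    by (rule closed_Int[rotated])
  also have "{x. 0 \<le> x \<bullet> u \<and> x \<bullet> u \<le> 1} \<inter> (\<lambda>x. x + (h - x \<bullet> u) *\<^sub>R u) -` F = prism u h F"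
    by (auto simp: prism_def)
  finally show ?thesis
    using bounded_prism[OF compact_imp_bounded[OF assms]] by (simp add: compact_eq_bounded_closed)
qed

lemma emeasure_prism_finite:
  "bounded F \<Longrightarrow> emeasure lborel (prism u h F) < \<infinity>"
  using emeasure_bounded_finite[OF bounded_prism] .

lemma prism_mono: "F \<subseteq> G \<Longrightarrow> prism u h F \<subseteq> prism u h G"
  by (auto simp: prism_def)

lemma bounded_unit_cell: "bounded (unit_cell k :: (real ^ 'n) set)"
proof -
  have "unit_cell k \<subseteq> cbox 0 (1 :: real ^ 'n)"
    by (auto simp: unit_cell_def mem_box_cart less_imp_le) (metis less_imp_le order_refl zero_le_one)+
  then show ?thesis
    using bounded_subset bounded_cbox by blast
qed

text \<open>The cells of mesh 1 / m that meet the unit cell are disjoint and lie over a fixed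
  bounded set, so their number is at most a constant times m^(n - 1). The sums of the gauges over
  these covers therefore stay bounded as the mesh shrinks.\<close>

lemma cell_measure_finite: "cell_measure (k::'n::finite) < \<infinity>"
proof -
  let ?d = "CARD('n) - 1" and ?Q = "unit_cell k :: (real ^ 'n) set"
  \<comment> \<open>The unit cell has norm at most n, and a grid cell that meets it adds a diameter
    of at most n.\<close>
  define W where "W = {x :: real ^ 'n. x $ k = 0} \<inter> cball 0 (2 * CARD('n))"
  define v where "v = emeasure lborel (prism (axis k 1) 0 W)"
  have "closed W"
    unfolding W_def by (intro closed_Int closed_cball closed_Collect_eq continuous_intros)
  then have W: "prism (axis k 1) 0 W \<in> sets borel"
    by (intro sets_prism borel_closed)
  have v: "v < \<infinity>"
    unfolding v_def by (rule emeasure_prism_finite) (simp add: W_def bounded_Int)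
  define c where "c = ennreal (unit_ball_vol (real ?d) * (CARD('n) / 2) ^ ?d)"
  have "hausdorff_premeasure ?d \<delta> ?Q \<le> c * v" if "\<delta> > 0" for \<delta>
  proof -
    \<comment> \<open>The second entry makes the cells small enough for \<delta>; the first bounds
      their diameter by n, so that they stay in W.\<close>
    define m where "m = max 1 (CARD('n) / \<delta>)"
    have m: "m > 0" "1 \<le> m" "CARD('n) / m \<le> \<delta>"
      using \<open>\<delta> > 0\<close> by (auto simp: m_def max_def field_simps)
    let ?Z = "grid_index k m ` ?Q"
    let ?C = "\<lambda>z. grid_map m 1 z ` ?Q"
    have fin: "finite ?Z"
      using finite_grid_index[OF m(1) bounded_unit_cell] .
    have diam: "bounded (?C z) \<and> diameter (?C z) \<le> CARD('n) / m" if "z \<in> ?Z" for z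
    proof
      have "z k = 0" using that by (auto simp: grid_index_def)
      then have *: "dist x y \<le> CARD('n) / m" if "x \<in> ?C z" "y \<in> ?C z" for x y
        using dist_grid_cell_le[OF m(1)] that by blast
      then show "bounded (?C z)"
        unfolding bounded_two_points by blast
      show "diameter (?C z) \<le> CARD('n) / m"
        using * m by (intro diameter_le) (auto simp: dist_norm)
    qed
    have "?Q \<subseteq> (\<Union>z\<in>?Z. ?C z)"
      using mem_grid_cell_index[OF m(1)] by (force simp: unit_cell_def[of k])
    then have "hausdorff_premeasure ?d \<delta> ?Q \<le> hausdorff_premeasure ?d \<delta> (\<Union>z\<in>?Z. ?C z)"
      by (rule hausdorff_premeasure_mono)
    also have "\<dots> \<le> (\<Sum>z\<in>?Z. hausdorff_gauge ?d (?C z))"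
      using diam m fin that by (intro hausdorff_premeasure_UN_le) (auto intro: order_trans)
    also have "\<dots> \<le> (\<Sum>z\<in>?Z. c * ennreal ((1 / m) ^ ?d))"
    proof (rule sum_mono)
      fix z assume z: "z \<in> ?Z"
      have "unit_ball_vol (real ?d) * (diameter (?C z) / 2) ^ ?d
          \<le> unit_ball_vol (real ?d) * (CARD('n) / m / 2) ^ ?d"
        using diam[OF z] by (intro mult_left_mono power_mono divide_right_mono) (auto simp: diameter_ge_0)
      also have "\<dots> = unit_ball_vol (real ?d) * (CARD('n) / 2) ^ ?d * (1 / m) ^ ?d"
        by (simp add: power_divide)
      finally show "hausdorff_gauge ?d (?C z) \<le> c * ennreal ((1 / m) ^ ?d)"
        using m unfolding hausdorff_gauge_def c_def by (auto simp: ennreal_mult[symmetric] intro!: ennreal_leI)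
    qed
    also have "\<dots> = c * (of_nat (card ?Z) * ennreal ((1 / m) ^ ?d))"
      by (simp add: mult_ac)
    also have "\<dots> \<le> c * v"
    proof (rule mult_left_mono)
      show "of_nat (card ?Z) * ennreal ((1 / m) ^ ?d) \<le> v"
        unfolding v_def
      proof (rule grid_le_emeasure_prism[OF m(1) fin])
        fix z assume "z \<in> ?Z"
        then obtain y where y: "y \<in> ?Q" "z = grid_index k m y" by blast
        have "norm y \<le> CARD('n)"
        proof -
          have "\<bar>y $ i\<bar> \<le> 1" for i
            using y(1) by (cases "i = k") (auto simp: unit_cell_def less_imp_le)
          then have "(\<Sum>i\<in>UNIV. \<bar>y $ i\<bar>) \<le> (\<Sum>i\<in>(UNIV::'n set). 1)"
            by (intro sum_mono) auto
          then show ?thesis using norm_le_l1_cart[of y] by simp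
        qed
        moreover have "norm x \<le> norm y + CARD('n) / m" if "x \<in> ?C z" for x
        proof -
          have "dist y x \<le> CARD('n) / m"
            using that mem_grid_cell_index[OF m(1), of y] y
            by (intro dist_grid_cell_le[OF m(1), of z]) (auto simp: unit_cell_def grid_index_def)
          then show ?thesis
            using norm_triangle_sub[of x y] by (simp add: dist_norm norm_minus_commute)
        qed
        moreover have "real CARD('n) / m \<le> CARD('n)"
          using m by (simp add: divide_le_eq mult_le_cancel_left1)
        moreover have "x $ k = 0" if "x \<in> ?C z" for x
          using that y by (subst (asm) grid_map_cell_iff[OF m(1)]) (auto simp: grid_index_def)
        ultimately show "?C z \<subseteq> W"
          unfolding W_def by fastforce
      qed (use W in \<open>auto simp: grid_index_def\<close>)
    qed simp
    finally show ?thesis .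
  qed
  then have "cell_measure k \<le> c * v"
    unfolding cell_measure_def by (rule hausdorff_measure_least)
  also have "\<dots> < \<infinity>"
    using v by (simp add: c_def ennreal_mult_less_top)
  finally show ?thesis .
qed

text \<open>A mass distribution argument: each covering set lies over a cube whose prism volume is a
  multiple of its gauge, and these prisms cover the prism over the unit cell, of volume 1. One mesh
  suffices, as each premeasure bounds the measure from below.\<close>

lemma cell_measure_pos: "cell_measure (k::'n::finite) > 0"
proof -
  let ?d = "CARD('n) - 1" and ?Q = "unit_cell k :: (real ^ 'n) set"
  \<comment> \<open>A set of diameter D lies over a cube of edge 2 * D around one of its points, and
    (2 * D)^d = 4^d * (D / 2)^d.\<close>
  define c where "c = unit_ball_vol (real ?d) / 4 ^ ?d"
  have c: "c > 0" by (simp add: c_def)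
  have "ennreal c \<le> hausdorff_premeasure ?d 1 ?Q"
  proof (rule hausdorff_premeasure_greatest)
    fix C :: "nat \<Rightarrow> (real ^ 'n) set"
    assume C: "?Q \<subseteq> (\<Union>i. C i)" "\<And>i. bounded (C i)" "\<And>i. diameter (C i) \<le> 1"
    define D where "D i = diameter (C i)" for i
    define p where "p i = (SOME x. x \<in> C i)" for i
    define a where "a i = (\<chi> j. if j = k then 0 else p i $ j - D i)" for i
    define b where "b i = (\<chi> j. if j = k then 1 else p i $ j + D i)" for i
    define B where "B i = (if C i = {} then {} else cbox (a i) (b i))" for i
    have D: "0 \<le> D i" for i
      using C(2) by (simp add: D_def diameter_ge_0)
    have "ennreal c = ennreal c * emeasure lborel (prism (axis k 1) 0 ?Q)"
      using emeasure_prism_grid_cell[of 1 "\<lambda>_. 0" k] by (simp add: grid_map_def vec_lambda_eta)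
    also have "\<dots> \<le> ennreal c * emeasure lborel (\<Union>i. B i)"
    proof (intro mult_left_mono emeasure_mono subsetI)
      fix x assume x: "x \<in> prism (axis k 1) 0 ?Q"
      let ?y = "x + (0 - x \<bullet> axis k 1) *\<^sub>R axis k 1"
      have "?y \<in> ?Q" using x by (simp add: prism_def)
      then obtain i where i: "?y \<in> C i" using C(1) by blast
      then have "p i \<in> C i" unfolding p_def by (rule someI)
      then have "dist ?y (p i) \<le> D i"
        unfolding D_def using i C(2) by (intro diameter_bounded_bound)
      then have y: "\<bar>(?y - p i) $ j\<bar> \<le> D i" for j
        using component_le_norm_cart[of "?y - p i" j] by (simp add: dist_norm)
      then have *: "\<bar>x $ j - p i $ j\<bar> \<le> D i" if "j \<noteq> k" for j
      proof -
        have "(?y - p i) $ j = x $ j - p i $ j"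
          using that by (simp add: axis_def[of k])
        then show ?thesis
          using y[of j] by (simp only:)
      qed
      have "0 \<le> x $ k" "x $ k \<le> 1"
        using x by (auto simp: prism_def inner_axis)
      then have "x \<in> cbox (a i) (b i)"
        using * by (auto simp: mem_box_cart a_def b_def abs_le_iff) (smt (verit))+
      then show "x \<in> (\<Union>i. B i)"
        using i by (auto simp: B_def)
    qed (auto simp: B_def)
    also have "\<dots> \<le> ennreal c * (\<Sum>i. emeasure lborel (B i))"
      by (intro mult_left_mono emeasure_subadditive_countably) (auto simp: B_def)
    also have "\<dots> = (\<Sum>i. ennreal c * emeasure lborel (B i))"
      by simp
    also have "\<dots> \<le> (\<Sum>i. hausdorff_gauge ?d (C i))"
    proof (rule suminf_le)
      fix i
      show "ennreal c * emeasure lborel (B i) \<le> hausdorff_gauge ?d (C i)"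
      proof (cases "C i = {}")
        case False
        have "emeasure lborel (cbox (a i) (b i)) = ennreal (\<Prod>j\<in>UNIV. b i $ j - a i $ j)"
          using D[of i] by (intro emeasure_lborel_cart_between) (auto simp: a_def b_def box_subset_cbox)
        also have "(\<Prod>j\<in>UNIV. b i $ j - a i $ j) = (\<Prod>j\<in>UNIV. if j = k then 1 else 2 * D i)"
          by (intro prod.cong) (auto simp: a_def b_def)
        finally have "emeasure lborel (cbox (a i) (b i)) = ennreal ((2 * D i) ^ ?d)"
          by (simp only: prod_If_eq_power)
        moreover have "c * (2 * D i) ^ ?d = unit_ball_vol (real ?d) * (D i / 2) ^ ?d"
        proof -
          have "(2 * D i) ^ ?d = 4 ^ ?d * (D i / 2) ^ ?d"
            by (subst power_mult_distrib[symmetric]) simp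
          then show ?thesis by (simp add: c_def)
        qed
        ultimately show ?thesis
          using False D[of i] c by (simp add: B_def hausdorff_gauge_def D_def ennreal_mult[symmetric])
      qed (simp add: B_def)
    qed auto
    finally show "ennreal c \<le> (\<Sum>i. hausdorff_gauge ?d (C i))" .
  qed
  also have "\<dots> \<le> cell_measure k"
    unfolding cell_measure_def by (rule hausdorff_measure_upper) simp
  finally show ?thesis
    using c by (metis ennreal_less_zero_iff order_less_le_trans)
qed

text \<open>The shrinking factor tends to 1; the limit may be taken inside the product because
  \<open>cell_measure k\<close> is finite.\<close>

lemma grid_le_hausdorff_measure:
  fixes k :: "'n::finite"
  assumes "m > 0" "finite Z" "\<And>z. z \<in> Z \<Longrightarrow> z k = 0" "\<And>z. z \<in> Z \<Longrightarrow> grid_map m 1 z ` unit_cell k \<subseteq> M"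
  shows "of_nat (card Z) * (ennreal ((1 / m) ^ (CARD('n) - 1)) * cell_measure k)
    \<le> hausdorff_measure (CARD('n) - 1) M"
proof -
  let ?\<theta> = "\<lambda>n. 1 - 1 / real (n + 2)"
  have "(\<lambda>n. 1 / real (n + 2)) \<longlonglongrightarrow> 0"
    by (rule LIMSEQ_ignore_initial_segment[OF lim_1_over_n])
  then have "(\<lambda>n. ?\<theta> n / m) \<longlonglongrightarrow> (1 - 0) / m"
    using assms(1) by (intro tendsto_intros) auto
  then have "(\<lambda>n. ennreal ((?\<theta> n / m) ^ (CARD('n) - 1))) \<longlonglongrightarrow> ennreal (((1 - 0) / m) ^ (CARD('n) - 1))"
    by (intro tendsto_ennrealI tendsto_power)
  then have "(\<lambda>n. of_nat (card Z) * (ennreal ((?\<theta> n / m) ^ (CARD('n) - 1)) * cell_measure k))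
      \<longlonglongrightarrow> of_nat (card Z) * (ennreal (((1 - 0) / m) ^ (CARD('n) - 1)) * cell_measure k)"
    using cell_measure_finite[of k]
    by (intro tendsto_mult_ennreal tendsto_const) (auto simp: ennreal_mult_eq_top_iff)
  then have "of_nat (card Z) * (ennreal (((1 - 0) / m) ^ (CARD('n) - 1)) * cell_measure k)
      \<le> hausdorff_measure (CARD('n) - 1) M"
    by (rule LIMSEQ_le_const2)
      (rule exI[of _ 0], intro allI impI, rule grid_le_hausdorff_measure_shrunk,
        use assms in auto)
  then show ?thesis by simp
qed


section \<open>Hausdorff measure and prism volume in a coordinate hyperplane\<close>

context
  fixes k :: "'n::finite"
begin

lemma grid_neighbourhood:
  assumes "m > 0" "z \<in> grid_index k m ` M" "\<And>x. x \<in> M \<Longrightarrow> x $ k = 0"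
  shows "grid_map m 1 z ` unit_cell k \<subseteq> {x. x $ k = 0 \<and> infdist x M \<le> CARD('n) / m}"
proof
  fix x assume x: "x \<in> grid_map m 1 z ` unit_cell k"
  obtain y where y: "y \<in> M" "z = grid_index k m y" using assms(2) by blast
  have z: "z k = 0" using assms(2) by (auto simp: grid_index_def)
  have "dist x y \<le> CARD('n) / m"
    using dist_grid_cell_le[OF assms(1) z x] mem_grid_cell_index[OF assms(1)] assms(3) y by blast
  then have "infdist x M \<le> CARD('n) / m"
    using infdist_le[OF y(1)] by (rule order_trans[rotated])
  moreover have "x $ k = 0"
    using x unfolding grid_map_cell_iff[where z = z, OF assms(1) z] by simp
  ultimately show "x \<in> {x. x $ k = 0 \<and> infdist x M \<le> CARD('n) / m}" by simp
qed

lemma compact_thickening: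
  assumes "compact M" "M \<noteq> {}" "\<epsilon> > 0"
  shows "compact {x :: real ^ 'n. x $ k = 0 \<and> infdist x M \<le> \<epsilon>}"
proof -
  have "closed {x :: real ^ 'n. x $ k = 0}"
    by (intro closed_Collect_eq continuous_intros)
  then have "compact ({x. x $ k = 0} \<inter> {x. infdist x M \<le> \<epsilon>})"
    using compact_infdist_le[OF assms(2,1,3)] by (rule closed_Int_compact)
  then show ?thesis by (simp add: Collect_conj_eq)
qed

lemma hausdorff_measure_le_thickening:
  fixes M :: "(real ^ 'n) set"
  assumes "compact M" "M \<noteq> {}" "\<And>x. x \<in> M \<Longrightarrow> x $ k = 0" "\<epsilon> > 0"
  shows "hausdorff_measure (CARD('n) - 1) M
    \<le> cell_measure k * emeasure lborel (prism (axis k 1) 0 {x. x $ k = 0 \<and> infdist x M \<le> \<epsilon>})"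
proof -
  \<comment> \<open>For this mesh a cell has diameter at most \<epsilon>, so every cell that meets M
    lies in the thickening.\<close>
  define m where "m = CARD('n) / \<epsilon>"
  have m: "m > 0" "CARD('n) / m = \<epsilon>" using assms(4) by (auto simp: m_def)
  let ?W = "{x. x $ k = 0 \<and> infdist x M \<le> \<epsilon>}"
  have "of_nat (card (grid_index k m ` M)) * ennreal ((1 / m) ^ (CARD('n) - 1))
      \<le> emeasure lborel (prism (axis k 1) 0 ?W)"
  proof (rule grid_le_emeasure_prism[OF m(1)])
    show "finite (grid_index k m ` M)"
      by (rule finite_grid_index[OF m(1) compact_imp_bounded[OF assms(1)]])
    show "prism (axis k 1) 0 ?W \<in> sets borel"
      by (intro sets_prism borel_compact compact_thickening assms)
    show "grid_map m 1 z ` unit_cell k \<subseteq> ?W" if "z \<in> grid_index k m ` M" for z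
      using grid_neighbourhood[OF m(1) that assms(3)] by (simp add: m(2))
  qed (auto simp: grid_index_def)
  then have "cell_measure k * (of_nat (card (grid_index k m ` M)) * ennreal ((1 / m) ^ (CARD('n) - 1)))
      \<le> cell_measure k * emeasure lborel (prism (axis k 1) 0 ?W)"
    by (rule mult_left_mono) simp
  moreover have "hausdorff_measure (CARD('n) - 1) M
      \<le> of_nat (card (grid_index k m ` M)) * (ennreal ((1 / m) ^ (CARD('n) - 1)) * cell_measure k)"
    by (intro hausdorff_measure_le_grid m compact_imp_bounded assms)
  ultimately show ?thesis
    by (simp add: mult_ac)
qed

text \<open>The thickenings of a compact set decrease to the set itself, and their prisms have
  finite volume, so the previous bound survives the limit.\<close>

lemma hausdorff_measure_le_prism_axis:
  fixes M :: "(real ^ 'n) set"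
  assumes "compact M" "\<And>x. x \<in> M \<Longrightarrow> x $ k = 0"
  shows "hausdorff_measure (CARD('n) - 1) M \<le> cell_measure k * emeasure lborel (prism (axis k 1) 0 M)"
proof (cases "M = {}")
  case False
  define W where "W j = {x. x $ k = 0 \<and> infdist x M \<le> 1 / real (Suc j)}" for j
  have W: "compact (W j)" for j
    unfolding W_def by (rule compact_thickening[OF assms(1) False]) simp
  have "(\<lambda>j. emeasure lborel (prism (axis k 1) 0 (W j)))
      \<longlonglongrightarrow> emeasure lborel (\<Inter>j. prism (axis k 1) 0 (W j))"
  proof (rule Lim_emeasure_decseq)
    show "range (\<lambda>j. prism (axis k 1) 0 (W j)) \<subseteq> sets lborel"
      using sets_prism[OF borel_compact[OF W]] by auto
    show "decseq (\<lambda>j. prism (axis k 1) 0 (W j))"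
    proof (rule decseq_SucI, rule prism_mono)
      fix j
      have "1 / real (Suc (Suc j)) \<le> 1 / real (Suc j)" by (simp add: field_simps)
      then show "W (Suc j) \<subseteq> W j" unfolding W_def by (auto simp del: of_nat_Suc)
    qed
    show "emeasure lborel (prism (axis k 1) 0 (W j)) \<noteq> \<infinity>" for j
      using emeasure_prism_finite[OF compact_imp_bounded[OF W[of j]], of "axis k 1" 0] by simp
  qed
  moreover have "(\<Inter>j. W j) = M"
  proof
    show "(\<Inter>j. W j) \<subseteq> M"
    proof
      fix x assume x: "x \<in> (\<Inter>j. W j)"
      then have "infdist x M \<le> 1 / real (Suc j)" for j
        by (auto simp: W_def)
      then have "infdist x M \<le> 0"
        using LIMSEQ_le_const[OF LIMSEQ_Suc[OF lim_1_over_n]] by blast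
      then show "x \<in> M"
        using in_closed_iff_infdist_zero[OF compact_imp_closed[OF assms(1)] False] infdist_nonneg[of x M]
        by (metis antisym)
    qed
    show "M \<subseteq> (\<Inter>j. W j)"
      using assms(2) by (auto simp: W_def)
  qed
  then have "(\<Inter>j. prism (axis k 1) 0 (W j)) = prism (axis k 1) 0 M"
    by (auto simp: prism_def)
  ultimately have "(\<lambda>j. emeasure lborel (prism (axis k 1) 0 (W j))) \<longlonglongrightarrow> emeasure lborel (prism (axis k 1) 0 M)"
    by simp
  then have "(\<lambda>j. cell_measure k * emeasure lborel (prism (axis k 1) 0 (W j)))
      \<longlonglongrightarrow> cell_measure k * emeasure lborel (prism (axis k 1) 0 M)"
    using cell_measure_finite[of k] by (intro ennreal_tendsto_cmult) auto
  then show ?thesis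
    by (rule LIMSEQ_le_const)
      (use hausdorff_measure_le_thickening[OF assms(1) False assms(2)] in \<open>auto simp: W_def simp del: of_nat_Suc\<close>)
qed simp

text \<open>The lower bound is claimed for a slightly larger compact set in place of M: it contains
  all the grid cells that meet M, so a single grid gives the estimate and no limit is taken. A given
  neighbourhood W of M leaves enough room; in the application W keeps the larger set inside an open
  facet.\<close>

lemma hausdorff_measure_ge_prism_axis:
  fixes M :: "(real ^ 'n) set"
  assumes "compact M" "\<And>x. x \<in> M \<Longrightarrow> x $ k = 0" "M \<subseteq> W" "open W"
  obtains M' where "compact M'" "M' \<subseteq> {x. x $ k = 0} \<inter> W"
    "cell_measure k * emeasure lborel (prism (axis k 1) 0 M) \<le> hausdorff_measure (CARD('n) - 1) M'"
proof (cases "M = {}")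
  case True
  then show ?thesis
    by (intro that[of "{}"]) (auto simp: prism_def)
next
  case False
  obtain \<epsilon> where \<epsilon>: "\<epsilon> > 0" "{x. infdist x M \<le> \<epsilon>} \<subseteq> W"
    using compact_in_open_separated[OF False assms(1,4,3)] by blast
  let ?M' = "{x. x $ k = 0 \<and> infdist x M \<le> \<epsilon>}"
  define m where "m = CARD('n) / \<epsilon>"
  have m: "m > 0" "CARD('n) / m = \<epsilon>" using \<epsilon> by (auto simp: m_def)
  have fin: "finite (grid_index k m ` M)"
    by (rule finite_grid_index[OF m(1) compact_imp_bounded[OF assms(1)]])
  have "cell_measure k * emeasure lborel (prism (axis k 1) 0 M)
      \<le> cell_measure k * (of_nat (card (grid_index k m ` M)) * ennreal ((1 / m) ^ (CARD('n) - 1)))"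
    by (intro mult_left_mono emeasure_prism_le_grid m compact_imp_bounded assms) auto
  also have "\<dots> = of_nat (card (grid_index k m ` M)) * (ennreal ((1 / m) ^ (CARD('n) - 1)) * cell_measure k)"
    by (simp add: mult_ac)
  also have "\<dots> \<le> hausdorff_measure (CARD('n) - 1) ?M'"
  proof (rule grid_le_hausdorff_measure[OF m(1) fin])
    show "grid_map m 1 z ` unit_cell k \<subseteq> ?M'" if "z \<in> grid_index k m ` M" for z
      using grid_neighbourhood[OF m(1) that assms(2)] by (simp add: m(2))
  qed (auto simp: grid_index_def)
  finally show ?thesis
    using \<epsilon> by (intro that[of ?M'] compact_thickening[OF assms(1) False]) auto
qed

end

section \<open>Transfer to arbitrary hyperplanes\<close>

lemma frame_change_obtains:
  fixes u :: "real ^ 'n"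
  assumes "norm u = 1"
  obtains f :: "real ^ 'n \<Rightarrow> real ^ 'n" where "orthogonal_transformation f" "f (axis k 1) = u"
  using orthogonal_transformation_exists[of "axis k 1" u] assms by auto

lemma measure_prism_frame_change:
  fixes f :: "real ^ 'n \<Rightarrow> real ^ 'n"
  assumes f: "orthogonal_transformation f" "f (axis k 1) = u" and M: "compact M"
  shows "emeasure lborel (prism u h ((\<lambda>x. f x + h *\<^sub>R u) ` M)) = emeasure lborel (prism (axis k 1) 0 M)"
proof -
  have lin: "linear f" and inj: "inj f" and surj: "surj f"
    using f(1) orthogonal_transformation_inj orthogonal_transformation_surj orthogonal_transformation_linear by auto
  have ip: "f x \<bullet> u = x \<bullet> axis k 1" for x
    using f by (metis orthogonal_transformation_def)
  have *: "f x + (h - f x \<bullet> u) *\<^sub>R u = f (x + (0 - x \<bullet> axis k 1) *\<^sub>R axis k 1) + h *\<^sub>R u" for x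
    by (simp add: ip linear_diff[OF lin] linear_add[OF lin] linear_cmul[OF lin] linear_neg[OF lin] f(2) algebra_simps)
  have "prism u h ((\<lambda>x. f x + h *\<^sub>R u) ` M) = f ` prism (axis k 1) 0 M" (is "?L = ?R")
  proof (intro set_eqI)
    fix y
    obtain x where x: "y = f x" using surj by (metis surjD)
    have "y \<in> ?L \<longleftrightarrow> x \<in> prism (axis k 1) 0 M"
      unfolding x prism_def mem_Collect_eq * unfolding ip
      using inj by (simp add: inj_image_mem_iff image_image[symmetric] image_iff inj_eq)
    also have "\<dots> \<longleftrightarrow> y \<in> ?R"
      unfolding x using inj by (simp add: inj_image_mem_iff)
    finally show "y \<in> ?L \<longleftrightarrow> y \<in> ?R" .
  qed
  moreover have "compact (prism (axis k 1) 0 M)"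
    by (intro compact_prism M)
  ultimately show ?thesis
    using emeasure_linear_image_compact[OF lin inj] f(1) by (metis ennreal_1 mult_1)
qed

text \<open>A rotation taking the coordinate axis to u, followed by a translation along u, preserves
  both Hausdorff measure and prism volume. It acts on the whole space, so that open neighbourhoods
  can be pulled back.\<close>

lemma frame_change_hyperplane:
  fixes u :: "real ^ 'n" and k :: 'n
  assumes u: "norm u = 1" and M: "compact M" "\<And>x. x \<in> M \<Longrightarrow> x \<bullet> u = h"
  obtains \<phi> :: "real ^ 'n \<Rightarrow> real ^ 'n" and M0 where "compact M0" "\<And>x. x \<in> M0 \<Longrightarrow> x $ k = 0" "M = \<phi> ` M0" "continuous_on UNIV \<phi>"
    "\<And>A. hausdorff_measure d (\<phi> ` A) = hausdorff_measure d A" "\<And>x. x $ k = 0 \<Longrightarrow> \<phi> x \<bullet> u = h"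
    "emeasure lborel (prism u h M) = emeasure lborel (prism (axis k 1) 0 M0)"
proof -
  obtain f :: "real ^ 'n \<Rightarrow> real ^ 'n" where f: "orthogonal_transformation f" "f (axis k 1) = u"
    using frame_change_obtains[OF u] .
  have lin: "linear f" and surj: "surj f"
    using f(1) orthogonal_transformation_surj orthogonal_transformation_linear by auto
  define \<phi> where "\<phi> x = f x + h *\<^sub>R u" for x
  define \<psi> where "\<psi> y = inv f (y - h *\<^sub>R u)" for y
  have \<phi>\<psi>: "\<phi> (\<psi> y) = y" for y
    using surj by (simp add: \<phi>_def \<psi>_def surj_f_inv_f)
  have iso: "dist (\<phi> x) (\<phi> y) = 1 * dist x y" for x y
    using f(1) orthogonal_transformation_norm[of f "x - y"]
    by (simp add: \<phi>_def dist_norm linear_diff[OF lin])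
  have cont: "continuous_on UNIV \<phi>"
    by (rule continuous_onI) (use iso in auto)
  have cont': "continuous_on M \<psi>"
    using iso \<phi>\<psi> by (intro continuous_onI) (metis mult_1 less_imp_le)
  have ip: "\<phi> x \<bullet> u = x $ k + h" for x
  proof -
    have "f x \<bullet> u = x \<bullet> axis k 1" using f by (metis orthogonal_transformation_def)
    then show ?thesis
      using u by (simp add: \<phi>_def inner_axis algebra_simps norm_eq_1)
  qed
  have M0: "compact (\<psi> ` M)"
    by (rule compact_continuous_image[OF cont' M(1)])
  have img: "M = \<phi> ` \<psi> ` M"
    by (simp add: image_image \<phi>\<psi>)
  show ?thesis
  proof (rule that[OF M0 _ img cont])
    show "x $ k = 0" if "x \<in> \<psi> ` M" for x
      using that M(2) ip by (metis \<phi>\<psi> add_cancel_left_left imageE)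
    show "hausdorff_measure d (\<phi> ` A) = hausdorff_measure d A" for A
      using hausdorff_measure_similarity[of \<phi> 1, OF iso _ surjI[of \<phi> \<psi>, OF \<phi>\<psi>]] by simp
    show "emeasure lborel (prism u h M) = emeasure lborel (prism (axis k 1) 0 (\<psi> ` M))"
      using measure_prism_frame_change[OF f M0, of h] img by (simp add: \<phi>_def)
  qed (simp add: ip)
qed

lemma hausdorff_measure_le_prism:
  fixes u :: "real ^ 'n" and k :: 'n
  assumes "norm u = 1" and "compact M" "\<And>x. x \<in> M \<Longrightarrow> x \<bullet> u = h"
  shows "hausdorff_measure (CARD('n) - 1) M \<le> cell_measure k * emeasure lborel (prism u h M)"
proof -
  obtain \<phi> :: "real ^ 'n \<Rightarrow> real ^ 'n" and M0 where *: "compact M0" "\<And>x. x \<in> M0 \<Longrightarrow> x $ k = 0" "M = \<phi> ` M0"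
    "\<And>A. hausdorff_measure (CARD('n) - 1) (\<phi> ` A) = hausdorff_measure (CARD('n) - 1) A"
    "emeasure lborel (prism u h M) = emeasure lborel (prism (axis k 1) 0 M0)"
    using frame_change_hyperplane[OF assms, where k = k] by metis
  show ?thesis
    using hausdorff_measure_le_prism_axis[OF *(1,2)] *(3-5) by simp
qed

lemma hausdorff_measure_ge_prism:
  fixes u :: "real ^ 'n" and k :: 'n
  assumes "norm u = 1" and "compact M" "\<And>x. x \<in> M \<Longrightarrow> x \<bullet> u = h" and "M \<subseteq> W" "open W"
  obtains M' where "compact M'" "M' \<subseteq> {x. x \<bullet> u = h} \<inter> W"
    "cell_measure k * emeasure lborel (prism u h M) \<le> hausdorff_measure (CARD('n) - 1) M'"
proof -
  obtain \<phi> :: "real ^ 'n \<Rightarrow> real ^ 'n" and M0 where *: "compact M0" "\<And>x. x \<in> M0 \<Longrightarrow> x $ k = 0" "M = \<phi> ` M0"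
    "continuous_on UNIV \<phi>"
    "\<And>A. hausdorff_measure (CARD('n) - 1) (\<phi> ` A) = hausdorff_measure (CARD('n) - 1) A"
    "\<And>x. x $ k = 0 \<Longrightarrow> \<phi> x \<bullet> u = h"
    "emeasure lborel (prism u h M) = emeasure lborel (prism (axis k 1) 0 M0)"
    using frame_change_hyperplane[OF assms(1-3), where k = k] by metis
  have "M0 \<subseteq> \<phi> -` W" using *(3) assms(4) by auto
  moreover have "open (\<phi> -` W)"
    using continuous_on_open_vimage[OF open_UNIV] *(4) assms(5) by auto
  ultimately obtain M' where M': "compact M'" "M' \<subseteq> {x. x $ k = 0} \<inter> \<phi> -` W"
    "cell_measure k * emeasure lborel (prism (axis k 1) 0 M0) \<le> hausdorff_measure (CARD('n) - 1) M'"
    using hausdorff_measure_ge_prism_axis[OF *(1,2)] by metis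
  show ?thesis
  proof (rule that)
    show "compact (\<phi> ` M')"
      using *(4) M'(1) by (meson compact_continuous_image continuous_on_subset subset_UNIV)
  qed (use M' * in auto)
qed

section \<open>Surface area measures of polytopes\<close>

text \<open>Disjoint compact sets are at a positive distance, so separated additivity
  applies.\<close>

lemma hausdorff_measure_UN_disjoint_compact:
  fixes A :: "'i \<Rightarrow> 'a::euclidean_space set"
  assumes "finite I" "\<And>i. i \<in> I \<Longrightarrow> compact (A i)" "disjoint_family_on A I"
  shows "(\<Sum>i\<in>I. hausdorff_measure d (A i)) \<le> hausdorff_measure d (\<Union>i\<in>I. A i)"
  using assms
proof (induction I rule: finite_induct)
  case (insert i I)
  have "closed (\<Union>j\<in>I. A j)"
    using insert.hyps insert.prems by (intro compact_imp_closed compact_UN) auto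
  moreover have "A i \<inter> (\<Union>j\<in>I. A j) = {}"
    using insert.hyps insert.prems(2) by (fastforce simp: disjoint_family_on_def)
  ultimately obtain r where r: "r > 0" "\<And>x y. x \<in> A i \<Longrightarrow> y \<in> (\<Union>j\<in>I. A j) \<Longrightarrow> r \<le> dist x y"
    using separate_compact_closed[OF insert.prems(1)[OF insertI1]] by metis
  have "(\<Sum>j\<in>I. hausdorff_measure d (A j)) \<le> hausdorff_measure d (\<Union>j\<in>I. A j)"
    using insert.prems by (intro insert.IH) (auto simp: disjoint_family_on_def)
  then have "(\<Sum>j\<in>insert i I. hausdorff_measure d (A j)) \<le> hausdorff_measure d (A i) + hausdorff_measure d (\<Union>j\<in>I. A j)"
    unfolding sum.insert[OF insert.hyps] by (rule add_left_mono)
  also have "\<dots> \<le> hausdorff_measure d (A i \<union> (\<Union>j\<in>I. A j))"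
    using r(2,1) by (rule hausdorff_measure_Un_separated)
  finally show ?case by simp
qed simp

lemma emeasure_lborel_hyperplane:
  fixes a :: "'a::euclidean_space"
  assumes "a \<noteq> 0 \<or> b \<noteq> 0"
  shows "emeasure lborel {x. a \<bullet> x = b} = 0"
proof -
  have "closed {x. a \<bullet> x = b}"
    by (intro closed_Collect_eq continuous_intros)
  then have "{x. a \<bullet> x = b} \<in> sets lborel" by (simp add: borel_closed)
  moreover have "emeasure lebesgue {x. a \<bullet> x = b} = 0"
    using negligible_hyperplane[OF assms] by (simp add: negligible_iff_null_sets null_sets_def)
  ultimately show ?thesis by simp
qed

section \<open>Facets of a bounded intersection of half-spaces\<close>

locale polytope_rep =
  fixes K U :: "(real ^ 'n) set" and h :: "real ^ 'n \<Rightarrow> real"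
  assumes K_eq: "K = {x. \<forall>u\<in>U. x \<bullet> u \<le> h u}"
    and finite_U: "finite U" and norm_U: "\<And>u. u \<in> U \<Longrightarrow> norm u = 1"
    and h_pos: "\<And>u. u \<in> U \<Longrightarrow> h u > 0" and bounded_K: "bounded K"
begin

definition facet :: "real ^ 'n \<Rightarrow> (real ^ 'n) set" where
  "facet u = {x \<in> K. x \<bullet> u = h u}"

text \<open>The outer normal is unique on this set, and it fills the facet up to area zero. It is
  empty for a redundant half-space, which the representation may contain.\<close>

definition open_facet :: "real ^ 'n \<Rightarrow> (real ^ 'n) set" where
  "open_facet u = {x. x \<bullet> u = h u \<and> (\<forall>v\<in>U - {u}. x \<bullet> v < h v)}"

definition facet_area :: "real ^ 'n \<Rightarrow> ennreal" where
  "facet_area u = emeasure lborel (prism u (h u) (facet u))"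

lemma closed_K: "closed K"
proof -
  have "K = (\<Inter>u\<in>U. {x. x \<bullet> u \<le> h u})" by (auto simp: K_eq)
  then show ?thesis
    by (auto intro!: closed_Collect_le continuous_intros)
qed

lemma compact_facet: "compact (facet u)"
proof -
  have "facet u = K \<inter> {x. x \<bullet> u = h u}" by (auto simp: facet_def)
  moreover have "closed {x. x \<bullet> u = h u}" by (intro closed_Collect_eq continuous_intros)
  ultimately show ?thesis
    using closed_K bounded_K by (simp add: compact_eq_bounded_closed bounded_Int closed_Int)
qed

lemma open_strict: "open {x. \<forall>v\<in>V. x \<bullet> v < h v}" if "V \<subseteq> U"
proof -
  have "{x. \<forall>v\<in>V. x \<bullet> v < h v} = (\<Inter>v\<in>V. {x. x \<bullet> v < h v})" by auto
  then show ?thesis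
    using finite_subset[OF that finite_U] by (auto intro!: open_INT open_Collect_less continuous_intros)
qed

lemma outer_unit_normal_facet: "u \<in> U \<Longrightarrow> x \<in> facet u \<Longrightarrow> outer_unit_normal K x u"
  unfolding facet_def by (auto simp: outer_unit_normal_def norm_U K_eq)

text \<open>The points where all constraints are strict form an open subset of K, so a boundary
  point has an active constraint. The normal of that constraint is an outer normal, hence the only
  one.\<close>

lemma regular_boundary_normal:
  assumes "x \<in> regular_boundary K"
  shows "normal_map K x \<in> U \<and> x \<in> facet (normal_map K x)"
proof -
  have x: "x \<in> K" "x \<notin> interior K"
    using assms closed_K by (auto simp: regular_boundary_def frontier_def)
  have "\<exists>u\<in>U. x \<bullet> u = h u"
  proof (rule ccontr)
    assume "\<not> ?thesis"
    then have "x \<in> {x. \<forall>v\<in>U. x \<bullet> v < h v}"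
      using x(1) by (force simp: K_eq)
    moreover have "{x. \<forall>v\<in>U. x \<bullet> v < h v} \<subseteq> K"
      by (auto simp: K_eq less_imp_le)
    ultimately show False
      using x(2) open_strict[OF order_refl] interior_maximal by blast
  qed
  then obtain u where u: "u \<in> U" "x \<in> facet u"
    using x(1) by (auto simp: facet_def)
  then have "normal_map K x = u"
    unfolding normal_map_def using assms outer_unit_normal_facet[OF u]
    by (auto simp: regular_boundary_def intro: the1_equality)
  with u show ?thesis by simp
qed

lemma open_facet_subset: "u \<in> U \<Longrightarrow> open_facet u \<subseteq> facet u"
proof
  fix x assume "x \<in> open_facet u"
  then have "x \<bullet> v \<le> h v" if "v \<in> U" for v
    using that by (cases "v = u") (auto simp: open_facet_def less_imp_le)
  then show "x \<in> facet u"
    using \<open>x \<in> open_facet u\<close> unfolding facet_def open_facet_def by (subst K_eq) auto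
qed

text \<open>The other constraints are strict at x, so K contains a short segment from x in each
  direction d with \<open>d \<bullet> u \<le> 0\<close>. An outer normal must be nonpositive on this
  half-space, and u is the only such unit vector.\<close>

lemma open_facet_regular:
  assumes u: "u \<in> U" and x: "x \<in> open_facet u"
  shows "x \<in> regular_boundary K \<and> normal_map K x = u"
proof -
  have xK: "x \<in> K" and xu: "x \<bullet> u = h u"
    using open_facet_subset[OF u] x by (auto simp: facet_def)
  have uu: "u \<bullet> u = 1" using norm_U[OF u] by (simp add: norm_eq_1)
  have move: "\<exists>\<epsilon>>0. x + \<epsilon> *\<^sub>R d \<in> K" if "d \<bullet> u \<le> 0" for d
  proof -
    have "open {x. \<forall>v\<in>U - {u}. x \<bullet> v < h v}" by (rule open_strict) auto
    moreover have "x \<in> {x. \<forall>v\<in>U - {u}. x \<bullet> v < h v}" using x by (simp add: open_facet_def)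
    ultimately obtain e where e: "e > 0" "ball x e \<subseteq> {x. \<forall>v\<in>U - {u}. x \<bullet> v < h v}"
      using openE by blast
    define \<epsilon> where "\<epsilon> = e / (2 * (norm d + 1))"
    have \<epsilon>: "\<epsilon> > 0" using e norm_ge_zero[of d] by (simp add: \<epsilon>_def add_nonneg_pos)
    have "norm (\<epsilon> *\<^sub>R d) = e * (norm d / (2 * (norm d + 1)))"
      using \<epsilon> by (simp add: abs_of_pos) (simp add: \<epsilon>_def)
    also have "\<dots> < e * 1"
    proof (rule mult_strict_left_mono[OF _ e(1)])
      have "c / (2 * (c + 1)) < 1" if "c \<ge> 0" for c :: real
        using that by (simp add: divide_less_eq)
      from this[OF norm_ge_zero] show "norm d / (2 * (norm d + 1)) < 1" .
    qed
    finally have "x + \<epsilon> *\<^sub>R d \<in> ball x e" by (simp add: dist_norm)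
    then have "\<forall>v\<in>U - {u}. (x + \<epsilon> *\<^sub>R d) \<bullet> v < h v" using e by blast
    moreover have "(x + \<epsilon> *\<^sub>R d) \<bullet> u \<le> h u"
      using that \<epsilon> xu by (simp add: inner_add_left mult_nonneg_nonpos)
    ultimately have "x + \<epsilon> *\<^sub>R d \<in> K" unfolding K_eq by force
    with \<epsilon> show ?thesis by blast
  qed
  have uniq: "w = u" if w: "outer_unit_normal K x w" for w
  proof -
    have le: "d \<bullet> w \<le> 0" if d: "d \<bullet> u \<le> 0" for d
    proof -
      obtain \<epsilon> where "\<epsilon> > 0" "x + \<epsilon> *\<^sub>R d \<in> K" using move[OF d] by blast
      then have "(x + \<epsilon> *\<^sub>R d) \<bullet> w \<le> x \<bullet> w" using w by (simp add: outer_unit_normal_def)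
      then show ?thesis using \<open>\<epsilon> > 0\<close> by (simp add: inner_add_left mult_le_0_iff)
    qed
    have ww: "w \<bullet> w = 1" using w by (simp add: outer_unit_normal_def norm_eq_1)
    \<comment> \<open>Testing w against its own component orthogonal to u gives (w \<bullet> u)^2
      \<ge> 1, and testing against - u fixes the sign.\<close>
    have "(w - (w \<bullet> u) *\<^sub>R u) \<bullet> w \<le> 0"
      by (rule le) (simp add: inner_diff_left uu)
    then have "(w \<bullet> u)\<^sup>2 \<ge> 1"
      by (simp add: inner_diff_left inner_diff_right ww inner_commute power2_eq_square)
    moreover have "w \<bullet> u \<ge> 0"
      using le[of "- u"] uu by (simp add: inner_commute)
    ultimately have "w \<bullet> u \<ge> 1"
      by (metis one_power2 power2_le_imp_le)
    then have "(w - u) \<bullet> (w - u) \<le> 0"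
      by (simp add: inner_diff_left inner_diff_right ww uu inner_commute)
    then show "w = u"
      by (metis eq_iff_diff_eq_0 inner_eq_zero_iff inner_ge_zero order_antisym)
  qed
  have n: "outer_unit_normal K x u"
    using outer_unit_normal_facet[OF u] open_facet_subset[OF u] x by blast
  have "x \<notin> interior K"
  proof
    assume "x \<in> interior K"
    then obtain e where e: "e > 0" "cball x e \<subseteq> K"
      using mem_interior_cball by blast
    have "x + e *\<^sub>R u \<in> cball x e" using e norm_U[OF u] by (simp add: dist_norm)
    then have "(x + e *\<^sub>R u) \<bullet> u \<le> h u" using e u by (auto simp: K_eq)
    then show False using e uu xu by (simp add: inner_add_left)
  qed
  then have "x \<in> frontier K"
    using xK closed_K by (simp add: frontier_def)
  moreover have "normal_map K x = u"
    unfolding normal_map_def using n uniq by (rule the_equality)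
  ultimately show ?thesis
    using n uniq unfolding regular_boundary_def by blast
qed

text \<open>A point of the facet outside the open facet satisfies a second constraint with equality;
  the points of the prism above such points lie in finitely many hyperplanes.\<close>

lemma emeasure_prism_open_facet:
  assumes u: "u \<in> U"
  shows "emeasure lborel (prism u (h u) (open_facet u)) = facet_area u"
  unfolding facet_area_def
proof (rule antisym)
  have F: "prism u (h u) (facet u) \<in> sets borel"
    by (intro sets_prism borel_compact compact_facet)
  show "emeasure lborel (prism u (h u) (open_facet u)) \<le> emeasure lborel (prism u (h u) (facet u))"
    using open_facet_subset[OF u] F by (intro emeasure_mono prism_mono) auto
  have "open_facet u = {x. x \<bullet> u = h u} \<inter> {x. \<forall>v\<in>U - {u}. x \<bullet> v < h v}"
    by (auto simp: open_facet_def)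
  moreover have "closed {x. x \<bullet> u = h u}" by (intro closed_Collect_eq continuous_intros)
  moreover have "open {x. \<forall>v\<in>U - {u}. x \<bullet> v < h v}" by (rule open_strict) auto
  ultimately have O: "prism u (h u) (open_facet u) \<in> sets borel"
    by (intro sets_prism) (simp add: sets.Int borel_closed borel_open)
  define N where "N v = {x. (v - (u \<bullet> v) *\<^sub>R u) \<bullet> x = h v - h u * (u \<bullet> v)}" for v
  have N: "N v \<in> null_sets lborel" if v: "v \<in> U - {u}" for v
  proof -
    \<comment> \<open>The normal vector of N v can vanish only for v = - u, as v = u is excluded.
      The right-hand side is then h v + h u > 0, so N v is empty.\<close>
    have "v - (u \<bullet> v) *\<^sub>R u \<noteq> 0 \<or> h v - h u * (u \<bullet> v) \<noteq> 0"
    proof (rule ccontr)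
      assume "\<not> ?thesis"
      then have *: "v = (u \<bullet> v) *\<^sub>R u" "h v = h u * (u \<bullet> v)" by auto
      have "norm v = \<bar>u \<bullet> v\<bar> * norm u" using *(1) by (metis norm_scaleR)
      then have "\<bar>u \<bullet> v\<bar> = 1" using v u norm_U by auto
      moreover have "u \<bullet> v > 0" using *(2) h_pos u v by (metis DiffD1 zero_less_mult_pos)
      ultimately have "u \<bullet> v = 1" by simp
      then show False using * v by simp
    qed
    then have "emeasure lborel (N v) = 0"
      unfolding N_def by (rule emeasure_lborel_hyperplane)
    moreover have "closed (N v)" unfolding N_def by (intro closed_Collect_eq continuous_intros)
    ultimately show ?thesis by (simp add: null_sets_def borel_closed)
  qed
  have "prism u (h u) (facet u) \<subseteq> prism u (h u) (open_facet u) \<union> (\<Union>v\<in>U - {u}. N v)"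
  proof
    fix x assume x: "x \<in> prism u (h u) (facet u)"
    let ?y = "x + (h u - x \<bullet> u) *\<^sub>R u"
    have y: "?y \<in> facet u" using x by (simp add: prism_def)
    show "x \<in> prism u (h u) (open_facet u) \<union> (\<Union>v\<in>U - {u}. N v)"
    proof (cases "?y \<in> open_facet u")
      case True
      then show ?thesis using x by (simp add: prism_def)
    next
      case False
      have "?y \<bullet> u = h u" "\<forall>v\<in>U. ?y \<bullet> v \<le> h v"
        using y unfolding facet_def by (auto simp: K_eq)
      moreover from this obtain v where v: "v \<in> U - {u}" "\<not> ?y \<bullet> v < h v"
        using False unfolding open_facet_def mem_Collect_eq by blast
      ultimately have v: "v \<in> U - {u}" "?y \<bullet> v = h v"
        by (auto simp: less_le)
      from v(2) have "x \<in> N v"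
        by (simp add: N_def algebra_simps inner_commute)
      with v show ?thesis by blast
    qed
  qed
  then have "emeasure lborel (prism u (h u) (facet u))
      \<le> emeasure lborel (prism u (h u) (open_facet u) \<union> (\<Union>v\<in>U - {u}. N v))"
    using O N by (intro emeasure_mono) (auto intro!: sets.Un sets.finite_UN simp: finite_U null_sets_def)
  also have "\<dots> = emeasure lborel (prism u (h u) (open_facet u))"
    using O N finite_U by (intro emeasure_Un_null_set null_sets_UN') (auto intro: countable_finite)
  finally show "emeasure lborel (prism u (h u) (facet u)) \<le> emeasure lborel (prism u (h u) (open_facet u))" .
qed

text \<open>The sets M u j are compact and exhaust the open facets. Each is enlarged inside its open
  facet to a compact set that attains the lower bound; the enlarged sets are still disjoint, so
  their measures add up.\<close>

lemma hausdorff_measure_open_facets_ge: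
  fixes k :: 'n
  assumes V: "V \<subseteq> U"
  shows "cell_measure k * (\<Sum>u\<in>V. facet_area u) \<le> hausdorff_measure (CARD('n) - 1) (\<Union>u\<in>V. open_facet u)"
proof -
  have fin: "finite V" using V finite_U by (rule finite_subset)
  define M where "M u j = {x. x \<bullet> u = h u \<and> (\<forall>v\<in>U - {u}. x \<bullet> v \<le> h v - 1 / real (Suc j))}" for u j
  have M_open: "M u j \<subseteq> open_facet u" for u j
  proof -
    have "h v - 1 / real (Suc j) < h v" for v by simp
    then show ?thesis
      unfolding M_def open_facet_def by (blast intro: order_le_less_trans)
  qed
  have M_compact: "compact (M u j)" if "u \<in> V" for u j
  proof -
    have "M u j = {x. x \<bullet> u = h u} \<inter> (\<Inter>v\<in>U - {u}. {x. x \<bullet> v \<le> h v - 1 / real (Suc j)})"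
      by (auto simp: M_def)
    then have "closed (M u j)"
      by (auto intro!: closed_Int closed_INT closed_Collect_le closed_Collect_eq continuous_intros simp del: of_nat_Suc)
    moreover have "M u j \<subseteq> K"
      using M_open[of u j] open_facet_subset[of u] that V by (auto simp: facet_def)
    then have "bounded (M u j)" using bounded_K by (rule bounded_subset[rotated])
    ultimately show ?thesis by (simp add: compact_eq_bounded_closed)
  qed
  have lim: "(\<lambda>j. emeasure lborel (prism u (h u) (M u j))) \<longlonglongrightarrow> facet_area u" if u: "u \<in> V" for u
  proof -
    have "(\<lambda>j. emeasure lborel (prism u (h u) (M u j))) \<longlonglongrightarrow> emeasure lborel (\<Union>j. prism u (h u) (M u j))"
    proof (rule Lim_emeasure_incseq)
      show "range (\<lambda>j. prism u (h u) (M u j)) \<subseteq> sets lborel"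
        using sets_prism[OF borel_compact[OF M_compact[OF u]]] by auto
      show "incseq (\<lambda>j. prism u (h u) (M u j))"
      proof (rule incseq_SucI, rule prism_mono)
        fix j
        have "1 / real (Suc (Suc j)) \<le> 1 / real (Suc j)" by (simp add: field_simps)
        then show "M u j \<subseteq> M u (Suc j)" unfolding M_def by (force simp del: of_nat_Suc)
      qed
    qed
    also have "(\<Union>j. prism u (h u) (M u j)) = prism u (h u) (\<Union>j. M u j)"
      by (auto simp: prism_def)
    also have "(\<Union>j. M u j) = open_facet u"
    proof
      show "open_facet u \<subseteq> (\<Union>j. M u j)"
      proof
        fix x assume x: "x \<in> open_facet u"
        have "eventually (\<lambda>j. x \<bullet> v \<le> h v - 1 / real (Suc j)) sequentially" if v: "v \<in> U - {u}" for v
        proof -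
          have "x \<bullet> v < h v" using x v by (simp add: open_facet_def)
          moreover have "(\<lambda>j. h v - 1 / real (Suc j)) \<longlonglongrightarrow> h v - 0"
            by (intro tendsto_intros LIMSEQ_Suc lim_1_over_n)
          ultimately have "eventually (\<lambda>j. x \<bullet> v < h v - 1 / real (Suc j)) sequentially"
            by (simp add: order_tendstoD(1))
          then show ?thesis by (rule eventually_mono) simp
        qed
        then have "eventually (\<lambda>j. \<forall>v\<in>U - {u}. x \<bullet> v \<le> h v - 1 / real (Suc j)) sequentially"
          using finite_U by (intro eventually_ball_finite) auto
        then obtain j where "\<forall>v\<in>U - {u}. x \<bullet> v \<le> h v - 1 / real (Suc j)"
          using eventually_happens trivial_limit_sequentially by blast
        then show "x \<in> (\<Union>j. M u j)"
          using x by (auto simp: M_def open_facet_def)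
      qed
    qed (use M_open in blast)
    finally show ?thesis
      using emeasure_prism_open_facet u V by auto
  qed
  have le: "cell_measure k * (\<Sum>u\<in>V. emeasure lborel (prism u (h u) (M u j)))
      \<le> hausdorff_measure (CARD('n) - 1) (\<Union>u\<in>V. open_facet u)" for j
  proof -
    have "\<exists>M'. compact M' \<and> M' \<subseteq> open_facet u
        \<and> cell_measure k * emeasure lborel (prism u (h u) (M u j)) \<le> hausdorff_measure (CARD('n) - 1) M'"
      if u: "u \<in> V" for u
    proof -
      have uU: "u \<in> U" using u V by blast
      have "M u j \<subseteq> {x. \<forall>v\<in>U - {u}. x \<bullet> v < h v}"
        using M_open[of u j] by (auto simp: open_facet_def)
      moreover have "open {x. \<forall>v\<in>U - {u}. x \<bullet> v < h v}" by (rule open_strict) auto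
      moreover have "\<And>x. x \<in> M u j \<Longrightarrow> x \<bullet> u = h u" by (simp add: M_def)
      ultimately obtain M' where "compact M'" "M' \<subseteq> {x. x \<bullet> u = h u} \<inter> {x. \<forall>v\<in>U - {u}. x \<bullet> v < h v}"
        "cell_measure k * emeasure lborel (prism u (h u) (M u j)) \<le> hausdorff_measure (CARD('n) - 1) M'"
        using hausdorff_measure_ge_prism[OF norm_U[OF uU] M_compact[OF u], of j "h u"
            "{x. \<forall>v\<in>U - {u}. x \<bullet> v < h v}" k] by blast
      then show ?thesis
        by (intro exI[of _ M']) (auto simp: open_facet_def)
    qed
    then obtain M' where M': "\<And>u. u \<in> V \<Longrightarrow> compact (M' u)" "\<And>u. u \<in> V \<Longrightarrow> M' u \<subseteq> open_facet u"
      "\<And>u. u \<in> V \<Longrightarrow> cell_measure k * emeasure lborel (prism u (h u) (M u j)) \<le> hausdorff_measure (CARD('n) - 1) (M' u)"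
      by metis
    have "open_facet u \<inter> open_facet v = {}" if "u \<in> V" "v \<in> V" "u \<noteq> v" for u v
    proof -
      have "x \<bullet> v < h v" "x \<bullet> v = h v" if "x \<in> open_facet u" "x \<in> open_facet v" for x
        using that \<open>u \<in> V\<close> \<open>v \<in> V\<close> \<open>u \<noteq> v\<close> V unfolding open_facet_def by (blast, simp)
      then show ?thesis by fastforce
    qed
    then have disj: "disjoint_family_on M' V"
      using M'(2) unfolding disjoint_family_on_def by blast
    have "cell_measure k * (\<Sum>u\<in>V. emeasure lborel (prism u (h u) (M u j)))
        \<le> (\<Sum>u\<in>V. hausdorff_measure (CARD('n) - 1) (M' u))"
      unfolding sum_distrib_left by (intro sum_mono M'(3))
    also have "\<dots> \<le> hausdorff_measure (CARD('n) - 1) (\<Union>u\<in>V. M' u)"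
      using fin M'(1) disj by (rule hausdorff_measure_UN_disjoint_compact)
    also have "\<dots> \<le> hausdorff_measure (CARD('n) - 1) (\<Union>u\<in>V. open_facet u)"
      using M'(2) by (intro hausdorff_measure_mono) blast
    finally show ?thesis .
  qed
  have "(\<lambda>j. cell_measure k * (\<Sum>u\<in>V. emeasure lborel (prism u (h u) (M u j)))) \<longlonglongrightarrow> cell_measure k * (\<Sum>u\<in>V. facet_area u)"
    using cell_measure_finite[of k] by (intro ennreal_tendsto_cmult tendsto_sum lim) auto
  then show ?thesis
    by (rule LIMSEQ_le_const2) (use le in blast)
qed

text \<open>The preimage lies between the union of the open facets and the union of the closed ones,
  and both have the same area.\<close>

lemma hausdorff_measure_normal_preimage:
  fixes k :: 'n
  shows "hausdorff_measure (CARD('n) - 1) {x \<in> regular_boundary K. normal_map K x \<in> \<omega>}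
    = cell_measure k * (\<Sum>u\<in>U \<inter> \<omega>. facet_area u)"
proof (rule antisym)
  let ?G = "{x \<in> regular_boundary K. normal_map K x \<in> \<omega>}"
  have "?G \<subseteq> (\<Union>u\<in>U \<inter> \<omega>. facet u)"
    using regular_boundary_normal by blast
  then have "hausdorff_measure (CARD('n) - 1) ?G \<le> hausdorff_measure (CARD('n) - 1) (\<Union>u\<in>U \<inter> \<omega>. facet u)"
    by (rule hausdorff_measure_mono)
  also have "\<dots> \<le> (\<Sum>u\<in>U \<inter> \<omega>. hausdorff_measure (CARD('n) - 1) (facet u))"
    using finite_U by (intro hausdorff_measure_UN_le) auto
  also have "\<dots> \<le> (\<Sum>u\<in>U \<inter> \<omega>. cell_measure k * facet_area u)"
    unfolding facet_area_def
    by (intro sum_mono hausdorff_measure_le_prism compact_facet) (auto simp: norm_U facet_def)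
  finally show "hausdorff_measure (CARD('n) - 1) ?G \<le> cell_measure k * (\<Sum>u\<in>U \<inter> \<omega>. facet_area u)"
    by (simp add: sum_distrib_left)
  have "cell_measure k * (\<Sum>u\<in>U \<inter> \<omega>. facet_area u) \<le> hausdorff_measure (CARD('n) - 1) (\<Union>u\<in>U \<inter> \<omega>. open_facet u)"
    by (rule hausdorff_measure_open_facets_ge) simp
  also have "\<dots> \<le> hausdorff_measure (CARD('n) - 1) ?G"
    using open_facet_regular by (intro hausdorff_measure_mono) auto
  finally show "cell_measure k * (\<Sum>u\<in>U \<inter> \<omega>. facet_area u) \<le> hausdorff_measure (CARD('n) - 1) ?G" .
qed

end

section \<open>Finitely supported measures on the sphere\<close>

lemma space_borel_sphere: "space borel_sphere = sphere 0 1"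
  by (simp add: borel_sphere_def space_restrict_space)

lemma singleton_in_borel_sphere: "norm u = 1 \<Longrightarrow> {u} \<in> sets borel_sphere"
  by (auto simp: borel_sphere_def sets_restrict_space image_iff intro!: bexI[of _ "{u}"])

lemma finite_in_borel_sphere: "finite V \<Longrightarrow> V \<subseteq> sphere 0 1 \<Longrightarrow> V \<in> sets borel_sphere"
  by (induction V rule: finite_induct)
    (auto intro: singleton_in_borel_sphere sets.insert_in_sets)

lemma emeasure_finitely_supported:
  assumes M: "sets M = sets borel_sphere" and V: "finite V" "V \<subseteq> sphere 0 1"
    and null: "emeasure M (space M - V) = 0" and \<omega>: "\<omega> \<in> sets M"
  shows "emeasure M \<omega> = (\<Sum>u\<in>V \<inter> \<omega>. emeasure M {u})"
proof -
  have V': "V \<in> sets M" using finite_in_borel_sphere[OF V] M by simp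
  have "emeasure M \<omega> = emeasure M (V \<inter> \<omega>)"
  proof (rule antisym)
    have "emeasure M \<omega> \<le> emeasure M ((V \<inter> \<omega>) \<union> (space M - V))"
      using V' \<omega> sets.sets_into_space[OF \<omega>] by (intro emeasure_mono) auto
    also have "\<dots> = emeasure M (V \<inter> \<omega>)"
      using V' \<omega> null by (intro emeasure_Un_null_set) (auto simp: null_sets_def)
    finally show "emeasure M \<omega> \<le> emeasure M (V \<inter> \<omega>)" .
    show "emeasure M (V \<inter> \<omega>) \<le> emeasure M \<omega>"
      using \<omega> by (intro emeasure_mono) auto
  qed
  also have "\<dots> = (\<Sum>u\<in>V \<inter> \<omega>. emeasure M {u})"
    using V M by (intro emeasure_eq_sum_singleton) (auto intro!: singleton_in_borel_sphere)
  finally show ?thesis .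
qed

lemma finitely_supported_measure_eqI:
  assumes "sets M = sets borel_sphere" "sets N = sets borel_sphere" "finite V" "V \<subseteq> sphere 0 1"
    and "emeasure M (space M - V) = 0" "emeasure N (space N - V) = 0"
    and "\<And>u. u \<in> V \<Longrightarrow> emeasure M {u} = emeasure N {u}"
  shows "M = N"
proof (rule measure_eqI)
  fix A assume A: "A \<in> sets M"
  then have "A \<in> sets N" using assms by simp
  then show "emeasure M A = emeasure N A"
    using emeasure_finitely_supported[OF assms(1,3,4,5) A] emeasure_finitely_supported[OF assms(2,3,4,6)]
      assms(7) by (auto intro!: sum.cong)
qed (use assms in simp)

text \<open>The complement of the support is covered by open null sets, of which countably many
  suffice by Lindelof. The set V will be the support itself or a great subsphere that contains
  it.\<close>

lemma emeasure_outside_measure_support: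
  fixes \<mu> :: "'a::euclidean_space measure"
  assumes M: "sets \<mu> = sets borel_sphere" and V: "measure_support \<mu> \<subseteq> V" "V \<in> sets \<mu>"
  shows "emeasure \<mu> (space \<mu> - V) = 0"
proof -
  have sp: "space \<mu> = sphere 0 1"
    using sets_eq_imp_space_eq[OF M] by (simp add: space_borel_sphere)
  define F where "F = {W. open W \<and> emeasure \<mu> (W \<inter> space \<mu>) = 0}"
  have W: "W \<inter> space \<mu> \<in> sets \<mu>" if "open W" for W
    using that by (auto simp: M borel_sphere_def sets_restrict_space sp intro!: image_eqI[where x = W])
  obtain F' where F': "F' \<subseteq> F" "countable F'" "\<Union> F' = \<Union> F"
    using Lindelof[of F] by (auto simp: F_def)
  have "(\<Union>W\<in>F'. W \<inter> space \<mu>) \<in> null_sets \<mu>"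
    using F' W by (intro null_sets_UN') (auto simp: F_def null_sets_def)
  moreover have "space \<mu> - V \<subseteq> (\<Union>W\<in>F'. W \<inter> space \<mu>)"
  proof
    fix x assume x: "x \<in> space \<mu> - V"
    then have "x \<notin> measure_support \<mu>" using V by blast
    then obtain W where "W \<in> F" "x \<in> W"
      using x by (auto simp: measure_support_def F_def)
    then have "x \<in> \<Union> F'" using F'(3) by blast
    then show "x \<in> (\<Union>W\<in>F'. W \<inter> space \<mu>)" using x by blast
  qed
  moreover have "space \<mu> - V \<in> sets \<mu>" using V by auto
  ultimately show ?thesis
    by (meson null_setsD1 null_sets_subset)
qed

text \<open>Removing the finitely many other support points from the space leaves an open
  neighbourhood of x; its mass is positive and carried by x alone.\<close>

lemma emeasure_support_point_pos:
  fixes \<mu> :: "'a::euclidean_space measure"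
  assumes M: "sets \<mu> = sets borel_sphere" and fin: "finite (measure_support \<mu>)" and x: "x \<in> measure_support \<mu>"
  shows "emeasure \<mu> {x} \<noteq> 0"
proof
  assume 0: "emeasure \<mu> {x} = 0"
  have sp: "space \<mu> = sphere 0 1"
    using sets_eq_imp_space_eq[OF M] by (simp add: space_borel_sphere)
  have sub: "measure_support \<mu> \<subseteq> sphere 0 1"
    by (auto simp: measure_support_def sp)
  let ?W = "- (measure_support \<mu> - {x})"
  have "open ?W" using fin by (intro open_Compl finite_imp_closed) auto
  then have ne: "emeasure \<mu> (?W \<inter> space \<mu>) \<noteq> 0"
    using x by (auto simp: measure_support_def)
  have "space \<mu> - measure_support \<mu> \<in> null_sets \<mu>"
    using emeasure_outside_measure_support[OF M order_refl] finite_in_borel_sphere[OF fin sub] M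
    by (auto simp: null_sets_def)
  moreover have "{x} \<in> null_sets \<mu>"
    using 0 x sub M by (auto simp: null_sets_def intro!: singleton_in_borel_sphere)
  moreover have "?W \<inter> space \<mu> = {x} \<union> (space \<mu> - measure_support \<mu>)"
    using x sub sp by auto
  ultimately show False
    using ne by (metis null_sets.Un null_setsD1)
qed

text \<open>For a set in the ball of radius B the support function is B-Lipschitz. Its continuity
  yields the measurability of the density of the Lp surface area measure.\<close>

lemma support_function_continuous:
  fixes K :: "'a::euclidean_space set"
  assumes "bounded K" "K \<noteq> {}"
  shows "continuous_on UNIV (support_function K)"
proof -
  obtain B where B: "B > 0" "\<And>x. x \<in> K \<Longrightarrow> norm x \<le> B"
    using assms(1) bounded_pos by blast
  have bdd: "bdd_above ((\<lambda>x. x \<bullet> u) ` K)" for u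
  proof (rule bdd_aboveI2)
    fix x assume "x \<in> K"
    then show "x \<bullet> u \<le> B * norm u"
      using B norm_cauchy_schwarz[of x u] by (meson mult_right_mono norm_ge_zero order_trans)
  qed
  have le: "support_function K u \<le> support_function K v + B * dist u v" for u v
    unfolding support_function_def
  proof (rule cSUP_least[OF assms(2)])
    fix x assume x: "x \<in> K"
    have "x \<bullet> u = x \<bullet> v + x \<bullet> (u - v)" by (simp add: inner_diff_right)
    also have "x \<bullet> (u - v) \<le> B * dist u v"
      using B(2)[OF x] norm_cauchy_schwarz[of x "u - v"] unfolding dist_norm
      by (meson mult_right_mono norm_ge_zero order_trans)
    also have "x \<bullet> v \<le> (SUP x\<in>K. x \<bullet> v)"
      using bdd x by (rule cSUP_upper[rotated])
    finally show "x \<bullet> u \<le> (SUP x\<in>K. x \<bullet> v) + B * dist u v" by simp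
  qed
  have "B-lipschitz_on UNIV (support_function K)"
  proof (rule lipschitz_onI)
    show "dist (support_function K u) (support_function K v) \<le> B * dist u v" for u v
      using le[of u v] le[of v u] by (simp add: dist_real_def abs_le_iff dist_commute)
  qed (use B in simp)
  then show ?thesis by (rule lipschitz_on_continuous_on)
qed

lemma sets_Lp_surface_area_measure [simp]: "sets (Lp_surface_area_measure p K) = sets borel_sphere"
  and sets_surface_area_measure [simp]: "sets (surface_area_measure K) = sets borel_sphere"
  by (simp_all add: Lp_surface_area_measure_def surface_area_measure_def)

section \<open>The Lp surface area measure of a polytope\<close>

context polytope_rep
begin

lemma zero_in_K: "0 \<in> K"
  by (subst K_eq) (auto simp: h_pos less_imp_le)

lemma U_sphere: "U \<subseteq> sphere 0 1"
  by (auto simp: norm_U)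

text \<open>\<open>measure_of\<close> takes the prescribed values only if these are countably
  additive. Here they are visibly a finite sum of point masses.\<close>

lemma emeasure_surface_area_measure:
  fixes k :: 'n
  assumes "\<omega> \<in> sets borel_sphere"
  shows "emeasure (surface_area_measure K) \<omega> = cell_measure k * (\<Sum>u\<in>U \<inter> \<omega>. facet_area u)"
proof -
  let ?f = "\<lambda>\<omega>. hausdorff_measure (DIM(real ^ 'n) - 1) {x \<in> regular_boundary K. normal_map K x \<in> \<omega>}"
  have f: "?f A = cell_measure k * (\<Sum>u\<in>U \<inter> A. facet_area u)" for A
    using hausdorff_measure_normal_preimage[of A k] by simp
  have f': "?f A = (\<Sum>u\<in>U. cell_measure k * facet_area u * indicator A u)" for A
    unfolding f using finite_U
    by (auto simp: sum_distrib_left sum.inter_restrict indicator_def intro!: sum.cong)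
  have "emeasure (surface_area_measure K) \<omega> = ?f \<omega>"
  proof (rule emeasure_measure_of[OF surface_area_measure_def])
    show "positive (sets (surface_area_measure K)) ?f"
      unfolding positive_def f by simp
    show "countably_additive (sets (surface_area_measure K)) ?f"
    proof (rule countably_additiveI)
      fix A :: "nat \<Rightarrow> (real ^ 'n) set" assume disj: "disjoint_family A"
      have "(\<Sum>i. ?f (A i)) = (\<Sum>u\<in>U. \<Sum>i. cell_measure k * facet_area u * indicator (A i) u)"
        unfolding f' by (intro suminf_sum) auto
      also have "\<dots> = (\<Sum>u\<in>U. cell_measure k * facet_area u * indicator (\<Union>i. A i) u)"
        using suminf_indicator[OF disj] by simp
      finally show "(\<Sum>i. ?f (A i)) = ?f (\<Union>i. A i)" unfolding f' .
    qed
  qed (use assms sets.space_closed in auto)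
  then show ?thesis unfolding f .
qed

lemma measurable_support_function_powr:
  "(\<lambda>u. ennreal (support_function K u powr (1 - p))) \<in> borel_measurable (surface_area_measure K)"
proof -
  have "support_function K \<in> borel_measurable borel"
    using support_function_continuous[OF bounded_K] zero_in_K by (intro borel_measurable_continuous_onI) auto
  then have "(\<lambda>u. ennreal (support_function K u powr (1 - p))) \<in> borel_measurable borel"
    by measurable
  then have "(\<lambda>u. ennreal (support_function K u powr (1 - p))) \<in> borel_measurable borel_sphere"
    unfolding borel_sphere_def by (rule measurable_restrict_space1)
  then show ?thesis
    by (simp cong: measurable_cong_sets)
qed

lemma emeasure_Lp_surface_area_measure_outside:
  "emeasure (Lp_surface_area_measure p K) (space (Lp_surface_area_measure p K) - U) = 0"
proof -
  have sp: "space (Lp_surface_area_measure p K) = space (surface_area_measure K)"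
    by (simp add: Lp_surface_area_measure_def)
  have s: "space (surface_area_measure K) - U \<in> sets borel_sphere"
    using finite_in_borel_sphere[OF finite_U U_sphere] sets.top[of "surface_area_measure K"]
    by (auto simp del: sets.top)
  then have "emeasure (surface_area_measure K) (space (surface_area_measure K) - U) = 0"
    by (subst emeasure_surface_area_measure[where k = undefined]) auto
  then have N: "space (surface_area_measure K) - U \<in> null_sets (surface_area_measure K)"
    using s by (auto simp: null_sets_def)
  show ?thesis
    unfolding sp unfolding Lp_surface_area_measure_def using s measurable_support_function_powr
    by (subst emeasure_density) (auto intro!: nn_integral_null_set[OF N])
qed

lemma emeasure_Lp_surface_area_measure_singleton:
  fixes k :: 'n
  assumes u: "u \<in> U"
  shows "emeasure (Lp_surface_area_measure p K) {u}
    = ennreal (support_function K u powr (1 - p)) * (cell_measure k * facet_area u)"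
proof -
  have s: "{u} \<in> sets (surface_area_measure K)"
    using singleton_in_borel_sphere[OF norm_U[OF u]] by simp
  have "emeasure (Lp_surface_area_measure p K) {u}
      = (\<integral>\<^sup>+ v. ennreal (support_function K v powr (1 - p)) * indicator {u} v \<partial>surface_area_measure K)"
    unfolding Lp_surface_area_measure_def
    by (rule emeasure_density[OF measurable_support_function_powr s])
  also have "\<dots> = (\<integral>\<^sup>+ v. ennreal (support_function K u powr (1 - p)) * indicator {u} v \<partial>surface_area_measure K)"
    by (rule nn_integral_cong) (auto simp: indicator_def)
  also have "\<dots> = ennreal (support_function K u powr (1 - p)) * emeasure (surface_area_measure K) {u}"
    using s by (rule nn_integral_cmult_indicator)
  also have "emeasure (surface_area_measure K) {u} = cell_measure k * facet_area u"
    using s u by (subst emeasure_surface_area_measure[where k = k]) auto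
  finally show ?thesis .
qed

text \<open>A redundant half-space could have \<open>h u\<close> above the support number; a point
  of the facet shows that the value is attained.\<close>

lemma support_function_eq:
  assumes "u \<in> U" "x \<in> facet u"
  shows "support_function K u = h u"
  unfolding support_function_def
proof (rule cSup_eq_maximum)
  show "h u \<in> (\<lambda>x. x \<bullet> u) ` K" using assms unfolding facet_def by (auto intro: rev_image_eqI)
  show "y \<le> h u" if "y \<in> (\<lambda>x. x \<bullet> u) ` K" for y
    using that assms(1) by (subst (asm) K_eq) auto
qed

lemma facet_area_pos:
  assumes u: "u \<in> U" and y: "y \<in> open_facet u"
  shows "facet_area u > 0"
proof -
  have uu: "u \<bullet> u = 1" using norm_U[OF u] by (simp add: norm_eq_1)
  define W where "W = {x. 0 < x \<bullet> u} \<inter> {x. x \<bullet> u < 1} \<inter>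
    (\<lambda>x. x + (h u - x \<bullet> u) *\<^sub>R u) -` {x. \<forall>v\<in>U - {u}. x \<bullet> v < h v}"
  have "open W"
    unfolding W_def
    by (intro open_Int open_Collect_less open_vimage open_strict continuous_intros) auto
  \<comment> \<open>The point over y at height 1 / 2, in the interior of the prism.\<close>
  moreover have "y - (h u - 1 / 2) *\<^sub>R u \<in> W"
    using y uu by (auto simp: W_def open_facet_def inner_diff_left algebra_simps)
  ultimately obtain e where e: "e > 0" "ball (y - (h u - 1 / 2) *\<^sub>R u) e \<subseteq> W"
    by (auto elim: openE)
  have "W \<subseteq> prism u (h u) (facet u)"
  proof
    fix x assume x: "x \<in> W"
    then have "x + (h u - x \<bullet> u) *\<^sub>R u \<in> open_facet u"
      by (auto simp: W_def open_facet_def inner_add_left uu)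
    then show "x \<in> prism u (h u) (facet u)"
      using x open_facet_subset[OF u] by (auto simp: W_def prism_def)
  qed
  then have "emeasure lborel (ball (y - (h u - 1 / 2) *\<^sub>R u) e) \<le> facet_area u"
    unfolding facet_area_def using e
    by (intro emeasure_mono order_trans[OF e(2)]) (auto intro!: sets_prism borel_compact[OF compact_facet])
  moreover have "emeasure lborel (ball (y - (h u - 1 / 2) *\<^sub>R u) e) > 0"
    using content_ball_pos[OF e(1)] by (metis emeasure_notin_sets measure_eq_emeasure_eq_ennreal less_numeral_extra(3) linorder_neqE measure_def not_less_zero enn2real_0 bot.not_eq_extremum bot_ennreal)
  ultimately show ?thesis by (rule order_less_le_trans[rotated])
qed

end

section \<open>Necessity of the condition\<close>

lemma zero_in_interior_symmetric:
  fixes K :: "'a::euclidean_space set"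
  assumes "convex K" "interior K \<noteq> {}" "uminus ` K = K"
  shows "0 \<in> interior K"
proof -
  obtain x where x: "x \<in> interior K" using assms(2) by blast
  then have "- x \<in> interior K"
    using interior_negations[of K] assms(3) by (metis imageI)
  then have "(1 / 2) *\<^sub>R x + (1 / 2) *\<^sub>R (- x) \<in> interior K"
    using x convex_interior[OF assms(1)] by (intro convexD) auto
  then show ?thesis by simp
qed

lemma polytope_halfspace_rep:
  fixes K :: "(real ^ 'n) set"
  assumes K: "polytope K" and z: "0 \<in> interior K"
  obtains U where "finite U" "\<And>u. u \<in> U \<Longrightarrow> norm u = 1"
    "K = {x. \<forall>u\<in>U. x \<bullet> u \<le> support_function K u}"
proof -
  have bK: "bounded K" and zK: "0 \<in> K"
    using K z interior_subset by (auto simp: polytope_imp_bounded)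
  obtain F where F: "finite F" "K = \<Inter> F" "\<forall>H\<in>F. \<exists>a b. a \<noteq> 0 \<and> H = {x. a \<bullet> x \<le> b}"
    using polytope_imp_polyhedron[OF K] by (auto simp: polyhedron_def)
  then obtain a b where ab: "\<And>H. H \<in> F \<Longrightarrow> a H \<noteq> 0 \<and> H = {x. a H \<bullet> x \<le> b H}"
    by metis
  define U where "U = (\<lambda>H. a H /\<^sub>R norm (a H)) ` F"
  have bdd: "bdd_above ((\<lambda>x. x \<bullet> u) ` K)" for u
    using bK by (metis bounded_imp_bdd_above bounded_linear_image bounded_linear_inner_left)
  have upper: "x \<bullet> u \<le> support_function K u" if "x \<in> K" for x u
    unfolding support_function_def using bdd that by (rule cSUP_upper[rotated])
  have "K = {x. \<forall>u\<in>U. x \<bullet> u \<le> support_function K u}"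
  proof
    show "{x. \<forall>u\<in>U. x \<bullet> u \<le> support_function K u} \<subseteq> K"
    proof
      fix x assume x: "x \<in> {x. \<forall>u\<in>U. x \<bullet> u \<le> support_function K u}"
      have "x \<in> H" if H: "H \<in> F" for H
      proof -
        let ?u = "a H /\<^sub>R norm (a H)"
        have pos: "norm (a H) > 0" using ab[OF H] by simp
        have "support_function K ?u \<le> b H / norm (a H)"
          unfolding support_function_def
        proof (rule cSUP_least)
          fix y assume "y \<in> K"
          then have "a H \<bullet> y \<le> b H" using F(2) H ab[OF H] by blast
          then show "y \<bullet> ?u \<le> b H / norm (a H)"
            using pos by (simp add: inner_commute divide_inverse mult.commute[of "inverse (norm (a H))"])
        qed (use zK in blast)
        moreover have "x \<bullet> ?u \<le> support_function K ?u"
          using x H by (auto simp: U_def)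
        ultimately have "x \<bullet> ?u \<le> b H / norm (a H)" by linarith
        then have "a H \<bullet> x \<le> b H"
          using pos by (simp add: inner_commute divide_inverse mult.commute[of "inverse (norm (a H))"])
        then show ?thesis using ab[OF H] by blast
      qed
      then show "x \<in> K" using F(2) by blast
    qed
  qed (use upper in blast)
  moreover have "norm u = 1" if "u \<in> U" for u
    using that ab by (auto simp: U_def)
  moreover have "finite U"
    using F(1) by (simp add: U_def)
  ultimately show ?thesis
    using that by (metis (no_types))
qed

text \<open>In a representation with the fewest half-spaces, dropping one of them admits a point y
  outside K that satisfies all the others.\<close>

lemma polytope_irredundant_rep:
  fixes K :: "(real ^ 'n) set"
  assumes K: "polytope K" and z: "0 \<in> interior K"
  obtains U where "polytope_rep K U (support_function K)"
    "\<forall>u\<in>U. polytope_rep.open_facet U (support_function K) u \<noteq> {}"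
proof -
  let ?h = "support_function K"
  define P where "P V \<longleftrightarrow> finite V \<and> (\<forall>u\<in>V. norm u = 1) \<and> (\<forall>x. x \<in> K \<longleftrightarrow> (\<forall>u\<in>V. x \<bullet> u \<le> ?h u))" for V
  obtain V where V: "finite V" "\<And>u. u \<in> V \<Longrightarrow> norm u = 1" "K = {x. \<forall>u\<in>V. x \<bullet> u \<le> ?h u}"
    by (rule polytope_halfspace_rep[OF assms]) (rule that; simp)
  have "P V"
    unfolding P_def using V(1,2) V(3)[THEN eqset_imp_iff] by simp
  then obtain U where PU: "P U" and min: "\<And>V. P V \<Longrightarrow> card U \<le> card V"
    using ex_has_least_nat[of P V card] by blast
  then have U: "finite U" "\<And>u. u \<in> U \<Longrightarrow> norm u = 1" "\<And>x. x \<in> K \<longleftrightarrow> (\<forall>u\<in>U. x \<bullet> u \<le> ?h u)"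
    unfolding P_def by blast+
  have bK: "bounded K" using K by (rule polytope_imp_bounded)
  obtain e where e: "e > 0" "cball 0 e \<subseteq> K" using z mem_interior_cball by blast
  have hpos: "?h u > 0" if u: "u \<in> U" for u
  proof -
    have n: "norm u = 1" using U(2) u by blast
    have "e *\<^sub>R u \<in> K" using e n by (intro subsetD[OF e(2)]) simp
    then have "(e *\<^sub>R u) \<bullet> u \<le> ?h u" using U(3) u by blast
    then show ?thesis using e n by (simp add: norm_eq_1)
  qed
  interpret polytope_rep K U ?h
    using U(1,2) hpos bK by unfold_locales (use U(3) in blast)+
  have "open_facet u \<noteq> {}" if u: "u \<in> U" for u
  proof -
    have "\<not> P (U - {u})"
      using min[of "U - {u}"] card_Diff1_less[OF U(1) u] by linarith
    then obtain y where y: "\<forall>v\<in>U - {u}. y \<bullet> v \<le> ?h v" "y \<notin> K"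
      unfolding P_def using U by (metis DiffD1 finite_Diff)
    then have yu: "y \<bullet> u > ?h u"
      unfolding U(3) by (metis Diff_iff not_less singletonD)
    \<comment> \<open>The segment from 0 to y crosses the hyperplane of u here. The other
      inequalities become strict, since 0 satisfies them strictly.\<close>
    define s where "s = ?h u / (y \<bullet> u)"
    have s: "0 < s" "s < 1" using yu hpos[OF u] by (auto simp: s_def)
    have "(s *\<^sub>R y) \<bullet> u = ?h u" using yu hpos[OF u] by (simp add: s_def)
    moreover have "(s *\<^sub>R y) \<bullet> v < ?h v" if v: "v \<in> U - {u}" for v
    proof (cases "y \<bullet> v \<le> 0")
      case True
      then have "s * (y \<bullet> v) \<le> 0" using s by (simp add: mult_nonneg_nonpos)
      then show ?thesis using hpos[of v] v by simp
    next
      case False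
      then have "s * (y \<bullet> v) < 1 * (y \<bullet> v)" using s by (intro mult_strict_right_mono) auto
      then show ?thesis using y(1) v by force
    qed
    ultimately have "s *\<^sub>R y \<in> open_facet u" by (simp add: open_facet_def)
    then show ?thesis by blast
  qed
  then show ?thesis
    using that[OF polytope_rep_axioms] by blast
qed

text \<open>If all normals lay in the hyperplane H, all multiples of a vector orthogonal to H would
  belong to the bounded set K. So some normal lies off H, and in an irredundant representation it
  carries positive mass.\<close>

lemma Lp_surface_area_measure_not_concentrated:
  fixes K :: "(real ^ 'n) set"
  assumes K: "polytope K" "aff_dim K = int CARD('n)" "uminus ` K = K"
    and S: "great_subsphere S" and conc: "concentrated_on (Lp_surface_area_measure p K) S"
  shows False
proof -
  have "affine hull K = UNIV" using K(2) aff_dim_eq_full[of K] by simp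
  moreover have "K \<noteq> {}" using calculation by auto
  ultimately have "interior K \<noteq> {}"
    using rel_interior_interior[of K] rel_interior_eq_empty[of K] polytope_imp_convex[OF K(1)] by auto
  then have z: "0 \<in> interior K"
    using K(3) polytope_imp_convex[OF K(1)] by (intro zero_in_interior_symmetric)
  obtain U where rep: "polytope_rep K U (support_function K)"
    and ne: "\<forall>u\<in>U. polytope_rep.open_facet U (support_function K) u \<noteq> {}"
    using polytope_irredundant_rep[OF K(1) z] .
  interpret polytope_rep K U "support_function K" by (rule rep)
  obtain H where H: "subspace H" "dim H = CARD('n) - 1" "S = sphere 0 1 \<inter> H"
    using S by (auto simp: great_subsphere_def)
  have "dim H < DIM(real ^ 'n)" using H(2) by simp
  then obtain a where a: "a \<noteq> 0" "span H \<subseteq> {x. a \<bullet> x = 0}"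
    using lowdim_subset_hyperplane by blast
  have "\<not> U \<subseteq> H"
  proof
    assume UH: "U \<subseteq> H"
    have "t *\<^sub>R a \<in> K" for t
    proof -
      have "(t *\<^sub>R a) \<bullet> u \<le> support_function K u" if "u \<in> U" for u
        using that a(2) UH span_superset[of H] h_pos[OF that] by (auto simp: subset_iff less_imp_le)
      then show ?thesis by (subst K_eq) simp
    qed
    moreover obtain B where "B > 0" "\<And>x. x \<in> K \<Longrightarrow> norm x \<le> B"
      using bounded_K bounded_pos by blast
    ultimately have "norm (((B + 1) / norm a) *\<^sub>R a) \<le> B" by blast
    then show False using a \<open>B > 0\<close> by simp
  qed
  then obtain u where u: "u \<in> U" "u \<notin> H" by blast
  obtain y where y: "y \<in> open_facet u" using ne u(1) by blast
  have "emeasure (Lp_surface_area_measure p K) {u}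
      \<le> emeasure (Lp_surface_area_measure p K) (space (Lp_surface_area_measure p K) - S)"
  proof (rule emeasure_mono)
    have sp: "space (Lp_surface_area_measure p K) = sphere 0 1"
      using sets_eq_imp_space_eq[OF sets_Lp_surface_area_measure] by (simp add: space_borel_sphere)
    show "{u} \<subseteq> space (Lp_surface_area_measure p K) - S"
      using u H(3) norm_U sp by auto
    have "closed H" using H(1) by (rule closed_subspace)
    then show "space (Lp_surface_area_measure p K) - S \<in> sets (Lp_surface_area_measure p K)"
      using borel_closed[of H] by (auto simp: sp H(3) borel_sphere_def sets_restrict_space intro!: image_eqI[where x = "- H"])
  qed
  also have "\<dots> = 0" using conc by (simp add: concentrated_on_def)
  finally have "emeasure (Lp_surface_area_measure p K) {u} = 0"
    by simp
  then have "ennreal (support_function K u powr (1 - p)) * (cell_measure (undefined :: 'n) * facet_area u) = 0"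
    by (simp only: emeasure_Lp_surface_area_measure_singleton[OF u(1), of p "undefined :: 'n"])
  then show False
    using facet_area_pos[OF u(1) y] cell_measure_pos[of "undefined :: 'n"] h_pos[OF u(1)]
    by (auto simp: ennreal_eq_0_iff)
qed

section \<open>The volume of an intersection of slabs\<close>

text \<open>Cavalieri's principle in an arbitrary direction without a choice of coordinates. The
  prisms thicken every slice by an interval of length 1, and integrating over this extra variable
  last gives back the factor 1.\<close>

lemma emeasure_slab_eq_nn_integral_prism:
  fixes u :: "'a::euclidean_space"
  assumes u: "norm u = 1" and C [measurable]: "C \<in> sets borel"
  shows "emeasure lborel (C \<inter> {x. \<alpha> < x \<bullet> u \<and> x \<bullet> u \<le> \<beta>})
    = (\<integral>\<^sup>+ s. emeasure lborel (prism u s C) * indicator {\<alpha><..\<beta>} s \<partial>lborel)"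
proof -
  let ?f = "\<lambda>s x. of_bool (0 \<le> x \<bullet> u \<and> x \<bullet> u \<le> 1 \<and> x + (s - x \<bullet> u) *\<^sub>R u \<in> C \<and> \<alpha> < s \<and> s \<le> \<beta>) :: ennreal"
  let ?g = "\<lambda>r x. of_bool (0 \<le> x \<bullet> u \<and> x \<bullet> u \<le> 1 \<and> x + r *\<^sub>R u \<in> C \<and> \<alpha> < x \<bullet> u + r \<and> x \<bullet> u + r \<le> \<beta>) :: ennreal"
  let ?g' = "\<lambda>r y. of_bool (0 \<le> y \<bullet> u - r \<and> y \<bullet> u - r \<le> 1 \<and> y \<in> C \<and> \<alpha> < y \<bullet> u \<and> y \<bullet> u \<le> \<beta>) :: ennreal"
  let ?S = "C \<inter> {x. \<alpha> < x \<bullet> u \<and> x \<bullet> u \<le> \<beta>}"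
  have uu: "u \<bullet> u = 1" using u by (simp add: norm_eq_1)
  have [measurable]: "(\<lambda>x. x \<in> C) \<in> measurable borel (count_space UNIV)"
    using C by simp
  have "(\<integral>\<^sup>+ s. emeasure lborel (prism u s C) * indicator {\<alpha><..\<beta>} s \<partial>lborel)
      = (\<integral>\<^sup>+ s. \<integral>\<^sup>+ x. ?f s x \<partial>lborel \<partial>lborel)"
  proof (rule nn_integral_cong)
    fix s :: real
    have "emeasure lborel (prism u s C) * indicator {\<alpha><..\<beta>} s
        = (\<integral>\<^sup>+ x. indicator (prism u s C) x * indicator {\<alpha><..\<beta>} s \<partial>lborel)"
      using sets_prism[OF C] by (simp add: nn_integral_multc)
    also have "\<dots> = (\<integral>\<^sup>+ x. ?f s x \<partial>lborel)"
      by (rule nn_integral_cong) (auto simp: prism_def indicator_def)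
    finally show "emeasure lborel (prism u s C) * indicator {\<alpha><..\<beta>} s = \<dots>" .
  qed
  also have "\<dots> = (\<integral>\<^sup>+ x. \<integral>\<^sup>+ s. ?f s x \<partial>lborel \<partial>lborel)"
    by (rule lborel_pair.Fubini') measurable
  \<comment> \<open>Substitution s = x \<bullet> u + r: the projection of x becomes a translation by
    r along u.\<close>
  also have "\<dots> = (\<integral>\<^sup>+ x. \<integral>\<^sup>+ r. ?g r x \<partial>lborel \<partial>lborel)"
  proof (rule nn_integral_cong)
    fix x :: 'a
    have "(\<integral>\<^sup>+ s. ?f s x \<partial>lborel)
      = (\<integral>\<^sup>+ s. ?f s x
          \<partial>distr lborel borel ((+) (x \<bullet> u)))"
      by (simp add: lborel_distr_plus)
    also have "\<dots> = (\<integral>\<^sup>+ r. ?g r x \<partial>lborel)"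
      by (subst nn_integral_distr) (auto intro!: nn_integral_cong)
    finally show "(\<integral>\<^sup>+ s. ?f s x \<partial>lborel) = \<dots>" .
  qed
  also have "\<dots> = (\<integral>\<^sup>+ r. \<integral>\<^sup>+ x. ?g r x \<partial>lborel \<partial>lborel)"
    by (rule lborel_pair.Fubini') measurable
  \<comment> \<open>Substitution y = x + r u for fixed r, so that membership in C concerns the
    integration variable itself.\<close>
  also have "\<dots> = (\<integral>\<^sup>+ r. \<integral>\<^sup>+ y. ?g' r y \<partial>lborel \<partial>lborel)"
  proof (rule nn_integral_cong)
    fix r :: real
    have "(\<integral>\<^sup>+ y. ?g' r y \<partial>lborel)
      = (\<integral>\<^sup>+ y. ?g' r y \<partial>distr lborel borel ((+) (r *\<^sub>R u)))"
      by (simp add: lborel_distr_plus)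
    also have "\<dots> = (\<integral>\<^sup>+ x. ?g r x \<partial>lborel)"
      by (subst nn_integral_distr) (auto intro!: nn_integral_cong simp: inner_add_left uu add.commute)
    finally show "(\<integral>\<^sup>+ x. ?g r x \<partial>lborel)
      = (\<integral>\<^sup>+ y. ?g' r y \<partial>lborel)" by simp
  qed
  also have "\<dots> = (\<integral>\<^sup>+ y. \<integral>\<^sup>+ r. ?g' r y \<partial>lborel \<partial>lborel)"
    by (rule lborel_pair.Fubini') measurable
  \<comment> \<open>For fixed y the variable r runs over an interval of length 1.\<close>
  also have "\<dots> = (\<integral>\<^sup>+ y. indicator ?S y \<partial>lborel)"
  proof (rule nn_integral_cong)
    fix y :: 'a
    have "(\<integral>\<^sup>+ r. ?g' r y \<partial>lborel)
      = (\<integral>\<^sup>+ r. indicator ?S y * indicator {y \<bullet> u - 1..y \<bullet> u} r \<partial>lborel)"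
      by (rule nn_integral_cong) (auto simp: indicator_def)
    also have "\<dots> = indicator ?S y"
      by (simp add: nn_integral_cmult)
    finally show "(\<integral>\<^sup>+ r. ?g' r y \<partial>lborel)
      = indicator ?S y" .
  qed
  also have "\<dots> = emeasure lborel ?S"
    by (rule nn_integral_indicator) measurable
  finally show ?thesis by simp
qed

text \<open>The coordinate vectors are combinations of the spanning set, so the scalar products with
  it control all coordinates. The bound is linear in c on purpose: c = 0 gives injectivity, positive
  c gives boundedness of intersections of slabs.\<close>

lemma norm_le_of_spanning:
  fixes S :: "(real ^ 'n) set"
  assumes "finite S" "span S = UNIV"
  obtains R where "R > 0" "\<And>x c. (\<And>v. v \<in> S \<Longrightarrow> \<bar>x \<bullet> v\<bar> \<le> c) \<Longrightarrow> norm x \<le> R * c"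
proof -
  have "\<exists>\<alpha>. axis k 1 = (\<Sum>v\<in>S. \<alpha> v *\<^sub>R v)" for k :: 'n
  proof -
    have "(axis k 1 :: real ^ 'n) \<in> range (\<lambda>\<alpha>. \<Sum>v\<in>S. \<alpha> v *\<^sub>R v)"
      unfolding span_finite[OF assms(1), symmetric] assms(2) by simp
    then show ?thesis by auto
  qed
  then obtain \<alpha> where \<alpha>: "\<And>k :: 'n. axis k 1 = (\<Sum>v\<in>S. \<alpha> k v *\<^sub>R v)"
    by metis
  define R where "R = 1 + (\<Sum>k\<in>(UNIV::'n set). \<Sum>v\<in>S. \<bar>\<alpha> k v\<bar>)"
  have R: "R \<ge> 1" unfolding R_def by (simp add: sum_nonneg)
  have S: "S \<noteq> {}"
  proof
    assume "S = {}"
    then have "axis undefined 1 = (0 :: real ^ 'n)" using \<alpha>[of undefined] by simp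
    then show False by simp
  qed
  have "norm x \<le> R * c" if c: "\<And>v. v \<in> S \<Longrightarrow> \<bar>x \<bullet> v\<bar> \<le> c" for x c
  proof -
    have c0: "c \<ge> 0" using c S by force
    have "\<bar>x $ k\<bar> \<le> (\<Sum>v\<in>S. \<bar>\<alpha> k v\<bar>) * c" for k
    proof -
      have "x $ k = x \<bullet> axis k 1" by (simp add: inner_axis)
      also have "\<dots> = (\<Sum>v\<in>S. \<alpha> k v * (x \<bullet> v))" by (subst \<alpha>) (simp add: inner_sum_right)
      finally have "\<bar>x $ k\<bar> \<le> (\<Sum>v\<in>S. \<bar>\<alpha> k v * (x \<bullet> v)\<bar>)" by (simp add: sum_abs)
      also have "\<dots> \<le> (\<Sum>v\<in>S. \<bar>\<alpha> k v\<bar> * c)"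
        using c by (intro sum_mono) (auto simp: abs_mult intro!: mult_left_mono)
      finally show ?thesis by (simp add: sum_distrib_right)
    qed
    then have "(\<Sum>k\<in>UNIV. \<bar>x $ k\<bar>) \<le> (\<Sum>k\<in>(UNIV::'n set). (\<Sum>v\<in>S. \<bar>\<alpha> k v\<bar>) * c)"
      by (intro sum_mono)
    then have "norm x \<le> (R - 1) * c"
      using norm_le_l1_cart[of x] by (simp add: R_def sum_distrib_right)
    also have "\<dots> \<le> R * c" using c0 by (intro mult_right_mono) auto
    finally show ?thesis .
  qed
  then show ?thesis using R by (intro that[of R]) auto
qed

lemma measure_tendsto_pointwise:
  fixes S :: "nat \<Rightarrow> 'a::euclidean_space set"
  assumes meas: "\<And>n. S n \<in> sets borel" "T \<in> sets borel" and B: "\<And>n. S n \<subseteq> cball 0 B"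
    and N: "N \<in> null_sets lborel"
    and ev: "\<And>x. x \<notin> N \<Longrightarrow> eventually (\<lambda>n. x \<in> S n \<longleftrightarrow> x \<in> T) sequentially"
  shows "(\<lambda>n. measure lborel (S n)) \<longlonglongrightarrow> measure lborel T"
proof -
  have "(\<lambda>n. \<integral>x. indicat_real (S n) x \<partial>lborel) \<longlonglongrightarrow> (\<integral>x. indicat_real T x \<partial>lborel)"
  proof (rule integral_dominated_convergence[where w = "indicat_real (cball 0 B)"])
    show "integrable lborel (indicat_real (cball 0 B :: 'a set))"
      using emeasure_lborel_cball_finite[of 0 B] by (intro integrable_real_indicator) auto
    show "AE x in lborel. (\<lambda>n. indicat_real (S n) x) \<longlonglongrightarrow> indicat_real T x"
    proof (rule AE_I'[OF N], safe)
      fix x assume "\<not> (\<lambda>n. indicat_real (S n) x) \<longlonglongrightarrow> indicat_real T x"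
      then show "x \<in> N"
        using ev[of x] by (auto intro!: tendsto_eventually elim!: eventually_mono simp: indicator_def)
    qed
    show "AE x in lborel. norm (indicat_real (S n) x) \<le> indicat_real (cball 0 B) x" for n
      using B[of n] by (intro AE_I2) (auto simp: indicator_def)
  qed (use meas in auto)
  then show ?thesis using meas by simp
qed


lemma hyperplane_null_set:
  fixes a :: "'a::euclidean_space"
  shows "a \<noteq> 0 \<Longrightarrow> {x. a \<bullet> x = b} \<in> null_sets lborel"
  using emeasure_lborel_hyperplane[of a b]
  by (auto simp: null_sets_def intro!: borel_closed closed_Collect_eq continuous_intros)

lemma eventually_abs_le_iff:
  fixes y :: real
  assumes "a \<longlonglongrightarrow> y" "b \<longlonglongrightarrow> c" "y \<noteq> c" "y \<noteq> - c"
  shows "eventually (\<lambda>n. \<bar>a n\<bar> \<le> b n \<longleftrightarrow> \<bar>y\<bar> \<le> c) sequentially"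
proof -
  have lim: "(\<lambda>n. b n - \<bar>a n\<bar>) \<longlonglongrightarrow> c - \<bar>y\<bar>"
    using assms by (intro tendsto_intros)
  have "c - \<bar>y\<bar> \<noteq> 0" using assms(3,4) by auto
  then consider "c - \<bar>y\<bar> > 0" | "c - \<bar>y\<bar> < 0" by linarith
  then show ?thesis
  proof cases
    case 1
    then show ?thesis using order_tendstoD(1)[OF lim 1] by (auto elim: eventually_mono)
  next
    case 2
    then show ?thesis using order_tendstoD(2)[OF lim 2] by (auto elim: eventually_mono)
  qed
qed

lemma eventually_all_less_iff:
  fixes P :: "nat \<Rightarrow> nat \<Rightarrow> bool" and N :: nat
  assumes "\<And>i. i < N \<Longrightarrow> eventually (\<lambda>n. P n i \<longleftrightarrow> Q i) sequentially"
  shows "eventually (\<lambda>n. (\<forall>i<N. P n i) \<longleftrightarrow> (\<forall>i<N. Q i)) sequentially"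
proof -
  have "eventually (\<lambda>n. \<forall>i\<in>{..<N}. P n i \<longleftrightarrow> Q i) sequentially"
    using assms by (intro eventually_ball_finite) auto
  then show ?thesis by (rule eventually_mono) auto
qed

section \<open>Continuity of volume and face areas in the support numbers\<close>

locale slabs =
  fixes u :: "nat \<Rightarrow> real ^ 'n" and N :: nat
  assumes norm_u: "\<And>i. i < N \<Longrightarrow> norm (u i) = 1"
    and nonparallel: "\<And>i j. i < N \<Longrightarrow> j < N \<Longrightarrow> i \<noteq> j \<Longrightarrow> u i \<noteq> u j \<and> u i \<noteq> - u j"
    and spanning: "span (u ` {..<N}) = UNIV"
begin

definition body :: "(nat \<Rightarrow> real) \<Rightarrow> (real ^ 'n) set" where
  "body h = {x. \<forall>i<N. \<bar>x \<bullet> u i\<bar> \<le> h i}"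

definition vol :: "(nat \<Rightarrow> real) \<Rightarrow> real" where
  "vol h = measure lborel (body h)"

definition face_area :: "nat \<Rightarrow> (nat \<Rightarrow> real) \<Rightarrow> real" where
  "face_area i h = measure lborel (prism (u i) (h i) (body h))"

lemma u_self: "i < N \<Longrightarrow> u i \<bullet> u i = 1"
  using norm_u by (simp add: norm_eq_1)

lemma vol_nonneg: "vol h \<ge> 0"
  by (simp add: vol_def)

lemma face_area_nonneg: "face_area i h \<ge> 0"
  by (simp add: face_area_def)

lemma closed_body: "closed (body h)"
proof -
  have "body h = (\<Inter>i\<in>{..<N}. {x. \<bar>x \<bullet> u i\<bar> \<le> h i})" by (auto simp: body_def)
  then show ?thesis by (auto intro!: closed_INT closed_Collect_le continuous_intros)
qed

lemma sets_body: "body h \<in> sets borel"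
  by (rule borel_closed[OF closed_body])

lemma norm_body_le:
  obtains R where "R > 0" "\<forall>x h c. x \<in> body h \<longrightarrow> (\<forall>i<N. h i \<le> c) \<longrightarrow> norm x \<le> R * c"
proof -
  obtain R where R: "R > 0" "\<And>x c. (\<And>v. v \<in> u ` {..<N} \<Longrightarrow> \<bar>x \<bullet> v\<bar> \<le> c) \<Longrightarrow> norm x \<le> R * c"
    using norm_le_of_spanning[OF _ spanning] by blast
  show ?thesis
  proof (rule that[OF R(1)])
    show "\<forall>x h c. x \<in> body h \<longrightarrow> (\<forall>i<N. h i \<le> c) \<longrightarrow> norm x \<le> R * c"
      by (intro allI impI R(2)) (auto simp: body_def intro: order_trans)
  qed
qed

lemma bounded_body: "bounded (body h)"
proof -
  obtain R where R: "R > 0" "\<forall>x h c. x \<in> body h \<longrightarrow> (\<forall>i<N. h i \<le> c) \<longrightarrow> norm x \<le> R * c"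
    using norm_body_le .
  have "h i \<le> (\<Sum>i<N. \<bar>h i\<bar>)" if "i < N" for i
    using member_le_sum[of i "{..<N}" "\<lambda>i. \<bar>h i\<bar>"] that by auto
  then have "\<forall>x\<in>body h. norm x \<le> R * (\<Sum>i<N. \<bar>h i\<bar>)"
    using R(2) by blast
  then show ?thesis using bounded_iff by blast
qed

text \<open>On the prism, constraint j becomes a slab in the direction of the component of u j
  orthogonal to u i. Constraint i holds automatically, the projected point being at height h i \<ge>
  0.\<close>

lemma prism_body_eq:
  assumes "i < N" "h i \<ge> 0"
  shows "prism (u i) (h i) (body h) = {x. 0 \<le> x \<bullet> u i \<and> x \<bullet> u i \<le> 1 \<and>
    (\<forall>j<N. j \<noteq> i \<longrightarrow> \<bar>x \<bullet> (u j - (u i \<bullet> u j) *\<^sub>R u i) + h i * (u i \<bullet> u j)\<bar> \<le> h j)}"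
proof -
  have *: "(x + (h i - x \<bullet> u i) *\<^sub>R u i) \<bullet> u j = x \<bullet> (u j - (u i \<bullet> u j) *\<^sub>R u i) + h i * (u i \<bullet> u j)" for x j
    by (simp add: algebra_simps)
  have i: "(x + (h i - x \<bullet> u i) *\<^sub>R u i) \<bullet> u i = h i" for x
    using u_self[OF assms(1)] by (simp add: algebra_simps)
  have "x + (h i - x \<bullet> u i) *\<^sub>R u i \<in> body h \<longleftrightarrow>
    (\<forall>j<N. j \<noteq> i \<longrightarrow> \<bar>x \<bullet> (u j - (u i \<bullet> u j) *\<^sub>R u i) + h i * (u i \<bullet> u j)\<bar> \<le> h j)" for x
    unfolding body_def mem_Collect_eq using i[of x] assms * by (metis abs_of_nonneg order_refl)
  then show ?thesis
    by (auto simp: prism_def)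
qed

lemma coefficient_nonzero:
  assumes "i < N" "j < N" "j \<noteq> i"
  shows "u j - (u i \<bullet> u j) *\<^sub>R u i \<noteq> 0"
proof
  assume "u j - (u i \<bullet> u j) *\<^sub>R u i = 0"
  then have *: "u j = (u i \<bullet> u j) *\<^sub>R u i" by simp
  then have "norm (u j) = \<bar>u i \<bullet> u j\<bar> * norm (u i)" by (metis norm_scaleR)
  then have "\<bar>u i \<bullet> u j\<bar> = 1" using norm_u assms by simp
  then have "u j = u i \<or> u j = - u i" using * by (metis abs_eq_iff' abs_1 scaleR_minus1_left scaleR_one)
  then show False using nonparallel[OF assms(2,1)] assms(3) by auto
qed

lemma bodies_uniformly_bounded:
  assumes "\<And>i. i < N \<Longrightarrow> (\<lambda>n. H n i) \<longlonglongrightarrow> h i"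
  obtains B where "\<And>n. body (H n) \<subseteq> cball 0 B" "body h \<subseteq> cball 0 B"
    "\<And>n i. i < N \<Longrightarrow> \<bar>H n i\<bar> \<le> B" "B > 0"
proof -
  obtain R where R: "R > 0" "\<forall>x h c. x \<in> body h \<longrightarrow> (\<forall>i<N. h i \<le> c) \<longrightarrow> norm x \<le> R * c"
    using norm_body_le .
  have "\<exists>b. \<forall>n. \<bar>H n i\<bar> \<le> b" if "i < N" for i
    using assms[OF that] convergent_imp_Bseq[of "\<lambda>n. H n i"] by (auto simp: convergent_def Bseq_def)
  then obtain b where b: "\<And>i n. i < N \<Longrightarrow> \<bar>H n i\<bar> \<le> b i" by metis
  define c where "c = 1 + (\<Sum>i<N. \<bar>b i\<bar> + \<bar>h i\<bar>)"
  have mem: "\<bar>b i\<bar> + \<bar>h i\<bar> \<le> c - 1" if "i < N" for i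
    using member_le_sum[of i "{..<N}" "\<lambda>i. \<bar>b i\<bar> + \<bar>h i\<bar>"] that by (auto simp: c_def)
  have c: "c > 0" unfolding c_def by (intro add_pos_nonneg sum_nonneg) auto
  have 1: "\<bar>H n i\<bar> \<le> c" "h i \<le> c" if "i < N" for n i
    using mem[OF that] b[OF that, of n] by linarith+
  show ?thesis
  proof (rule that[of "(R + 1) * c"])
    show "body (H n) \<subseteq> cball 0 ((R + 1) * c)" for n
    proof
      fix x assume "x \<in> body (H n)"
      then have "norm x \<le> R * c" using R(2) 1(1) abs_le_D1 by blast
      then show "x \<in> cball 0 ((R + 1) * c)" using c by (simp add: algebra_simps)
    qed
    show "body h \<subseteq> cball 0 ((R + 1) * c)"
    proof
      fix x assume "x \<in> body h"
      then have "norm x \<le> R * c" using R(2) 1(2) by blast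
      then show "x \<in> cball 0 ((R + 1) * c)" using c by (simp add: algebra_simps)
    qed
    show "\<bar>H n i\<bar> \<le> (R + 1) * c" if "i < N" for n i
    proof -
      have "1 * c \<le> (R + 1) * c" using R c by (intro mult_right_mono) auto
      then show ?thesis using 1(1)[OF that, of n] by linarith
    qed
  qed (use R c in simp)
qed

text \<open>A point off the bounding hyperplanes of the limit body is eventually classified as by
  the limit body; dominated convergence of the indicators does the rest.\<close>

lemma vol_tendsto:
  assumes H: "\<And>i. i < N \<Longrightarrow> (\<lambda>n. H n i) \<longlonglongrightarrow> h i"
  shows "(\<lambda>n. vol (H n)) \<longlonglongrightarrow> vol h"
proof -
  obtain B where B: "\<And>n. body (H n) \<subseteq> cball 0 B"
    using bodies_uniformly_bounded[of H h, OF H] by metis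
  define X where "X = (\<Union>i<N. {x. u i \<bullet> x = h i} \<union> {x. u i \<bullet> x = - h i})"
  have u0: "u i \<noteq> 0" if "i < N" for i using norm_u[OF that] by auto
  show ?thesis
    unfolding vol_def
  proof (rule measure_tendsto_pointwise[OF sets_body sets_body B])
    show "X \<in> null_sets lborel"
      unfolding X_def using u0 by (intro null_sets_UN' null_sets.Un hyperplane_null_set) auto
    fix x assume x: "x \<notin> X"
    show "eventually (\<lambda>n. x \<in> body (H n) \<longleftrightarrow> x \<in> body h) sequentially"
      unfolding body_def mem_Collect_eq
    proof (rule eventually_all_less_iff, rule eventually_abs_le_iff)
      fix i assume i: "i < N"
      show "x \<bullet> u i \<noteq> h i" "x \<bullet> u i \<noteq> - h i" using x i by (auto simp: X_def inner_commute)
    qed (use H in auto)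
  qed
qed

text \<open>As for the volume, with the projected slabs of the prism. Their bounding hyperplanes are
  null sets because no two normals are parallel.\<close>

lemma face_area_tendsto:
  assumes i: "i < N" and H: "\<And>j. j < N \<Longrightarrow> (\<lambda>n. H n j) \<longlonglongrightarrow> h j"
    and pos: "\<And>n. H n i \<ge> 0" "h i \<ge> 0"
  shows "(\<lambda>n. face_area i (H n)) \<longlonglongrightarrow> face_area i h"
proof -
  obtain B where B: "\<And>n. body (H n) \<subseteq> cball 0 B" "\<And>n i. i < N \<Longrightarrow> \<bar>H n i\<bar> \<le> B" "B > 0"
    using bodies_uniformly_bounded[of H h, OF H] by metis
  let ?w = "\<lambda>j. u j - (u i \<bullet> u j) *\<^sub>R u i"
  define X where "X = (\<Union>j\<in>{..<N} - {i}. {x. ?w j \<bullet> x = h j - h i * (u i \<bullet> u j)} \<union> {x. ?w j \<bullet> x = - h j - h i * (u i \<bullet> u j)})"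
  show ?thesis
    unfolding face_area_def
  proof (rule measure_tendsto_pointwise[OF sets_prism[OF sets_body] sets_prism[OF sets_body]])
    show "prism (u i) (H n i) (body (H n)) \<subseteq> cball 0 (2 * B + 1)" for n
    proof
      fix x assume x: "x \<in> prism (u i) (H n i) (body (H n))"
      let ?y = "x + (H n i - x \<bullet> u i) *\<^sub>R u i"
      have "norm ?y \<le> B" using x B(1)[of n] by (auto simp: prism_def)
      moreover have "norm ((H n i - x \<bullet> u i) *\<^sub>R u i) \<le> B + 1"
        using x B(2)[OF i, of n] norm_u[OF i] pos(1)[of n] by (auto simp: prism_def)
      ultimately show "x \<in> cball 0 (2 * B + 1)"
        using norm_triangle_ineq4[of ?y "(H n i - x \<bullet> u i) *\<^sub>R u i"] by simp
    qed
    show "X \<in> null_sets lborel"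
      unfolding X_def using coefficient_nonzero[OF i]
      by (intro null_sets_UN' null_sets.Un hyperplane_null_set) auto
    fix x assume x: "x \<notin> X"
    have "eventually (\<lambda>n. (\<forall>j<N. j \<noteq> i \<longrightarrow> \<bar>x \<bullet> ?w j + H n i * (u i \<bullet> u j)\<bar> \<le> H n j)
        \<longleftrightarrow> (\<forall>j<N. j \<noteq> i \<longrightarrow> \<bar>x \<bullet> ?w j + h i * (u i \<bullet> u j)\<bar> \<le> h j)) sequentially"
    proof (rule eventually_all_less_iff)
      fix j assume j: "j < N"
      show "eventually (\<lambda>n. (j \<noteq> i \<longrightarrow> \<bar>x \<bullet> ?w j + H n i * (u i \<bullet> u j)\<bar> \<le> H n j)
        \<longleftrightarrow> (j \<noteq> i \<longrightarrow> \<bar>x \<bullet> ?w j + h i * (u i \<bullet> u j)\<bar> \<le> h j)) sequentially"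
      proof (cases "j = i")
        case False
        have "x \<bullet> ?w j + h i * (u i \<bullet> u j) \<noteq> h j" "x \<bullet> ?w j + h i * (u i \<bullet> u j) \<noteq> - h j"
          using x j False unfolding X_def inner_commute[of x "?w j"]
          by (auto simp: eq_diff_eq diff_eq_eq)
        moreover have "(\<lambda>n. x \<bullet> ?w j + H n i * (u i \<bullet> u j)) \<longlonglongrightarrow> x \<bullet> ?w j + h i * (u i \<bullet> u j)"
          by (intro tendsto_intros H i)
        ultimately show ?thesis
          using eventually_abs_le_iff[OF _ H[OF j]] False by simp
      qed simp
    qed
    then show "eventually (\<lambda>n. x \<in> prism (u i) (H n i) (body (H n)) \<longleftrightarrow> x \<in> prism (u i) (h i) (body h)) sequentially"
      unfolding prism_body_eq[where h = h, OF i pos(2)] prism_body_eq[where h = "H _", OF i pos(1)]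
      by (rule eventually_mono) auto
  qed
qed

end

section \<open>The derivative of the volume\<close>

lemma emeasure_lborel_uminus:
  fixes S :: "'a::euclidean_space set"
  assumes "S \<in> sets borel"
  shows "emeasure lborel (uminus -` S) = emeasure lborel S"
proof -
  have "(lborel :: 'a measure) = distr lborel borel uminus"
    using lborel_affine[of "-1" "0 :: 'a"] by (simp add: density_1)
  then have "emeasure lborel S = emeasure (distr lborel borel uminus) S" by simp
  also have "\<dots> = emeasure lborel (uminus -` S)"
    using assms by (subst emeasure_distr) auto
  finally show ?thesis by simp
qed

context slabs
begin

lemma emeasure_body: "emeasure lborel (body h) = ennreal (vol h)"
  unfolding vol_def using emeasure_bounded_finite[OF bounded_body, of h]
  by (intro emeasure_eq_ennreal_measure) simp

lemma body_cong: "(\<And>i. i < N \<Longrightarrow> h i = h' i) \<Longrightarrow> body h = body h'"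
  by (simp add: body_def)

lemma vol_cong: "(\<And>i. i < N \<Longrightarrow> h i = h' i) \<Longrightarrow> vol h = vol h'"
  unfolding vol_def by (subst body_cong[of h h']) simp_all

lemma face_area_cong: "i < N \<Longrightarrow> (\<And>j. j < N \<Longrightarrow> h j = h' j) \<Longrightarrow> face_area i h = face_area i h'"
  unfolding face_area_def by (subst body_cong[of h h']) simp_all

text \<open>Widening slab i adds two opposite pieces of equal volume, and Cavalieri's principle
  expresses each of them by the face areas swept out.\<close>

lemma emeasure_body_upd:
  assumes i: "i < N" and ab: "0 \<le> \<alpha>" "\<alpha> \<le> \<beta>"
  shows "emeasure lborel (body (h(i := \<beta>))) = emeasure lborel (body (h(i := \<alpha>)))
    + 2 * (\<integral>\<^sup>+ s. ennreal (face_area i (h(i := s))) * indicator {\<alpha><..\<beta>} s \<partial>lborel)"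
proof -
  \<comment> \<open>The intersection of the other slabs does not depend on h i; its slice at height
    s \<ge> 0 is the face of the body with h i = s.\<close>
  define C where "C = {x. \<forall>j<N. j \<noteq> i \<longrightarrow> \<bar>x \<bullet> u j\<bar> \<le> h j}"
  have "C = (\<Inter>j\<in>{..<N} - {i}. {x. \<bar>x \<bullet> u j\<bar> \<le> h j})" by (auto simp: C_def)
  then have "closed C" by (auto intro!: closed_INT closed_Collect_le continuous_intros)
  then have C: "C \<in> sets borel" by (rule borel_closed)
  have body: "body (h(i := s)) = C \<inter> {x. \<bar>x \<bullet> u i\<bar> \<le> s}" for s
    using i by (auto simp: body_def C_def)
  define S where "S = C \<inter> {x. \<alpha> < x \<bullet> u i \<and> x \<bullet> u i \<le> \<beta>}"
  have S: "S \<in> sets borel"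
    unfolding S_def by (rule sets.Int[OF C]) measurable
  have S': "uminus -` S \<in> sets borel"
    using measurable_sets[OF _ S, of uminus borel] by simp
  have "body (h(i := \<beta>)) = body (h(i := \<alpha>)) \<union> (S \<union> uminus -` S)"
    using ab by (auto simp: body S_def C_def)
  moreover have "body (h(i := \<alpha>)) \<inter> (S \<union> uminus -` S) = {}" "S \<inter> uminus -` S = {}"
    using ab by (auto simp: body S_def)
  ultimately have "emeasure lborel (body (h(i := \<beta>)))
      = emeasure lborel (body (h(i := \<alpha>))) + (emeasure lborel S + emeasure lborel (uminus -` S))"
    using S S' sets_body by (simp add: plus_emeasure)
  also have "emeasure lborel S + emeasure lborel (uminus -` S) = 2 * emeasure lborel S"
    using emeasure_lborel_uminus[OF S] by (simp add: mult_2)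
  also have "emeasure lborel S = (\<integral>\<^sup>+ s. emeasure lborel (prism (u i) s C) * indicator {\<alpha><..\<beta>} s \<partial>lborel)"
    unfolding S_def by (rule emeasure_slab_eq_nn_integral_prism[OF norm_u[OF i] C])
  also have "\<dots> = (\<integral>\<^sup>+ s. ennreal (face_area i (h(i := s))) * indicator {\<alpha><..\<beta>} s \<partial>lborel)"
  proof (rule nn_integral_cong)
    fix s
    show "emeasure lborel (prism (u i) s C) * indicator {\<alpha><..\<beta>} s
      = ennreal (face_area i (h(i := s))) * indicator {\<alpha><..\<beta>} s"
    proof (cases "s \<in> {\<alpha><..\<beta>}")
      case True
      then have "s \<ge> 0" using ab by simp
      have "(x + (s - x \<bullet> u i) *\<^sub>R u i) \<bullet> u i = s" for x
        using u_self[OF i] by (simp add: algebra_simps)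
      then have "prism (u i) s C = prism (u i) s (body (h(i := s)))"
        using \<open>s \<ge> 0\<close> by (auto simp: prism_def body)
      moreover have "emeasure lborel (prism (u i) s (body (h(i := s)))) = ennreal (face_area i (h(i := s)))"
        using emeasure_prism_finite[OF bounded_body, of "u i" s "h(i := s)"]
        by (simp add: face_area_def emeasure_eq_ennreal_measure)
      ultimately show ?thesis by simp
    qed simp
  qed
  finally show ?thesis .
qed

lemma vol_upd_bounds:
  assumes i: "i < N" and ab: "0 \<le> \<alpha>" "\<alpha> \<le> \<beta>"
    and lo: "\<And>s. \<alpha> < s \<Longrightarrow> s \<le> \<beta> \<Longrightarrow> lo \<le> face_area i (h(i := s))"
    and hi: "\<And>s. \<alpha> < s \<Longrightarrow> s \<le> \<beta> \<Longrightarrow> face_area i (h(i := s)) \<le> hi" and "hi \<ge> 0"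
  shows "2 * lo * (\<beta> - \<alpha>) \<le> vol (h(i := \<beta>)) - vol (h(i := \<alpha>))"
    "vol (h(i := \<beta>)) - vol (h(i := \<alpha>)) \<le> 2 * hi * (\<beta> - \<alpha>)"
proof -
  let ?I = "\<integral>\<^sup>+ s. ennreal (face_area i (h(i := s))) * indicator {\<alpha><..\<beta>} s \<partial>lborel"
  have const: "(\<integral>\<^sup>+ s. ennreal c * indicator {\<alpha><..\<beta>} s \<partial>lborel) = ennreal (c * (\<beta> - \<alpha>))" if "c \<ge> 0" for c
    using ab that by (simp add: nn_integral_cmult_indicator ennreal_mult)
  have "?I \<le> (\<integral>\<^sup>+ s. ennreal hi * indicator {\<alpha><..\<beta>} s \<partial>lborel)"
    using hi by (intro nn_integral_mono) (auto simp: indicator_def intro!: ennreal_leI)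
  then have I_hi: "?I \<le> ennreal (hi * (\<beta> - \<alpha>))"
    using const[OF \<open>hi \<ge> 0\<close>] by simp
  \<comment> \<open>The lower bound may be negative, which \<open>ennreal\<close> would truncate;
    the face area is at least its positive part.\<close>
  have "(\<integral>\<^sup>+ s. ennreal (max lo 0) * indicator {\<alpha><..\<beta>} s \<partial>lborel) \<le> ?I"
    using lo face_area_nonneg by (intro nn_integral_mono) (auto simp: indicator_def intro!: ennreal_leI)
  then have I_lo: "ennreal (max lo 0 * (\<beta> - \<alpha>)) \<le> ?I"
    using const[of "max lo 0"] by simp
  obtain r where r: "r \<ge> 0" "?I = ennreal r"
    using le_less_trans[OF I_hi ennreal_less_top] by (cases ?I rule: ennreal_cases) auto
  have "ennreal (vol (h(i := \<beta>))) = ennreal (vol (h(i := \<alpha>))) + 2 * ennreal r"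
    using emeasure_body_upd[OF i ab, of h] r(2) by (simp add: emeasure_body)
  also have "\<dots> = ennreal (vol (h(i := \<alpha>)) + 2 * r)"
    using r(1) vol_nonneg[of "h(i := \<alpha>)"] by (simp add: ennreal_mult'')
  finally have eq: "vol (h(i := \<beta>)) = vol (h(i := \<alpha>)) + 2 * r"
    using r(1) vol_nonneg[of "h(i := \<alpha>)"] vol_nonneg[of "h(i := \<beta>)"] by (subst (asm) ennreal_inj) auto
  have "r \<le> hi * (\<beta> - \<alpha>)" using I_hi r \<open>hi \<ge> 0\<close> ab by (simp add: ennreal_le_iff)
  then show "vol (h(i := \<beta>)) - vol (h(i := \<alpha>)) \<le> 2 * hi * (\<beta> - \<alpha>)" by (simp add: eq)
  have "max lo 0 * (\<beta> - \<alpha>) \<le> r" using I_lo r by (simp add: ennreal_le_iff)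
  moreover have "lo * (\<beta> - \<alpha>) \<le> max lo 0 * (\<beta> - \<alpha>)" using ab by (intro mult_right_mono) auto
  ultimately show "2 * lo * (\<beta> - \<alpha>) \<le> vol (h(i := \<beta>)) - vol (h(i := \<alpha>))" by (simp add: eq)
qed

lemma face_area_upd_continuous:
  assumes i: "i < N" and "s > 0"
  shows "isCont (\<lambda>s. face_area i (h(i := s))) s"
  unfolding continuous_at_sequentially comp_def
proof (intro allI impI)
  fix t assume t: "t \<longlonglongrightarrow> s"
  \<comment> \<open>Convergence of the face areas asks for nonnegative support numbers throughout,
    so an initial segment of the sequence is dropped.\<close>
  have "eventually (\<lambda>n. t n > 0) sequentially"
    using order_tendstoD(1)[OF t \<open>s > 0\<close>] .
  then obtain n0 where n0: "\<And>n. n \<ge> n0 \<Longrightarrow> t n > 0"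
    by (auto simp: eventually_sequentially)
  have "(\<lambda>n. face_area i (h(i := t (n + n0)))) \<longlonglongrightarrow> face_area i (h(i := s))"
  proof (rule face_area_tendsto[OF i])
    show "(\<lambda>n. (h(i := t (n + n0))) j) \<longlonglongrightarrow> (h(i := s)) j" if "j < N" for j
      using LIMSEQ_ignore_initial_segment[OF t, of n0] by (cases "j = i") auto
  qed (use n0 \<open>s > 0\<close> in \<open>auto simp: less_imp_le\<close>)
  then show "(\<lambda>n. face_area i (h(i := t n))) \<longlonglongrightarrow> face_area i (h(i := s))"
    by (rule LIMSEQ_offset)
qed

lemma vol_upd_DERIV:
  assumes i: "i < N" and s: "s > 0"
  shows "((\<lambda>s. vol (h(i := s))) has_real_derivative 2 * face_area i (h(i := s))) (at s)"
  unfolding DERIV_def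
proof (rule LIM_I)
  fix e :: real assume e: "e > 0"
  let ?F = "\<lambda>s. face_area i (h(i := s))"
  \<comment> \<open>An error of e / 4 in the face area enters twice, once for each of the opposite
    faces, so the difference quotient is off by at most e / 2.\<close>
  obtain \<delta> where \<delta>: "\<delta> > 0" "\<And>t. dist t s < \<delta> \<Longrightarrow> dist (?F t) (?F s) < e / 4"
    using face_area_upd_continuous[OF i s, of h, unfolded continuous_at_eps_delta, THEN spec[of _ "e / 4"]] e
    by auto
  define d where "d = min \<delta> s"
  have key: "2 * (?F s - e / 4) * (b - a) \<le> vol (h(i := b)) - vol (h(i := a))"
    "vol (h(i := b)) - vol (h(i := a)) \<le> 2 * (?F s + e / 4) * (b - a)"
    if ab: "a \<le> b" "a > 0" "\<bar>a - s\<bar> < d" "\<bar>b - s\<bar> < d" for a b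
  proof -
    have *: "\<bar>?F t - ?F s\<bar> < e / 4" if "a < t" "t \<le> b" for t
      using \<delta>(2)[of t] that ab by (auto simp: dist_real_def d_def)
    have lo: "?F s - e / 4 \<le> ?F t" and hi: "?F t \<le> ?F s + e / 4" if "a < t" "t \<le> b" for t
      using *[OF that] by linarith+
    have "0 \<le> a" "0 \<le> ?F s + e / 4"
      using ab face_area_nonneg[of i "h(i := s)"] e by auto
    then show "2 * (?F s - e / 4) * (b - a) \<le> vol (h(i := b)) - vol (h(i := a))"
      "vol (h(i := b)) - vol (h(i := a)) \<le> 2 * (?F s + e / 4) * (b - a)"
      using vol_upd_bounds[OF i _ ab(1) lo hi] by blast+
  qed
  show "\<exists>r>0. \<forall>t::real. t \<noteq> 0 \<and> norm (t - 0) < r \<longrightarrow>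
    norm ((vol (h(i := s + t)) - vol (h(i := s))) / t - 2 * ?F s) < e"
  proof (intro exI[of _ d] conjI allI impI)
    show "d > 0" using \<delta> s by (simp add: d_def)
    fix t :: real assume "t \<noteq> 0 \<and> norm (t - 0) < d"
    then have t: "t \<noteq> 0" "\<bar>t\<bar> < d" by auto
    have st: "s + t > 0" using t by (auto simp: d_def)
    have "\<bar>vol (h(i := s + t)) - vol (h(i := s)) - 2 * ?F s * t\<bar> \<le> (e / 2) * \<bar>t\<bar>"
    proof (cases "t > 0")
      case True
      then show ?thesis
        using key[of s "s + t"] t s \<open>d > 0\<close> by (intro abs_leI) (simp_all add: algebra_simps)
    next
      case False
      then show ?thesis
        using key[of "s + t" s] t st \<open>d > 0\<close> by (intro abs_leI) (simp_all add: algebra_simps)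
    qed
    also have "\<dots> < e * \<bar>t\<bar>" using e t by simp
    finally have "\<bar>vol (h(i := s + t)) - vol (h(i := s)) - 2 * ?F s * t\<bar> / \<bar>t\<bar> < e"
      using t by (simp add: divide_less_eq)
    moreover have "(vol (h(i := s + t)) - vol (h(i := s))) / t - 2 * ?F s
        = (vol (h(i := s + t)) - vol (h(i := s)) - 2 * ?F s * t) / t"
      using t by (simp add: diff_divide_distrib)
    ultimately show "norm ((vol (h(i := s + t)) - vol (h(i := s))) / t - 2 * ?F s) < e"
      by (simp add: abs_divide)
  qed
qed

end

section \<open>The energy and its partial derivatives\<close>

locale weighted_slabs = slabs u N
  for u :: "nat \<Rightarrow> real ^ 'n" and N :: nat +
  fixes c :: "nat \<Rightarrow> real" and q :: real
  assumes c_pos: "\<And>i. i < N \<Longrightarrow> c i > 0" and q_pos: "q > 0"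
begin

text \<open>The critical points of \<open>energy\<close> on the positive orthant are the solutions
  \<open>face_area i h = c i * h i powr (p - 1)\<close> with \<open>q = - p\<close>.\<close>

definition energy :: "(nat \<Rightarrow> real) \<Rightarrow> real" where
  "energy h = vol h + 2 / q * (\<Sum>i<N. c i * h i powr (- q))"

text \<open>The area counts twice for the two opposite faces; in the other term the factor 2 / q of
  the energy cancels against the exponent - q.\<close>

definition gradient :: "nat \<Rightarrow> (nat \<Rightarrow> real) \<Rightarrow> real" where
  "gradient i h = 2 * face_area i h - 2 * c i * h i powr (- q - 1)"

lemma energy_cong: "(\<And>i. i < N \<Longrightarrow> h i = h' i) \<Longrightarrow> energy h = energy h'"
  unfolding energy_def by (subst vol_cong[of h h']) simp_all

lemma energy_terms_nonneg: "0 \<le> (\<Sum>i<N. c i * h i powr (- q))"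
  by (intro sum_nonneg mult_nonneg_nonneg) (auto intro: less_imp_le c_pos)

lemma vol_le_energy: "vol h \<le> energy h"
  using energy_terms_nonneg[of h] q_pos by (simp add: energy_def)

lemma energy_nonneg: "energy h \<ge> 0"
  using vol_nonneg vol_le_energy by (rule order_trans)

lemma energy_ge_term:
  assumes "i < N"
  shows "2 / q * (c i * h i powr (- q)) \<le> energy h"
proof -
  have "c i * h i powr (- q) \<le> (\<Sum>i<N. c i * h i powr (- q))"
    using assms c_pos by (intro member_le_sum mult_nonneg_nonneg) (auto intro: less_imp_le)
  then have "2 / q * (c i * h i powr (- q)) \<le> 2 / q * (\<Sum>i<N. c i * h i powr (- q))"
    using q_pos by (intro mult_left_mono) auto
  then show ?thesis using vol_nonneg[of h] by (simp add: energy_def)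
qed

lemma energy_upd_DERIV:
  assumes i: "i < N" and s: "s > 0"
  shows "((\<lambda>s. energy (h(i := s))) has_real_derivative gradient i (h(i := s))) (at s)"
proof -
  have eq: "energy (h(i := s)) = vol (h(i := s)) + 2 / q * (c i * s powr (- q))
      + 2 / q * (\<Sum>j\<in>{..<N} - {i}. c j * h j powr (- q))" for s
    using i by (simp add: energy_def sum.remove[of "{..<N}" i] distrib_left)
  have "((\<lambda>s. vol (h(i := s)) + 2 / q * (c i * s powr (- q))
      + 2 / q * (\<Sum>j\<in>{..<N} - {i}. c j * h j powr (- q))) has_real_derivative
      2 * face_area i (h(i := s)) + 2 / q * (c i * (- q * s powr (- q - 1))) + 0) (at s)"
    using s by (intro DERIV_add DERIV_cmult vol_upd_DERIV i has_real_derivative_powr DERIV_const)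
  then show ?thesis
    using q_pos by (simp add: eq gradient_def mult_ac)
qed

lemma energy_diff_coordinate:
  assumes i: "i < N" and "a > 0" "b > 0"
  obtains s where "min a b \<le> s" "s \<le> max a b" "energy (h(i := b)) - energy (h(i := a)) = (b - a) * gradient i (h(i := s))"
proof (cases a b rule: linorder_cases)
  case less
  obtain s where "a < s" "s < b" "energy (h(i := b)) - energy (h(i := a)) = (b - a) * gradient i (h(i := s))"
    using MVT2[OF less energy_upd_DERIV[OF i less_le_trans[OF assms(2)]]] by blast
  then show ?thesis by (intro that[of s]) auto
next
  case greater
  obtain s where "b < s" "s < a" "energy (h(i := a)) - energy (h(i := b)) = (a - b) * gradient i (h(i := s))"
    using MVT2[OF greater energy_upd_DERIV[OF i less_le_trans[OF assms(3)]]] by blast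
  then show ?thesis by (intro that[of s]) (auto simp: algebra_simps)
qed (use that[of a] in simp)

text \<open>Only partial derivatives are at hand, so h is changed to h' one coordinate at a time,
  with the mean value theorem at every change. This is why the intermediate point \<zeta> i depends
  on i.\<close>

lemma energy_diff:
  assumes "\<And>i. i < N \<Longrightarrow> h i > 0" "\<And>i. i < N \<Longrightarrow> h' i > 0"
  obtains \<zeta> where "\<And>i j. i < N \<Longrightarrow> j < N \<Longrightarrow> min (h j) (h' j) \<le> \<zeta> i j \<and> \<zeta> i j \<le> max (h j) (h' j)"
    "energy h' - energy h = (\<Sum>i<N. (h' i - h i) * gradient i (\<zeta> i))"
proof -
  \<comment> \<open>The first m coordinates are already those of h'.\<close>
  define mix where "mix m j = (if j < m then h' j else h j)" for m j :: nat
  have upd: "(mix i)(i := h' i) = mix (Suc i)" "(mix i)(i := h i) = mix i" for i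
    by (auto simp: mix_def fun_eq_iff less_Suc_eq)
  have "\<exists>s. min (h i) (h' i) \<le> s \<and> s \<le> max (h i) (h' i) \<and>
      energy (mix (Suc i)) - energy (mix i) = (h' i - h i) * gradient i ((mix i)(i := s))" if i: "i < N" for i
    using energy_diff_coordinate[OF i assms(1)[OF i] assms(2)[OF i], of "mix i"] unfolding upd by metis
  then obtain s where s: "\<And>i. i < N \<Longrightarrow> min (h i) (h' i) \<le> s i \<and> s i \<le> max (h i) (h' i) \<and>
      energy (mix (Suc i)) - energy (mix i) = (h' i - h i) * gradient i ((mix i)(i := s i))"
    by metis
  show ?thesis
  proof (rule that[of "\<lambda>i. (mix i)(i := s i)"])
    show "min (h j) (h' j) \<le> ((mix i)(i := s i)) j \<and> ((mix i)(i := s i)) j \<le> max (h j) (h' j)"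
      if "i < N" "j < N" for i j
      using s[of i] that by (auto simp: mix_def)
    have "energy h' - energy h = energy (mix N) - energy (mix 0)"
      using energy_cong[of h' "mix N"] energy_cong[of h "mix 0"] by (simp add: mix_def)
    also have "\<dots> = (\<Sum>i<N. energy (mix (Suc i)) - energy (mix i))"
      using sum_lessThan_telescope[of "\<lambda>i. energy (mix i)" N] by simp
    also have "\<dots> = (\<Sum>i<N. (h' i - h i) * gradient i ((mix i)(i := s i)))"
      using s by (intro sum.cong) auto
    finally show "energy h' - energy h = (\<Sum>i<N. (h' i - h i) * gradient i ((mix i)(i := s i)))" .
  qed
qed

end

section \<open>The energy\<close>

lemma coordinate_tendsto:
  fixes H :: "nat \<Rightarrow> nat \<Rightarrow> real"
  shows "H \<longlonglongrightarrow> h \<Longrightarrow> (\<lambda>n. H n i) \<longlonglongrightarrow> h i"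
  by (rule continuous_on_tendsto_compose[OF continuous_on_product_coordinates]) auto

text \<open>The metric on functions weights the coordinates by powers of 1 / 2, whose sum is
  2.\<close>

lemma dist_nat_fun_le:
  fixes h h' :: "nat \<Rightarrow> real"
  assumes "\<And>i. \<bar>h i - h' i\<bar> \<le> \<rho>"
  shows "dist h h' \<le> 2 * \<rho>"
proof -
  have "\<rho> \<ge> 0" using assms[of 0] by (meson abs_ge_zero order_trans)
  have s: "summable (\<lambda>n. (1 / 2) ^ n * \<rho>)"
    by (intro summable_mult2) (simp add: summable_geometric_iff)
  have le: "(1 / 2) ^ n * min (dist (h (from_nat n)) (h' (from_nat n))) 1 \<le> (1 / 2) ^ n * \<rho>" for n
    using assms[of "from_nat n"] by (intro mult_left_mono) (auto simp: dist_real_def min_le_iff_disj)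
  have "dist h h' = (\<Sum>n. (1 / 2) ^ n * min (dist (h (from_nat n)) (h' (from_nat n))) 1)"
    by (simp add: dist_fun_def)
  also have "\<dots> \<le> (\<Sum>n. (1 / 2) ^ n * \<rho>)"
    using le by (intro suminf_le s summable_comparison_test'[OF s, of 0]) auto
  also have "\<dots> = (\<Sum>n. (1 / 2) ^ n) * \<rho>"
    by (subst suminf_mult2) (simp_all add: summable_geometric_iff)
  also have "\<dots> = 2 * \<rho>"
    by (simp add: suminf_geometric)
  finally show ?thesis .
qed

section \<open>Compactness, coercivity and deformation\<close>

context weighted_slabs
begin

text \<open>Setting the coordinates from N on to 0 makes the box compact in the product topology and
  the parameters of a body unique.\<close>

definition par_box :: "real \<Rightarrow> real \<Rightarrow> (nat \<Rightarrow> real) set" where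
  "par_box l L = {h. (\<forall>i<N. l \<le> h i \<and> h i \<le> L) \<and> (\<forall>i\<ge>N. h i = 0)}"

definition positive_par :: "(nat \<Rightarrow> real) set" where
  "positive_par = {h. (\<forall>i<N. 0 < h i) \<and> (\<forall>i\<ge>N. h i = 0)}"

lemma compact_par_box: "compact (par_box l L)"
proof -
  have "par_box l L = Pi\<^sub>E UNIV (\<lambda>i. if i < N then {l..L} else {0})"
    by (auto simp: par_box_def PiE_def Pi_def not_less split: if_splits)
  moreover have "compactin (product_topology (\<lambda>i. euclidean) UNIV) (Pi\<^sub>E UNIV (\<lambda>i. if i < N then {l..L} else {0::real}))"
    by (subst compactin_PiE) auto
  ultimately show ?thesis
    by (simp add: euclidean_product_topology)
qed

lemma par_box_positive: "l > 0 \<Longrightarrow> par_box l L \<subseteq> positive_par"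
  by (force simp: par_box_def positive_par_def)

lemma continuous_on_gradient:
  assumes i: "i < N"
  shows "continuous_on positive_par (gradient i)"
  unfolding continuous_on_sequentially comp_def
proof (intro allI ballI impI, elim conjE)
  fix H h assume h: "h \<in> positive_par" and H: "\<forall>n. H n \<in> positive_par" and lim: "H \<longlonglongrightarrow> h"
  have "(\<lambda>n. face_area i (H n)) \<longlonglongrightarrow> face_area i h"
    using h H by (intro face_area_tendsto i coordinate_tendsto lim) (auto simp: positive_par_def i less_imp_le)
  moreover have "h i \<noteq> 0" using h i by (auto simp: positive_par_def)
  then have "(\<lambda>n. H n i powr (- q - 1)) \<longlonglongrightarrow> h i powr (- q - 1)"
    by (intro tendsto_powr tendsto_const coordinate_tendsto lim)
  ultimately show "(\<lambda>n. gradient i (H n)) \<longlonglongrightarrow> gradient i h"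
    unfolding gradient_def by (intro tendsto_diff tendsto_mult tendsto_const)
qed

lemma continuous_on_energy: "continuous_on positive_par energy"
  unfolding continuous_on_sequentially comp_def
proof (intro allI ballI impI, elim conjE)
  fix H h assume h: "h \<in> positive_par" and lim: "H \<longlonglongrightarrow> h"
  have "(\<lambda>n. vol (H n)) \<longlonglongrightarrow> vol h"
    by (intro vol_tendsto coordinate_tendsto lim)
  moreover have "(\<lambda>n. H n i powr (- q)) \<longlonglongrightarrow> h i powr (- q)" if "i < N" for i
    using h that by (intro tendsto_powr tendsto_const coordinate_tendsto lim) (auto simp: positive_par_def)
  ultimately show "(\<lambda>n. energy (H n)) \<longlonglongrightarrow> energy h"
    unfolding energy_def by (intro tendsto_add tendsto_mult tendsto_const tendsto_sum) auto
qed

lemma gradient_cong: "i < N \<Longrightarrow> (\<And>j. j < N \<Longrightarrow> h j = h' j) \<Longrightarrow> gradient i h = gradient i h'"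
  unfolding gradient_def by (subst face_area_cong[of i h h']) simp_all

lemma gradient_uniformly_continuous:
  assumes "l > 0" "\<eta> > 0"
  obtains \<rho> where "\<rho> > 0" "\<forall>i<N. \<forall>h\<in>par_box l L. \<forall>h'\<in>par_box l L.
    (\<forall>j<N. \<bar>h j - h' j\<bar> \<le> \<rho>) \<longrightarrow> \<bar>gradient i h - gradient i h'\<bar> < \<eta>"
proof -
  have "\<exists>d>0. \<forall>h\<in>par_box l L. \<forall>h'\<in>par_box l L. dist h' h < d \<longrightarrow> dist (gradient i h') (gradient i h) < \<eta>"
    if i: "i < N" for i
  proof -
    have "uniformly_continuous_on (par_box l L) (gradient i)"
      by (intro compact_uniformly_continuous compact_par_box continuous_on_subset[OF continuous_on_gradient[OF i]]
          par_box_positive assms)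
    then show ?thesis using assms(2) unfolding uniformly_continuous_on_def by blast
  qed
  then obtain d where d: "\<And>i. i < N \<Longrightarrow> d i > 0"
    "\<And>i h h'. i < N \<Longrightarrow> h \<in> par_box l L \<Longrightarrow> h' \<in> par_box l L \<Longrightarrow> dist h' h < d i \<Longrightarrow> dist (gradient i h') (gradient i h) < \<eta>"
    by metis
  \<comment> \<open>The divisor 4 leaves 2 * \<rho>, the bound on the distance of two functions,
    strictly below every d i; the entry 1 keeps the minimum nonvacuous.\<close>
  define \<rho> where "\<rho> = Min (insert 1 (d ` {..<N})) / 4"
  have \<rho>: "\<rho> > 0" unfolding \<rho>_def using d(1) by (auto simp: Min_gr_iff)
  have \<rho>d: "2 * \<rho> < d i" if "i < N" for i
  proof -
    have "Min (insert 1 (d ` {..<N})) \<le> d i" using that by (intro Min_le) auto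
    moreover have "2 * \<rho> < Min (insert 1 (d ` {..<N}))" using \<rho> unfolding \<rho>_def by linarith
    ultimately show ?thesis by linarith
  qed
  show ?thesis
  proof (rule that[OF \<rho>], intro allI impI ballI)
    fix i h h' assume i: "i < N" and h: "h \<in> par_box l L" "h' \<in> par_box l L" and le: "\<forall>j<N. \<bar>h j - h' j\<bar> \<le> \<rho>"
    have "\<bar>h' j - h j\<bar> \<le> \<rho>" for j
      using le h \<rho> by (cases "j < N") (auto simp: par_box_def abs_minus_commute)
    then have "dist h' h \<le> 2 * \<rho>" by (rule dist_nat_fun_le)
    then have "dist (gradient i h') (gradient i h) < \<eta>"
      using d(2)[OF i h] \<rho>d[OF i] by simp
    then show "\<bar>gradient i h - gradient i h'\<bar> < \<eta>" by (simp add: dist_real_def abs_minus_commute)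
  qed
qed

lemma energy_le_imp_ge:
  assumes "C > 0"
  obtains l where "l > 0" "\<forall>h. (\<forall>i<N. 0 < h i) \<longrightarrow> energy h \<le> C \<longrightarrow> (\<forall>i<N. l \<le> h i)"
proof -
  \<comment> \<open>The value of h i at which the single term 2 / q * c i * h i powr (- q) equals C;
    a smaller h i would exceed the energy bound.\<close>
  define m where "m i = (2 * c i / (q * C)) powr (1 / q)" for i
  have m: "m i > 0" if "i < N" for i
    using c_pos[OF that] q_pos assms by (simp add: m_def)
  define l where "l = Min (insert 1 (m ` {..<N}))"
  have l: "l > 0" using m by (auto simp: l_def)
  show ?thesis
  proof (rule that[OF l], intro allI impI)
    fix h i assume h: "\<forall>i<N. 0 < h i" and E: "energy h \<le> C" and i: "i < N"
    have "2 / q * (c i * h i powr (- q)) \<le> C"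
      using energy_ge_term[OF i, of h] E by simp
    moreover have pw: "q * h i powr q > 0" using h i q_pos by auto
    ultimately have "2 * c i / (q * h i powr q) \<le> C"
      by (simp add: powr_minus_divide)
    then have "2 * c i \<le> h i powr q * (q * C)"
      unfolding pos_divide_le_eq[OF pw] by (simp add: mult_ac)
    then have "2 * c i / (q * C) \<le> h i powr q"
      using q_pos assms by (simp add: pos_divide_le_eq)
    then have "m i \<le> (h i powr q) powr (1 / q)"
      unfolding m_def using c_pos[OF i] q_pos assms by (intro powr_mono2) auto
    also have "\<dots> = h i" using h i q_pos by (simp add: powr_powr less_imp_le)
    finally have "m i \<le> h i" .
    moreover have "l \<le> m i" unfolding l_def using i by (intro Min_le) auto
    ultimately show "l \<le> h i" by simp
  qed
qed

lemma convex_body: "convex (body h)"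
proof -
  have "body h = (\<Inter>i\<in>{..<N}. {x. u i \<bullet> x \<le> h i} \<inter> {x. u i \<bullet> x \<ge> - h i})"
    by (force simp: body_def abs_le_iff inner_commute)
  then show ?thesis
    by (auto intro!: convex_INT convex_Int convex_halfspace_le convex_halfspace_ge)
qed

text \<open>A long convex body containing a ball contains many disjoint balls of half the radius.\<close>

lemma vol_le_imp_norm_le:
  assumes "l > 0"
  obtains L where "\<forall>h. (\<forall>i<N. l \<le> h i) \<longrightarrow> vol h \<le> C \<longrightarrow> body h \<subseteq> cball 0 L"
proof -
  define v where "v = measure lborel (ball (0 :: real ^ 'n) (l / 2))"
  have v: "v > 0" using content_ball_pos[of "l / 2" "0 :: real ^ 'n"] assms by (simp add: v_def)
  obtain m :: nat where m: "C / v < real m" using reals_Archimedean2 by blast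
  \<comment> \<open>If norm x > L, the ray to x contains the m points 2 * k * l * e with k < m
    inside the body. The half-size balls sit at half their distance from 0, and m of them exceed the
    volume C.\<close>
  define L where "L = 2 * l * real m"
  show ?thesis
  proof (rule that[of L], intro allI impI subsetI)
    fix h x assume h: "\<forall>i<N. l \<le> h i" and C: "vol h \<le> C" and x: "x \<in> body h"
    show "x \<in> cball 0 L"
    proof (rule ccontr)
      assume "x \<notin> cball 0 L"
      then have nx: "norm x > L" by simp
      then have x0: "norm x > 0" using assms by (intro le_less_trans[OF _ nx]) (simp add: L_def)
      define e where "e = x /\<^sub>R norm x"
      have ne: "norm e = 1" using x0 by (simp add: e_def)
      define B where "B k = ball ((real k * l) *\<^sub>R e) (l / 2)" for k :: nat
      have "B k \<subseteq> body h" if k: "k < m" for k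
      proof
        fix y assume y: "y \<in> B k"
        define w where "w = y - (real k * l) *\<^sub>R e"
        have "norm w < l / 2" using y by (simp add: B_def w_def dist_norm norm_minus_commute)
        have "2 *\<^sub>R w \<in> body h"
        proof -
          have "\<bar>(2 *\<^sub>R w) \<bullet> u i\<bar> \<le> h i" if i: "i < N" for i
          proof -
            have "\<bar>(2 *\<^sub>R w) \<bullet> u i\<bar> \<le> norm (2 *\<^sub>R w) * norm (u i)" by (rule Cauchy_Schwarz_ineq2)
            also have "\<dots> \<le> l" using \<open>norm w < l / 2\<close> norm_u[OF i] by simp
            finally show ?thesis using h i by (meson order_trans)
          qed
          then show ?thesis by (simp add: body_def)
        qed
        moreover have "(2 * real k * l) *\<^sub>R e \<in> body h"
        proof -
          define s where "s = 2 * real k * l / norm x"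
          have "2 * real k * l \<le> L" using k assms by (simp add: L_def)
          then have s: "0 \<le> s" "s \<le> 1" using x0 nx assms by (auto simp: s_def)
          have "\<bar>(s *\<^sub>R x) \<bullet> u i\<bar> \<le> h i" if "i < N" for i
          proof -
            have "\<bar>(s *\<^sub>R x) \<bullet> u i\<bar> = s * \<bar>x \<bullet> u i\<bar>" using s by (simp add: abs_mult)
            also have "\<dots> \<le> 1 * \<bar>x \<bullet> u i\<bar>" using s by (intro mult_right_mono) auto
            finally show ?thesis using x that by (auto simp: body_def)
          qed
          then have "s *\<^sub>R x \<in> body h" by (simp add: body_def)
          moreover have "s *\<^sub>R x = (2 * real k * l) *\<^sub>R e" using x0 by (simp add: s_def e_def divide_inverse)
          ultimately show ?thesis by simp
        qed
        \<comment> \<open>y is the midpoint of 2 w, which lies in the ball of radius l, and a point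
          on the segment from 0 to x.\<close>
        ultimately have "(1 / 2) *\<^sub>R (2 *\<^sub>R w) + (1 / 2) *\<^sub>R ((2 * real k * l) *\<^sub>R e) \<in> body h"
          by (intro convexD[OF convex_body]) auto
        then show "y \<in> body h" by (simp add: w_def)
      qed
      moreover have "disjoint_family_on B {..<m}"
        unfolding disjoint_family_on_def
      proof (intro ballI impI)
        fix j k :: nat assume "j \<noteq> k"
        have "1 \<le> \<bar>real j - real k\<bar>" using \<open>j \<noteq> k\<close> by linarith
        then have "1 * l \<le> \<bar>real j - real k\<bar> * l" using assms by (intro mult_right_mono) auto
        also have "\<dots> = norm ((real j * l) *\<^sub>R e - (real k * l) *\<^sub>R e)"
          using ne assms by (simp add: scaleR_left_diff_distrib[symmetric] left_diff_distrib[symmetric] abs_mult)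
        finally have d: "l \<le> dist ((real j * l) *\<^sub>R e) ((real k * l) *\<^sub>R e)" by (simp add: dist_norm)
        show "B j \<inter> B k = {}"
        proof (rule ccontr)
          assume "B j \<inter> B k \<noteq> {}"
          then obtain z where "dist ((real j * l) *\<^sub>R e) z < l / 2" "dist ((real k * l) *\<^sub>R e) z < l / 2"
            by (auto simp: B_def)
          then show False using d dist_triangle2[of "(real j * l) *\<^sub>R e" "(real k * l) *\<^sub>R e" z] by linarith
        qed
      qed
      moreover have "emeasure lborel (B k) = ennreal v" for k
      proof -
        have "emeasure lborel (B k) = emeasure lborel (ball (0 :: real ^ 'n) (l / 2))"
          unfolding B_def using assms by (simp add: emeasure_ball)
        then show ?thesis
          unfolding v_def using emeasure_lborel_ball_finite[of "0 :: real ^ 'n" "l / 2"]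
          by (simp add: emeasure_eq_ennreal_measure)
      qed
      moreover have "B k \<in> sets lborel" for k by (simp add: B_def)
      ultimately have "(\<Sum>k<m. ennreal v) = emeasure lborel (\<Union>k<m. B k)" "(\<Union>k<m. B k) \<subseteq> body h"
        using sum_emeasure[of B "{..<m}" lborel] by (simp_all add: image_subset_iff UN_subset_iff)
      then have "(\<Sum>k<m. ennreal v) \<le> emeasure lborel (body h)"
        using sets_body by (metis emeasure_mono sets_lborel)
      then have "ennreal (real m * v) \<le> ennreal (vol h)"
        using v by (simp add: emeasure_body ennreal_mult ennreal_of_nat_eq_real_of_nat)
      then have "real m * v \<le> vol h" by (simp add: ennreal_le_iff vol_def)
      then show False using m C v by (simp add: divide_less_eq)
    qed
  qed
qed

text \<open>A substitute for compact sublevel sets, since wide slabs may escape to infinity at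
  bounded energy. A slab with h i > L does not touch the body, so its face area is 0 and only the
  decreasing singular term contributes to the derivative.\<close>

lemma coercivity:
  assumes "C > 0"
  obtains l L where "l > 0" "\<forall>h. (\<forall>i<N. 0 < h i) \<longrightarrow> energy h \<le> C \<longrightarrow>
    (\<forall>i<N. l \<le> h i \<and> (L < h i \<longrightarrow> gradient i h < 0))"
proof -
  obtain l where l: "l > 0" "\<forall>h. (\<forall>i<N. 0 < h i) \<longrightarrow> energy h \<le> C \<longrightarrow> (\<forall>i<N. l \<le> h i)"
    using energy_le_imp_ge[OF assms] .
  obtain L where L: "\<forall>h. (\<forall>i<N. l \<le> h i) \<longrightarrow> vol h \<le> C \<longrightarrow> body h \<subseteq> cball 0 L"
    using vol_le_imp_norm_le[OF l(1)] .
  show ?thesis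
  proof (rule that[OF l(1)], intro allI impI conjI)
    fix h i assume h: "\<forall>i<N. 0 < h i" and E: "energy h \<le> C" and i: "i < N"
    show "l \<le> h i" using l(2) h E i by blast
    assume hi: "L < h i"
    have "vol h \<le> C" using vol_le_energy E by (rule order_trans)
    then have b: "body h \<subseteq> cball 0 L" using L l(2) h E by blast
    have "y \<notin> body h" if "y \<bullet> u i = h i" for y
    proof
      assume "y \<in> body h"
      then have "norm y \<le> L" using b by auto
      moreover have "y \<bullet> u i \<le> norm y" using norm_cauchy_schwarz[of y "u i"] norm_u[OF i] by simp
      ultimately show False using that hi by simp
    qed
    moreover have "(x + (h i - x \<bullet> u i) *\<^sub>R u i) \<bullet> u i = h i" for x
      using u_self[OF i] by (simp add: algebra_simps)
    ultimately have "prism (u i) (h i) (body h) = {}" by (auto simp: prism_def)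
    then have "face_area i h = 0" by (simp add: face_area_def)
    moreover have "c i * h i powr (- q - 1) > 0" using h i c_pos[OF i] by auto
    ultimately show "gradient i h < 0" by (simp add: gradient_def)
  qed
qed

lemma gradient_bounded:
  assumes "l > 0"
  obtains M where "M > 0" "\<forall>i<N. \<forall>h\<in>par_box l L. \<bar>gradient i h\<bar> \<le> M"
proof -
  have "\<exists>b. \<forall>h\<in>par_box l L. \<bar>gradient i h\<bar> \<le> b" if i: "i < N" for i
  proof -
    have "compact (gradient i ` par_box l L)"
      by (intro compact_continuous_image compact_par_box continuous_on_subset[OF continuous_on_gradient[OF i]]
          par_box_positive assms)
    then show ?thesis using compact_imp_bounded bounded_iff by (metis imageI real_norm_def)
  qed
  then obtain b where b: "\<And>i h. i < N \<Longrightarrow> h \<in> par_box l L \<Longrightarrow> \<bar>gradient i h\<bar> \<le> b i"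
    by metis
  have "\<bar>gradient i h\<bar> \<le> 1 + (\<Sum>i<N. \<bar>b i\<bar>)" if "i < N" "h \<in> par_box l L" for i h
    using b[OF that] member_le_sum[of i "{..<N}" "\<lambda>i. \<bar>b i\<bar>"] that(1) by auto
  then show ?thesis
    by (intro that[of "1 + (\<Sum>i<N. \<bar>b i\<bar>)"]) (auto intro!: add_pos_nonneg sum_nonneg)
qed

text \<open>Absence of critical points becomes a uniform bound through the minimum of the squared
  gradient on a compact box.\<close>

lemma gradient_bounded_below:
  assumes "l > 0" and noncrit: "\<And>h. h \<in> positive_par \<Longrightarrow> \<exists>i<N. gradient i h \<noteq> 0"
  obtains \<delta> where "\<delta> > 0" "\<forall>h\<in>par_box l L. \<delta> \<le> (\<Sum>i<N. (gradient i h)\<^sup>2)"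
proof (cases "par_box l L = {}")
  case False
  have "continuous_on (par_box l L) (\<lambda>h. \<Sum>i<N. (gradient i h)\<^sup>2)"
    by (intro continuous_intros continuous_on_subset[OF continuous_on_gradient] par_box_positive assms) auto
  then obtain h0 where h0: "h0 \<in> par_box l L"
    "\<forall>h\<in>par_box l L. (\<Sum>i<N. (gradient i h0)\<^sup>2) \<le> (\<Sum>i<N. (gradient i h)\<^sup>2)"
    using continuous_attains_inf[OF compact_par_box False] by blast
  obtain i where i: "i < N" "gradient i h0 \<noteq> 0"
    using noncrit h0(1) par_box_positive[OF assms(1)] by blast
  have "0 < (gradient i h0)\<^sup>2" using i by simp
  also have "\<dots> \<le> (\<Sum>i<N. (gradient i h0)\<^sup>2)"
    using i by (intro member_le_sum) auto
  finally show ?thesis using that h0(2) by blast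
qed (use that[of 1] in simp)

text \<open>One step of a discretized ascending gradient flow, switched off where the energy is at least \<open>C + 1\<close>.\<close>

lemma deformation:
  assumes noncrit: "\<And>h. h \<in> positive_par \<Longrightarrow> \<exists>i<N. gradient i h \<noteq> 0" and "C \<ge> 0"
  obtains L0 where "\<forall>L\<ge>L0. \<exists>\<epsilon>>0. \<exists>\<Phi>. continuous_on positive_par \<Phi> \<and>
    (\<forall>h\<in>positive_par. (\<forall>i<N. h i \<le> L) \<longrightarrow>
      \<Phi> h \<in> positive_par \<and> (\<forall>i<N. \<Phi> h i \<le> L) \<and> energy (\<Phi> h) \<ge> min (energy h + \<epsilon>) (C + 1 / 2) \<and>
      (energy h \<ge> C + 1 \<longrightarrow> \<Phi> h = h))"
proof -
  obtain l L1 where l: "l > 0" and co: "\<forall>h. (\<forall>i<N. 0 < h i) \<longrightarrow> energy h \<le> C + 1 \<longrightarrow>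
    (\<forall>i<N. l \<le> h i \<and> (L1 < h i \<longrightarrow> gradient i h < 0))"
    using coercivity[of "C + 1"] \<open>C \<ge> 0\<close> by (metis add_nonneg_pos zero_less_one)
  show ?thesis
  proof (rule that[of "L1 + 1"], intro allI impI)
    fix L assume L: "L \<ge> L1 + 1"
    \<comment> \<open>The start of a step is bounded below by l, its end only by l / 2, so all
      estimates are made on the larger box.\<close>
    have l2: "l / 2 > 0" using l by simp
    obtain M where M: "M > 0" "\<forall>i<N. \<forall>h\<in>par_box (l / 2) L. \<bar>gradient i h\<bar> \<le> M"
      using gradient_bounded[OF l2] .
    obtain \<delta> where \<delta>: "\<delta> > 0" "\<forall>h\<in>par_box (l / 2) L. \<delta> \<le> (\<Sum>i<N. (gradient i h)\<^sup>2)"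
      using gradient_bounded_below[OF l2 noncrit] by metis
    \<comment> \<open>Replacing one factor of the squared partial derivative by its value at a
      nearby point costs at most M * \<eta> in each of the N coordinates, in total at most \<delta>
      / 2.\<close>
    define \<eta> where "\<eta> = \<delta> / (2 * (real N + 1) * M)"
    have \<eta>: "\<eta> > 0" using \<delta> M by (simp add: \<eta>_def)
    have \<eta>N: "real N * (M * \<eta>) \<le> \<delta> / 2"
    proof -
      have "real N + 1 \<noteq> 0" by linarith
      then have "(real N + 1) * (\<delta> / 2 / (real N + 1)) = \<delta> / 2" 
        by (metis nonzero_eq_divide_eq mult.commute)
      moreover have "M * \<eta> = \<delta> / 2 / (real N + 1)" using M by (simp add: \<eta>_def)
      ultimately have "(real N + 1) * (M * \<eta>) = \<delta> / 2" by (simp only:)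
      moreover have "real N * (M * \<eta>) \<le> (real N + 1) * (M * \<eta>)" using M \<eta> by (intro mult_right_mono) auto
      ultimately show ?thesis by linarith
    qed
    obtain \<rho> where \<rho>: "\<rho> > 0" "\<forall>i<N. \<forall>h\<in>par_box (l / 2) L. \<forall>h'\<in>par_box (l / 2) L.
      (\<forall>j<N. \<bar>h j - h' j\<bar> \<le> \<rho>) \<longrightarrow> \<bar>gradient i h - gradient i h'\<bar> < \<eta>"
      using gradient_uniformly_continuous[OF l2 \<eta>] .
    \<comment> \<open>The three bounds keep a step, of length at most t * M in each coordinate,
      within the modulus \<rho>, above l / 2, and within the margin 1 between L1 and L.\<close>
    define t where "t = min (min \<rho> (l / 2)) 1 / M"
    have t: "t > 0" "t * M \<le> \<rho>" "t * M \<le> l / 2" "t * M \<le> 1"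
      using M \<rho> l by (auto simp: t_def)
    \<comment> \<open>Equal to 1 up to energy C, still at least 1 / 2 up to C + 1 / 2, and 0 from C
      + 1 on.\<close>
    define cut where "cut h = max 0 (min 1 (C + 1 - energy h))" for h
    have cut: "0 \<le> cut h" "cut h \<le> 1" for h by (auto simp: cut_def)
    define \<Phi> where "\<Phi> h i = (if i < N then h i + t * cut h * gradient i h else 0)" for h i
    have "continuous_on positive_par \<Phi>"
    proof (rule continuous_on_coordinatewise_then_product)
      fix i
      show "continuous_on positive_par (\<lambda>h. \<Phi> h i)"
      proof (cases "i < N")
        case True
        then have "continuous_on positive_par (\<lambda>h. h i + t * cut h * gradient i h)"
          unfolding cut_def
          by (intro continuous_intros continuous_on_gradient continuous_on_energy
              continuous_on_product_then_coordinatewise continuous_on_id)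
        then show ?thesis using True by (simp add: \<Phi>_def)
      qed (simp add: \<Phi>_def)
    qed
    \<comment> \<open>The gain t * \<delta> / 4 is the product of the step size t, the cutoff 1 / 2
      and the remaining half of \<delta>.\<close>
    moreover have "\<Phi> h \<in> positive_par \<and> (\<forall>i<N. \<Phi> h i \<le> L) \<and> energy (\<Phi> h) \<ge> min (energy h + t * \<delta> / 4) (C + 1 / 2) \<and>
      (energy h \<ge> C + 1 \<longrightarrow> \<Phi> h = h)" if h: "h \<in> positive_par" and hL: "\<forall>i<N. h i \<le> L" for h
    proof (cases "energy h \<ge> C + 1")
      case True
      then have "\<Phi> h = h" using h by (auto simp: \<Phi>_def cut_def positive_par_def fun_eq_iff)
      then show ?thesis using h hL True by auto
    next
      case False
      have hl: "l \<le> h i" "L1 < h i \<Longrightarrow> gradient i h < 0" if "i < N" for i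
        using co h False that by (auto simp: positive_par_def)
      have hbox: "h \<in> par_box (l / 2) L"
        using h hL hl(1) l by (force simp: par_box_def positive_par_def)
      have step: "\<bar>t * cut h * gradient i h\<bar> \<le> t * M" if i: "i < N" for i
      proof -
        have "\<bar>t * cut h * gradient i h\<bar> = t * (cut h * \<bar>gradient i h\<bar>)"
          using t(1) cut[of h] by (simp add: abs_mult)
        also have "\<dots> \<le> t * (1 * M)"
          using t(1) cut[of h] M(2) hbox i by (intro mult_left_mono mult_mono) auto
        finally show ?thesis by simp
      qed
      have \<Phi>: "l / 2 \<le> \<Phi> h i" "\<Phi> h i \<le> L" if i: "i < N" for i
      proof -
        show "l / 2 \<le> \<Phi> h i" using step[OF i] hl(1)[OF i] t(3) i by (simp add: \<Phi>_def abs_le_iff)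
        \<comment> \<open>Beyond L1 the partial derivative is negative, so the step does not
          increase h i; below L1 a step of length at most 1 cannot pass L.\<close>
        show "\<Phi> h i \<le> L"
        proof (cases "L1 < h i")
          case True
          then have "t * cut h * gradient i h \<le> 0"
            using hl(2)[OF i] t(1) cut(1)[of h] by (intro mult_nonneg_nonpos) auto
          then show ?thesis using hL i by (auto simp: \<Phi>_def intro: order_trans[rotated])
        next
          case False
          then show ?thesis using step[OF i] t(4) L i by (simp add: \<Phi>_def abs_le_iff)
        qed
      qed
      have \<Phi>box: "\<Phi> h \<in> par_box (l / 2) L" using \<Phi> by (auto simp: par_box_def \<Phi>_def)
      have hpos: "\<And>i. i < N \<Longrightarrow> h i > 0" "\<And>i. i < N \<Longrightarrow> \<Phi> h i > 0"
        using hl(1) \<Phi>(1) l by (auto intro: less_le_trans[of _ "l / 2"] less_le_trans[of _ l])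
      obtain \<zeta> where \<zeta>: "\<And>i j. i < N \<Longrightarrow> j < N \<Longrightarrow> min (h j) (\<Phi> h j) \<le> \<zeta> i j \<and> \<zeta> i j \<le> max (h j) (\<Phi> h j)"
        and diff: "energy (\<Phi> h) - energy h = (\<Sum>i<N. (\<Phi> h i - h i) * gradient i (\<zeta> i))"
        using energy_diff[of h "\<Phi> h", OF hpos] by blast
      have close: "\<bar>gradient i h - gradient i (\<zeta> i)\<bar> < \<eta>" if i: "i < N" for i
      proof -
        define z where "z j = (if j < N then \<zeta> i j else 0)" for j
        have "z \<in> par_box (l / 2) L"
          using \<zeta>[OF i] hbox \<Phi>box by (fastforce simp: par_box_def z_def min_le_iff_disj le_max_iff_disj)
        moreover have "\<bar>h j - z j\<bar> \<le> \<rho>" if j: "j < N" for j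
        proof -
          have "\<bar>h j - z j\<bar> \<le> \<bar>\<Phi> h j - h j\<bar>" using \<zeta>[OF i j] j by (auto simp: z_def)
          also have "\<dots> \<le> \<rho>" using step[OF j] t(2) j by (simp add: \<Phi>_def)
          finally show ?thesis .
        qed
        ultimately have "\<bar>gradient i h - gradient i z\<bar> < \<eta>" using \<rho>(2) i hbox by blast
        moreover have "gradient i z = gradient i (\<zeta> i)" by (rule gradient_cong[OF i]) (simp add: z_def)
        ultimately show ?thesis by simp
      qed
      have "t * cut h * (\<delta> / 2) \<le> t * cut h * (\<Sum>i<N. gradient i h * gradient i (\<zeta> i))"
      proof (rule mult_left_mono)
        have "gradient i h * gradient i (\<zeta> i) \<ge> (gradient i h)\<^sup>2 - M * \<eta>" if i: "i < N" for i
        proof -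
          have "\<bar>gradient i h * (gradient i h - gradient i (\<zeta> i))\<bar> \<le> M * \<eta>"
            unfolding abs_mult using M close[OF i] hbox i by (intro mult_mono) (auto intro: less_imp_le)
          then show ?thesis by (simp add: abs_le_iff power2_eq_square algebra_simps)
        qed
        then have "(\<Sum>i<N. (gradient i h)\<^sup>2 - M * \<eta>) \<le> (\<Sum>i<N. gradient i h * gradient i (\<zeta> i))"
          by (intro sum_mono) auto
        then show "\<delta> / 2 \<le> (\<Sum>i<N. gradient i h * gradient i (\<zeta> i))"
          using \<delta>(2) hbox \<eta>N by (fastforce simp: sum_subtractf)
      qed (use t cut in simp)
      also have "\<dots> = energy (\<Phi> h) - energy h"
        unfolding diff by (simp add: \<Phi>_def sum_distrib_left mult_ac)
      finally have inc: "energy h + t * cut h * (\<delta> / 2) \<le> energy (\<Phi> h)" by simp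
      have "min (energy h + t * \<delta> / 4) (C + 1 / 2) \<le> energy (\<Phi> h)"
      proof (cases "energy h \<le> C + 1 / 2")
        case True
        then have "1 / 2 \<le> cut h" by (auto simp: cut_def)
        then have "(t * \<delta> / 2) * (1 / 2) \<le> (t * \<delta> / 2) * cut h"
          using t(1) \<delta>(1) by (intro mult_left_mono) auto
        then show ?thesis using inc by (simp add: mult_ac min_le_iff_disj)
      next
        case False
        have "0 \<le> t * cut h * (\<delta> / 2)" using t cut \<delta> by simp
        then show ?thesis using inc False by linarith
      qed
      moreover have "\<Phi> h \<in> positive_par" using \<Phi>box par_box_positive[OF l2] by blast
      ultimately show ?thesis using \<Phi>(2) False by blast
    qed
    ultimately show "\<exists>\<epsilon>>0. \<exists>\<Phi>. continuous_on positive_par \<Phi> \<and>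
      (\<forall>h\<in>positive_par. (\<forall>i<N. h i \<le> L) \<longrightarrow>
        \<Phi> h \<in> positive_par \<and> (\<forall>i<N. \<Phi> h i \<le> L) \<and> energy (\<Phi> h) \<ge> min (energy h + \<epsilon>) (C + 1 / 2) \<and>
        (energy h \<ge> C + 1 \<longrightarrow> \<Phi> h = h))"
      using t(1) \<delta>(1) by (intro exI[of _ "t * \<delta> / 4"] conjI exI[of _ \<Phi>]) auto
  qed
qed

end

section \<open>The linking argument\<close>

text \<open>Brouwer's theorem is applied to t - F t, clipped to the cube. If F t $ k > 0 at a fixed
  point, the clipping can restore t $ k only at the value - T, where the sign of F is the opposite
  one; the other sign is symmetric.\<close>

lemma poincare_miranda:
  fixes F :: "real ^ 'n \<Rightarrow> real ^ 'n"
  assumes "T > 0" and cont: "continuous_on (cbox (\<chi> k. - T) (\<chi> k. T)) F"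
    and hi: "\<And>t k. t \<in> cbox (\<chi> k. - T) (\<chi> k. T) \<Longrightarrow> t $ k = T \<Longrightarrow> F t $ k > 0"
    and lo: "\<And>t k. t \<in> cbox (\<chi> k. - T) (\<chi> k. T) \<Longrightarrow> t $ k = - T \<Longrightarrow> F t $ k < 0"
  obtains t where "t \<in> cbox (\<chi> k. - T) (\<chi> k. T)" "F t = 0"
proof -
  let ?B = "cbox (\<chi> k. - T) (\<chi> k. T) :: (real ^ 'n) set"
  define f where "f t = (\<chi> k. max (- T) (min T (t $ k - F t $ k)))" for t
  have "continuous_on ?B f"
    unfolding f_def by (intro continuous_intros continuous_on_vec_lambda cont)
  moreover have "f \<in> ?B \<rightarrow> ?B"
    using assms(1) by (auto simp: f_def mem_box_cart)
  moreover have "?B \<noteq> {}" using assms(1) by (auto simp: interval_ne_empty_cart)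
  ultimately obtain t where t: "t \<in> ?B" "f t = t"
    using brouwer[OF compact_cbox convex_box(1)] by blast
  have "F t $ k = 0" for k
  proof -
    have eq: "t $ k = max (- T) (min T (t $ k - F t $ k))" using t(2) by (metis f_def vec_lambda_beta)
    have "- T \<le> t $ k" "t $ k \<le> T" using t(1) by (auto simp: mem_box_cart)
    then show ?thesis using eq hi[OF t(1), of k] lo[OF t(1), of k] by (smt (verit))
  qed
  then show ?thesis using t(1) that by (simp add: vec_eq_iff)
qed

lemma continuous_on_Min_image:
  fixes g :: "'i \<Rightarrow> 'a::topological_space \<Rightarrow> real"
  assumes "finite I" "I \<noteq> {}" "\<And>i. i \<in> I \<Longrightarrow> continuous_on S (g i)"
  shows "continuous_on S (\<lambda>x. Min ((\<lambda>i. g i x) ` I))"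
  using assms
proof (induction I rule: finite_ne_induct)
  case (insert i I)
  then have "continuous_on S (\<lambda>x. min (g i x) (Min ((\<lambda>i. g i x) ` I)))"
    by (intro continuous_on_min) auto
  then show ?case using insert.hyps by simp
qed simp

text \<open>The normals u (b k) form a basis ordered by \<open>rank\<close>, with coordinates
  \<beta>; \<open>\<kappa> i\<close> is the last basis index that occurs in u i, that is, the step
  at which u i enters the flag.\<close>

locale slabs_basis = weighted_slabs u N c q for u :: "nat \<Rightarrow> real ^ 'n" and N c q +
  fixes b :: "'n \<Rightarrow> nat" and \<beta> :: "nat \<Rightarrow> 'n \<Rightarrow> real" and rank :: "'n \<Rightarrow> nat" and \<kappa> :: "nat \<Rightarrow> 'n"
  assumes b_less: "\<And>k. b k < N"
    and u_expand: "\<And>i. i < N \<Longrightarrow> u i = (\<Sum>k\<in>UNIV. \<beta> i k *\<^sub>R u (b k))"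
    and \<beta>_b: "\<And>k l. \<beta> (b k) l = (if l = k then 1 else 0)"
    and inj_rank: "inj rank"
    and \<beta>_\<kappa>: "\<And>i. i < N \<Longrightarrow> \<beta> i (\<kappa> i) \<noteq> 0"
    and \<kappa>_max: "\<And>i k. i < N \<Longrightarrow> \<beta> i k \<noteq> 0 \<Longrightarrow> rank k \<le> rank (\<kappa> i)"
begin

lemma \<kappa>_b: "\<kappa> (b k) = k"
  using \<beta>_\<kappa>[OF b_less[of k]] by (auto simp: \<beta>_b split: if_splits)

text \<open>The support numbers of the parallelotopes bounded by the slabs of the basis; these parallelotopes
  form an \<open>n\<close>-parameter family of bodies on which the energy is coercive.\<close>

definition ridge :: "real ^ 'n \<Rightarrow> nat \<Rightarrow> real" where
  "ridge t i = (if i < N then \<Sum>k\<in>UNIV. \<bar>\<beta> i k\<bar> * exp (t $ k) else 0)"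

text \<open>The classes \<open>{i. \<kappa> i = k}\<close> come from the flag spanned by the ordered basis: picking one normal
  from each class always gives a basis again. The set where \<open>level\<close> is constantly 1 links the ridge.\<close>

definition level :: "(nat \<Rightarrow> real) \<Rightarrow> real ^ 'n" where
  "level h = (\<chi> k. Min (h ` {i \<in> {..<N}. \<kappa> i = k}))"

lemma class_nonempty: "{i \<in> {..<N}. \<kappa> i = k} \<noteq> {}"
  using b_less[of k] \<kappa>_b[of k] by auto

lemma ridge_b: "ridge t (b k) = exp (t $ k)"
  using b_less[of k] by (simp add: ridge_def \<beta>_b if_distrib[of abs] if_distrib[of "\<lambda>x. x * _"] cong: if_cong)

lemma ridge_ge: "i < N \<Longrightarrow> \<bar>\<beta> i k\<bar> * exp (t $ k) \<le> ridge t i"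
  unfolding ridge_def by (auto intro!: member_le_sum)

lemma ridge_positive: "ridge t \<in> positive_par"
proof -
  have "0 < ridge t i" if i: "i < N" for i
  proof -
    have "0 < \<bar>\<beta> i (\<kappa> i)\<bar> * exp (t $ \<kappa> i)" using \<beta>_\<kappa>[OF i] by simp
    also have "\<dots> \<le> ridge t i" by (rule ridge_ge[OF i])
    finally show ?thesis .
  qed
  then show ?thesis by (simp add: positive_par_def ridge_def)
qed

lemma continuous_on_ridge: "continuous_on S ridge"
proof (rule continuous_on_coordinatewise_then_product)
  show "continuous_on S (\<lambda>t. ridge t i)" for i
    unfolding ridge_def by (cases "i < N") (auto intro!: continuous_intros)
qed

lemma continuous_on_level:
  assumes "continuous_on S \<gamma>"
  shows "continuous_on S (\<lambda>t. level (\<gamma> t))"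
  unfolding level_def
proof (rule continuous_on_vec_lambda)
  fix k
  show "continuous_on S (\<lambda>t. Min (\<gamma> t ` {i \<in> {..<N}. \<kappa> i = k}))"
    using continuous_on_Min_image[OF _ class_nonempty, of k S "\<lambda>i t. \<gamma> t i"]
      continuous_on_product_then_coordinatewise[OF assms] by simp
qed

lemma basis_span: "span (range (\<lambda>k. u (b k))) = UNIV"
proof -
  have "u ` {..<N} \<subseteq> span (range (\<lambda>k. u (b k)))"
    using u_expand by (auto intro!: span_sum span_scale intro: span_base)
  then have "span (u ` {..<N}) \<subseteq> span (range (\<lambda>k. u (b k)))"
    by (meson span_minimal subspace_span)
  then show ?thesis using spanning by auto
qed

text \<open>In the coordinates x \<bullet> u (b k) the parallelotope is a box with half-edges exp (t
  $ k). It lies in the body, because the other ridge values bound the scalar products on it.\<close>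

lemma vol_ridge:
  obtains a where "a > 0" "\<And>t. a * exp (\<Sum>k\<in>UNIV. t $ k) \<le> vol (ridge t)"
proof -
  define F where "F x = (\<chi> k. x \<bullet> u (b k))" for x :: "real ^ 'n"
  have linF: "linear F" by (rule linearI) (auto simp: F_def vec_eq_iff inner_add_left)
  have "inj F"
  proof (rule linear_injective_0[OF linF, THEN iffD2], intro allI impI)
    fix x assume "F x = 0"
    then have "\<And>v. v \<in> range (\<lambda>k. u (b k)) \<Longrightarrow> \<bar>x \<bullet> v\<bar> \<le> 0" by (auto simp: F_def vec_eq_iff)
    moreover obtain R where "R > 0" "\<And>x c. (\<And>v. v \<in> range (\<lambda>k. u (b k)) \<Longrightarrow> \<bar>x \<bullet> v\<bar> \<le> c) \<Longrightarrow> norm x \<le> R * c"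
      using norm_le_of_spanning[OF finite_imageI[OF finite] basis_span] by blast
    ultimately have "norm x \<le> R * 0" by blast
    then show "x = 0" by simp
  qed
  then have "surj F" using linF linear_injective_imp_surjective by blast
  then obtain G where G: "linear G" "\<And>y. F (G y) = y"
    using linear_surjective_right_inverse[OF linF] by (metis comp_apply id_apply)
  have "inj G" using G(2) by (metis injI)
  then obtain a where a: "a > 0" "\<And>S. compact S \<Longrightarrow> emeasure lborel (G ` S) = ennreal a * emeasure lborel S"
    using emeasure_linear_image_compact[OF G(1)] by blast
  show ?thesis
  proof (rule that[OF a(1)])
    fix t :: "real ^ 'n"
    let ?Q = "cbox (\<chi> k. - exp (t $ k)) (\<chi> k. exp (t $ k))"
    have "G ` ?Q \<subseteq> body (ridge t)"
    proof
      fix x assume "x \<in> G ` ?Q"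
      then have "F x \<in> ?Q" using G(2) by auto
      then have x: "\<bar>x \<bullet> u (b k)\<bar> \<le> exp (t $ k)" for k
        by (auto simp: F_def mem_box_cart abs_le_iff) (metis minus_le_iff)
      have "\<bar>x \<bullet> u i\<bar> \<le> ridge t i" if i: "i < N" for i
      proof -
        have "\<bar>x \<bullet> u i\<bar> = \<bar>\<Sum>k\<in>UNIV. \<beta> i k * (x \<bullet> u (b k))\<bar>"
          by (subst u_expand[OF i]) (simp add: inner_sum_right)
        also have "\<dots> \<le> (\<Sum>k\<in>UNIV. \<bar>\<beta> i k * (x \<bullet> u (b k))\<bar>)" by (rule sum_abs)
        also have "\<dots> \<le> ridge t i"
          using x i by (auto simp: ridge_def abs_mult intro!: sum_mono mult_left_mono)
        finally show ?thesis .
      qed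
      then show "x \<in> body (ridge t)" by (simp add: body_def)
    qed
    then have "emeasure lborel (G ` ?Q) \<le> ennreal (vol (ridge t))"
      unfolding emeasure_body[symmetric] using sets_body by (intro emeasure_mono) auto
    moreover have "emeasure lborel ?Q = ennreal (\<Prod>k\<in>UNIV. 2 * exp (t $ k))"
      by (subst emeasure_lborel_cart_between[of "\<chi> k. - exp (t $ k)" "\<chi> k. exp (t $ k)"])
        (auto simp: box_subset_cbox intro: order_trans[of _ 0])
    ultimately have "ennreal (a * (\<Prod>k\<in>UNIV. 2 * exp (t $ k))) \<le> ennreal (vol (ridge t))"
      using a by (simp add: ennreal_mult prod_nonneg)
    then have "a * (\<Prod>k\<in>UNIV. 2 * exp (t $ k)) \<le> vol (ridge t)"
      by (simp add: ennreal_le_iff vol_def)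
    moreover have "(\<Prod>k\<in>UNIV. exp (t $ k)) \<le> (\<Prod>k\<in>UNIV. 2 * exp (t $ k))"
      by (intro prod_mono) auto
    ultimately show "a * exp (\<Sum>k\<in>UNIV. t $ k) \<le> vol (ridge t)"
      using a(1) by (simp add: exp_sum) (meson mult_left_mono less_imp_le order_trans)
  qed
qed

lemma c_min: obtains m where "m > 0" "\<And>i. i < N \<Longrightarrow> m \<le> c i"
proof -
  have "finite (insert 1 (c ` {..<N}))" by simp
  then show ?thesis
    using c_pos by (intro that[of "Min (insert 1 (c ` {..<N}))"]) (auto intro: Min_le)
qed

text \<open>Either some coordinate is very negative, and the singular term of the corresponding
  basis normal is large; or all coordinates are bounded below while one equals T, so their sum and
  with it the volume are large.\<close>

lemma energy_ridge_boundary: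
  obtains T0 where "\<And>T t k. T \<ge> T0 \<Longrightarrow> t \<in> cbox (\<chi> k. - T) (\<chi> k. T) \<Longrightarrow> \<bar>t $ k\<bar> = T \<Longrightarrow> energy (ridge t) \<ge> E"
proof -
  obtain a where a: "a > 0" "\<And>t. a * exp (\<Sum>k\<in>UNIV. t $ k) \<le> vol (ridge t)"
    using vol_ridge by blast
  obtain m where m: "m > 0" "\<And>i. i < N \<Longrightarrow> m \<le> c i" using c_min by blast
  \<comment> \<open>Chosen so that a coordinate at most - T1 already gives a singular term of size
    E; m is the common lower bound of the weights.\<close>
  define T1 where "T1 = max 0 (ln (max 1 (E * q / (2 * m))) / q)"
  have T1: "E \<le> 2 / q * (m * exp (q * T1))"
  proof -
    have "ln (max 1 (E * q / (2 * m))) \<le> q * T1"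
      using q_pos by (auto simp: T1_def max_def field_simps)
    then have "max 1 (E * q / (2 * m)) \<le> exp (q * T1)"
      by (metis exp_le_cancel_iff exp_ln max.cobounded1 order_less_le_trans zero_less_one)
    then have "E * q / (2 * m) \<le> exp (q * T1)" by simp
    then show ?thesis using m q_pos by (simp add: field_simps)
  qed
  \<comment> \<open>One coordinate at least T2 outweighs all the others being as low as - T1 and
    still gives volume E.\<close>
  define T2 where "T2 = max T1 (ln (max 1 (E / a)) + real CARD('n) * T1)"
  have T2: "E \<le> a * exp (T2 - real CARD('n) * T1)"
  proof -
    have "ln (max 1 (E / a)) \<le> T2 - real CARD('n) * T1" by (simp add: T2_def)
    then have "max 1 (E / a) \<le> exp (T2 - real CARD('n) * T1)"
      by (metis exp_le_cancel_iff exp_ln max.cobounded1 order_less_le_trans zero_less_one)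
    then have "E / a \<le> exp (T2 - real CARD('n) * T1)" by simp
    then show ?thesis using a by (simp add: field_simps)
  qed
  show ?thesis
  proof (rule that[of T2])
    fix T :: real and t :: "real ^ 'n" and k assume T: "T \<ge> T2" and t: "t \<in> cbox (\<chi> k. - T) (\<chi> k. T)" and k: "\<bar>t $ k\<bar> = T"
    show "energy (ridge t) \<ge> E"
    proof (cases "\<exists>l. t $ l \<le> - T1")
      case True
      then obtain l where l: "t $ l \<le> - T1" by blast
      have "q * T1 \<le> - q * t $ l" using q_pos mult_left_mono[of "T1" "- t $ l" q] l by simp
      then have "2 / q * (m * exp (q * T1)) \<le> 2 / q * (c (b l) * exp (- q * t $ l))"
        using q_pos m b_less by (intro mult_left_mono mult_mono) (auto intro: order_trans less_imp_le)
      also have "\<dots> = 2 / q * (c (b l) * ridge t (b l) powr (- q))"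
        by (simp add: ridge_b powr_def)
      also have "\<dots> \<le> energy (ridge t)"
        by (rule energy_ge_term[OF b_less])
      finally show ?thesis using T1 by simp
    next
      case False
      have "t $ k \<noteq> - T"
      proof
        assume "t $ k = - T"
        then have "t $ k \<le> - T1" using T by (simp add: T2_def)
        then show False using False by blast
      qed
      then have tk: "t $ k = T" using k by auto
      have T10: "T1 \<ge> 0" by (simp add: T1_def)
      have "T - real CARD('n) * T1 \<le> T - (\<Sum>l\<in>UNIV - {k}. T1)"
        using T10 by (simp add: card_Diff_singleton mult_right_mono)
      also have "\<dots> \<le> t $ k + (\<Sum>l\<in>UNIV - {k}. t $ l)"
        using False tk sum_mono[of "UNIV - {k}" "\<lambda>_. - T1" "\<lambda>l. t $ l"] by (simp add: sum_negf not_le less_imp_le)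
      also have "\<dots> = (\<Sum>l\<in>UNIV. t $ l)" by (simp add: sum.remove[of UNIV k])
      finally have "T2 - real CARD('n) * T1 \<le> (\<Sum>l\<in>UNIV. t $ l)" using T by simp
      then have "a * exp (T2 - real CARD('n) * T1) \<le> a * exp (\<Sum>l\<in>UNIV. t $ l)"
        using a(1) by simp
      also have "\<dots> \<le> vol (ridge t)" by (rule a(2))
      also have "\<dots> \<le> energy (ridge t)" by (rule vol_le_energy)
      finally show ?thesis using T2 by simp
    qed
  qed
qed

text \<open>The representatives are triangular with respect to the ordered basis: u i is a nonzero
  multiple of u (b k) plus basis vectors of lower rank, which are spanned already by
  induction.\<close>

lemma spanning_of_level:
  assumes "\<And>k. \<exists>i\<in>I. i < N \<and> \<kappa> i = k"
  shows "span (u ` I) = UNIV"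
proof -
  have "u (b k) \<in> span (u ` I)" for k
  proof (induction k rule: measure_induct_rule[where f = rank])
    case (less k)
    obtain i where i: "i \<in> I" "i < N" "\<kappa> i = k" using assms by blast
    have "u i = \<beta> i k *\<^sub>R u (b k) + (\<Sum>l\<in>UNIV - {k}. \<beta> i l *\<^sub>R u (b l))"
      using u_expand[OF i(2)] by (simp add: sum.remove[of UNIV k])
    then have "\<beta> i k *\<^sub>R u (b k) = u i - (\<Sum>l\<in>UNIV - {k}. \<beta> i l *\<^sub>R u (b l))" by simp
    also have "\<dots> \<in> span (u ` I)"
    proof (intro span_diff span_sum)
      show "u i \<in> span (u ` I)" using i by (intro span_base) auto
      fix l assume l: "l \<in> UNIV - {k}"
      show "\<beta> i l *\<^sub>R u (b l) \<in> span (u ` I)"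
      proof (cases "\<beta> i l = 0")
        case False
        then have "rank l \<le> rank k" using \<kappa>_max[OF i(2)] i(3) by blast
        moreover have "rank l \<noteq> rank k" using inj_rank l by (auto dest: injD)
        ultimately show ?thesis using less by (intro span_scale) simp
      qed (simp add: span_zero)
    qed
    finally have "(1 / \<beta> i k) *\<^sub>R (\<beta> i k *\<^sub>R u (b k)) \<in> span (u ` I)" by (rule span_scale)
    then show ?case using \<beta>_\<kappa>[OF i(2)] i(3) by simp
  qed
  then have "span (range (\<lambda>k. u (b k))) \<subseteq> span (u ` I)"
    by (intro span_minimal) auto
  then show ?thesis using basis_span by auto
qed

text \<open>A minimum 1 over each class means that all h i are at least 1 and that indices with h i
  = 1 represent every class. Their normals span, so the body lies in the bounded set S I, and there
  are finitely many index sets I.\<close>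

lemma energy_level_bound:
  obtains C where "C \<ge> 0" "\<forall>h\<in>positive_par. level h = (\<chi> k. 1) \<longrightarrow> energy h \<le> C"
proof -
  define S where "S I = {x. \<forall>i\<in>I. \<bar>x \<bullet> u i\<bar> \<le> 1}" for I
  \<comment> \<open>The sum over all index sets is a bound independent of h. For sets S I of
    infinite volume \<open>measure\<close> is 0, so the sum is still a real upper bound for the
    bounded ones.\<close>
  define Cv where "Cv = (\<Sum>I\<in>Pow {..<N}. measure lborel (S I))"
  define C where "C = Cv + 2 / q * (\<Sum>i<N. c i)"
  have C: "C \<ge> 0"
    using q_pos unfolding C_def Cv_def
    by (intro add_nonneg_nonneg sum_nonneg mult_nonneg_nonneg) (auto intro: less_imp_le c_pos)
  have "energy h \<le> C" if h: "h \<in> positive_par" and lev: "level h = (\<chi> k. 1)" for h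
  proof -
    have M: "Min (h ` {i \<in> {..<N}. \<kappa> i = k}) = 1" for k
      using arg_cong[OF lev, of "\<lambda>v. v $ k"] by (simp add: level_def)
    have ge: "h i \<ge> 1" if i: "i < N" for i
    proof -
      have "Min (h ` {j \<in> {..<N}. \<kappa> j = \<kappa> i}) \<le> h i" using i by (intro Min_le) auto
      then show ?thesis using M by simp
    qed
    define I where "I = {i. i < N \<and> h i \<le> 1}"
    have "\<exists>i\<in>I. i < N \<and> \<kappa> i = k" for k
    proof -
      have "Min (h ` {i \<in> {..<N}. \<kappa> i = k}) \<in> h ` {i \<in> {..<N}. \<kappa> i = k}"
        using class_nonempty[of k] by (intro Min_in) auto
      then show ?thesis using M[of k] by (auto simp: I_def)
    qed
    then have sp: "span (u ` I) = UNIV" by (rule spanning_of_level)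
    have finI: "finite I" by (simp add: I_def)
    have "closed (S I)"
    proof -
      have "S I = (\<Inter>i\<in>I. {x. \<bar>x \<bullet> u i\<bar> \<le> 1})" by (auto simp: S_def)
      then show ?thesis by (auto intro!: closed_INT closed_Collect_le continuous_intros)
    qed
    moreover have "bounded (S I)"
    proof -
      obtain R where R: "R > 0" "\<And>x c. (\<And>v. v \<in> u ` I \<Longrightarrow> \<bar>x \<bullet> v\<bar> \<le> c) \<Longrightarrow> norm x \<le> R * c"
        using norm_le_of_spanning[OF finite_imageI[OF finI] sp] by blast
      have "norm x \<le> R * 1" if "x \<in> S I" for x
        by (rule R(2)) (use that in \<open>auto simp: S_def\<close>)
      then show ?thesis unfolding bounded_iff by blast
    qed
    ultimately have SI: "S I \<in> fmeasurable lborel"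
      using emeasure_bounded_finite[of "S I"] by (intro fmeasurableI) (auto intro: borel_closed)
    have "body h \<subseteq> S I" by (force simp: body_def S_def I_def)
    then have "vol h \<le> measure lborel (S I)"
      unfolding vol_def using sets_body SI by (intro measure_mono_fmeasurable) auto
    also have "\<dots> \<le> Cv"
      unfolding Cv_def by (rule member_le_sum) (auto simp: I_def)
    finally have "vol h \<le> Cv" .
    moreover have "(\<Sum>i<N. c i * h i powr (- q)) \<le> (\<Sum>i<N. c i)"
    proof (rule sum_mono)
      fix i assume "i \<in> {..<N}"
      then have i: "i < N" by simp
      have "h i powr (- q) \<le> h i powr 0" using ge[OF i] q_pos by (intro powr_mono) auto
      then have "h i powr (- q) \<le> 1" using ge[OF i] by simp
      then have "c i * h i powr (- q) \<le> c i * 1" using c_pos[OF i] by (intro mult_left_mono) auto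
      then show "c i * h i powr (- q) \<le> c i" by simp
    qed
    then have "2 / q * (\<Sum>i<N. c i * h i powr (- q)) \<le> 2 / q * (\<Sum>i<N. c i)"
      using q_pos by (intro mult_left_mono) auto
    ultimately show ?thesis by (simp add: energy_def C_def)
  qed
  then show ?thesis using C that by blast
qed

text \<open>For t $ k = T all normals of class k have a large ridge value, as their coefficient at k
  is nonzero; for t $ k = - T the basis normal b k of this class has the value exp (- T) <
  1.\<close>

lemma level_ridge_boundary:
  obtains T0 where "T0 > 0" "\<forall>T\<ge>T0. \<forall>t k. (t $ k = T \<longrightarrow> level (ridge t) $ k > 1) \<and> (t $ k = - T \<longrightarrow> level (ridge t) $ k < 1)"
proof -
  define m where "m = Min (insert 1 ((\<lambda>i. \<bar>\<beta> i (\<kappa> i)\<bar>) ` {..<N}))"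
  have m: "m > 0" using \<beta>_\<kappa> by (simp add: m_def)
  have m_le: "m \<le> \<bar>\<beta> i (\<kappa> i)\<bar>" if "i < N" for i
    unfolding m_def using that by (intro Min_le) auto
  define T0 where "T0 = max 1 (1 + ln (1 / m))"
  show ?thesis
  proof (rule that[of T0], simp add: T0_def, intro allI impI conjI)
    fix T :: real and t :: "real ^ 'n" and k assume T: "T \<ge> T0"
    have "1 / m < exp T"
    proof -
      have "ln (1 / m) < T" using T by (simp add: T0_def)
      then show ?thesis using m by (metis exp_less_cancel_iff exp_ln zero_less_divide_1_iff)
    qed
    then have mT: "1 < m * exp T" using m by (simp add: field_simps)
    { assume tk: "t $ k = T"
      have "1 < ridge t i" if i: "i < N" "\<kappa> i = k" for i
      proof -
        have "m * exp T \<le> \<bar>\<beta> i k\<bar> * exp (t $ k)"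
          using m_le[OF i(1)] i(2) tk by (intro mult_mono) auto
        also have "\<dots> \<le> ridge t i" by (rule ridge_ge[OF i(1)])
        finally show ?thesis using mT by simp
      qed
      then show "level (ridge t) $ k > 1"
        using class_nonempty[of k] by (auto simp: level_def Min_gr_iff) }
    { assume tk: "t $ k = - T"
      have "level (ridge t) $ k \<le> ridge t (b k)"
        using b_less[of k] \<kappa>_b[of k] by (auto simp: level_def intro!: Min_le)
      also have "\<dots> < 1" using tk T by (simp add: ridge_b T0_def)
      finally show "level (ridge t) $ k < 1" . }
  qed
qed

text \<open>Otherwise iterated deformation, which fixes the boundary of the ridge, would lift the whole ridge
  above the level attained on the linking set.\<close>

lemma critical_point:
  obtains h where "h \<in> positive_par" "\<forall>i<N. gradient i h = 0"
proof (rule ccontr)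
  assume "\<not> thesis"
  then have noncrit: "\<And>h. h \<in> positive_par \<Longrightarrow> \<exists>i<N. gradient i h \<noteq> 0" using that by blast
  obtain C where C: "C \<ge> 0" "\<forall>h\<in>positive_par. level h = (\<chi> k. 1) \<longrightarrow> energy h \<le> C"
    using energy_level_bound .
  obtain T1 where T1: "T1 > 0" "\<forall>T\<ge>T1. \<forall>t k. (t $ k = T \<longrightarrow> level (ridge t) $ k > 1) \<and> (t $ k = - T \<longrightarrow> level (ridge t) $ k < 1)"
    using level_ridge_boundary .
  \<comment> \<open>On the boundary of such a cube the energy of the ridge is at least C + 1, where
    the deformation is the identity.\<close>
  obtain T2 where T2: "\<And>T t k. T \<ge> T2 \<Longrightarrow> t \<in> cbox (\<chi> k. - T) (\<chi> k. T) \<Longrightarrow> \<bar>t $ k\<bar> = T \<Longrightarrow> energy (ridge t) \<ge> C + 1"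
    using energy_ridge_boundary by blast
  define T where "T = max T1 T2"
  have T: "T > 0" "T \<ge> T1" "T \<ge> T2" using T1 by (auto simp: T_def)
  let ?B = "cbox (\<chi> k. - T) (\<chi> k. T) :: (real ^ 'n) set"
  obtain L0 where L0: "\<forall>L\<ge>L0. \<exists>\<epsilon>>0. \<exists>\<Phi>. continuous_on positive_par \<Phi> \<and>
    (\<forall>h\<in>positive_par. (\<forall>i<N. h i \<le> L) \<longrightarrow>
      \<Phi> h \<in> positive_par \<and> (\<forall>i<N. \<Phi> h i \<le> L) \<and> energy (\<Phi> h) \<ge> min (energy h + \<epsilon>) (C + 1 / 2) \<and>
      (energy h \<ge> C + 1 \<longrightarrow> \<Phi> h = h))"
    using deformation[OF noncrit C(1)] by blast
  \<comment> \<open>Bounds every coordinate of the ridge over the cube, so that the hypothesis of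
    the deformation holds at the start; each step preserves it.\<close>
  define L where "L = max L0 (\<Sum>i<N. \<Sum>k\<in>UNIV. \<bar>\<beta> i k\<bar> * exp T)"
  have ridge_L: "ridge t i \<le> L" if t: "t \<in> ?B" and i: "i < N" for t i
  proof -
    have "ridge t i \<le> (\<Sum>k\<in>UNIV. \<bar>\<beta> i k\<bar> * exp T)"
      using t i by (auto simp: ridge_def mem_box_cart intro!: sum_mono mult_left_mono)
    also have "\<dots> \<le> (\<Sum>i<N. \<Sum>k\<in>UNIV. \<bar>\<beta> i k\<bar> * exp T)"
      using i by (intro member_le_sum[where f = "\<lambda>i. \<Sum>k\<in>UNIV. \<bar>\<beta> i k\<bar> * exp T"]) (auto intro!: sum_nonneg)
    finally show ?thesis by (simp add: L_def)
  qed
  obtain \<epsilon> \<Phi> where \<epsilon>: "\<epsilon> > 0" and \<Phi>_cont: "continuous_on positive_par \<Phi>"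
    and \<Phi>: "\<forall>h\<in>positive_par. (\<forall>i<N. h i \<le> L) \<longrightarrow>
      \<Phi> h \<in> positive_par \<and> (\<forall>i<N. \<Phi> h i \<le> L) \<and> energy (\<Phi> h) \<ge> min (energy h + \<epsilon>) (C + 1 / 2) \<and>
      (energy h \<ge> C + 1 \<longrightarrow> \<Phi> h = h)"
    using L0[rule_format, of L, unfolded L_def, OF max.cobounded1] unfolding L_def[symmetric] by blast
  \<comment> \<open>m deformation steps raise the ridge by \<epsilon> each until the level C + 1 / 2
    is reached; the start 0 is the nonnegativity of the energy.\<close>
  have climb: "\<exists>\<gamma>. continuous_on ?B \<gamma> \<and> (\<forall>t\<in>?B. \<gamma> t \<in> positive_par \<and> (\<forall>i<N. \<gamma> t i \<le> L) \<and>
      ((\<exists>k. \<bar>t $ k\<bar> = T) \<longrightarrow> \<gamma> t = ridge t) \<and> energy (\<gamma> t) \<ge> min (real m * \<epsilon>) (C + 1 / 2))" for m :: nat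
  proof (induction m)
    case 0
    show ?case
      using ridge_L ridge_positive continuous_on_ridge energy_nonneg C(1)
      by (intro exI[of _ ridge]) (auto intro: min.coboundedI1)
  next
    case (Suc m)
    then obtain \<gamma> where \<gamma>: "continuous_on ?B \<gamma>" and \<gamma>': "\<forall>t\<in>?B. \<gamma> t \<in> positive_par \<and> (\<forall>i<N. \<gamma> t i \<le> L) \<and>
      ((\<exists>k. \<bar>t $ k\<bar> = T) \<longrightarrow> \<gamma> t = ridge t) \<and> energy (\<gamma> t) \<ge> min (real m * \<epsilon>) (C + 1 / 2)" by blast
    have "continuous_on ?B (\<lambda>t. \<Phi> (\<gamma> t))"
      using \<gamma>' by (intro continuous_on_compose2[OF \<Phi>_cont \<gamma>]) blast
    moreover have "\<Phi> (\<gamma> t) \<in> positive_par \<and> (\<forall>i<N. \<Phi> (\<gamma> t) i \<le> L) \<and>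
      ((\<exists>k. \<bar>t $ k\<bar> = T) \<longrightarrow> \<Phi> (\<gamma> t) = ridge t) \<and> energy (\<Phi> (\<gamma> t)) \<ge> min (real (Suc m) * \<epsilon>) (C + 1 / 2)"
      if t: "t \<in> ?B" for t
    proof -
      have pos: "\<gamma> t \<in> positive_par" "\<forall>i<N. \<gamma> t i \<le> L" and en: "energy (\<gamma> t) \<ge> min (real m * \<epsilon>) (C + 1 / 2)"
        using \<gamma>' t by blast+
      have \<Phi>t: "\<Phi> (\<gamma> t) \<in> positive_par" "\<forall>i<N. \<Phi> (\<gamma> t) i \<le> L"
        "energy (\<Phi> (\<gamma> t)) \<ge> min (energy (\<gamma> t) + \<epsilon>) (C + 1 / 2)" "energy (\<gamma> t) \<ge> C + 1 \<longrightarrow> \<Phi> (\<gamma> t) = \<gamma> t"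
        using \<Phi> pos by blast+
      have "\<Phi> (\<gamma> t) = ridge t" if "\<exists>k. \<bar>t $ k\<bar> = T"
      proof -
        have "\<gamma> t = ridge t" using \<gamma>' t that by blast
        moreover have "energy (ridge t) \<ge> C + 1" using that T2[OF T(3) t] by blast
        ultimately show ?thesis using \<Phi>t(4) by simp
      qed
      moreover have "min (real (Suc m) * \<epsilon>) (C + 1 / 2) \<le> min (energy (\<gamma> t) + \<epsilon>) (C + 1 / 2)"
        using en \<epsilon> by (simp add: distrib_right min_def split: if_splits)
      ultimately show ?thesis
        using \<Phi>t(1,2) order_trans[OF _ \<Phi>t(3)] by blast
    qed
    ultimately show ?case by (intro exI[of _ "\<lambda>t. \<Phi> (\<gamma> t)"]) blast
  qed
  obtain m :: nat where m: "(C + 1 / 2) / \<epsilon> < real m" using reals_Archimedean2 by blast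
  then have "C + 1 / 2 < real m * \<epsilon>" using \<epsilon> by (simp add: divide_less_eq)
  then have min_eq: "min (real m * \<epsilon>) (C + 1 / 2) = C + 1 / 2" by simp
  obtain \<gamma> where \<gamma>: "continuous_on ?B \<gamma>" and \<gamma>': "\<forall>t\<in>?B. \<gamma> t \<in> positive_par \<and>
      ((\<exists>k. \<bar>t $ k\<bar> = T) \<longrightarrow> \<gamma> t = ridge t) \<and> energy (\<gamma> t) \<ge> C + 1 / 2"
    using climb[of m] unfolding min_eq by blast
  have "continuous_on ?B (\<lambda>t. level (\<gamma> t) - (\<chi> k. 1))"
    by (intro continuous_intros continuous_on_level \<gamma>)
  moreover have "(level (\<gamma> t) - (\<chi> k. 1)) $ k > 0" if "t \<in> ?B" "t $ k = T" for t k
  proof -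
    have "\<exists>k. \<bar>t $ k\<bar> = T" using that(2) T by (intro exI[of _ k]) simp
    then have "\<gamma> t = ridge t" using \<gamma>' that(1) by blast
    then show ?thesis using T1(2) T(2) that(2) by simp
  qed
  moreover have "(level (\<gamma> t) - (\<chi> k. 1)) $ k < 0" if "t \<in> ?B" "t $ k = - T" for t k
  proof -
    have "\<exists>k. \<bar>t $ k\<bar> = T" using that(2) T by (intro exI[of _ k]) simp
    then have "\<gamma> t = ridge t" using \<gamma>' that(1) by blast
    then show ?thesis using T1(2) T(2) that(2) by simp
  qed
  \<comment> \<open>The lifted ridge meets the linking set, where the energy is at most C, although
    it was lifted to at least C + 1 / 2.\<close>
  ultimately obtain t where "t \<in> ?B" "level (\<gamma> t) - (\<chi> k. 1) = 0"
    using poincare_miranda[OF T(1)] by blast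
  then show False using C(2) \<gamma>' by fastforce
qed

end

section \<open>Solution of the Minkowski problem\<close>

lemma (in weighted_slabs) basis_selection:
  obtains b \<beta> rank \<kappa> where "slabs_basis u N c q b \<beta> rank \<kappa>"
proof -
  obtain B where B: "B \<subseteq> u ` {..<N}" "independent B" "u ` {..<N} \<subseteq> span B" "card B = dim (u ` {..<N})"
    by (rule basis_exists)
  have finB: "finite B" using B(1) finite_subset by blast
  have spanB: "span B = UNIV"
    using spanning span_minimal[OF B(3) subspace_span] by auto
  have "card B = CARD('n)" using B(4) spanning by (metis dim_span dim_UNIV DIM_cart DIM_real mult_1_right)
  then obtain g where g: "bij_betw g (UNIV :: 'n set) B"
    using finite_same_card_bij[OF finite finB] by metis
  have "\<forall>k. \<exists>i<N. u i = g k" using g B(1) by (auto simp: bij_betw_def) (metis (no_types, lifting) imageE lessThan_iff rangeI subsetD)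
  then obtain b where b: "\<And>k. b k < N" "\<And>k. u (b k) = g k" by metis
  define T where "T y = (\<Sum>k\<in>UNIV. y $ k *\<^sub>R u (b k))" for y :: "real ^ 'n"
  have linT: "linear T"
    by (rule linearI) (auto simp: T_def scaleR_left_distrib sum.distrib scaleR_sum_right)
  have "surj T"
  proof (rule surjI)
    fix x
    have "x \<in> range (\<lambda>\<alpha>. \<Sum>v\<in>B. \<alpha> v *\<^sub>R v)"
      unfolding span_finite[OF finB, symmetric] spanB by simp
    then obtain \<alpha> where "x = (\<Sum>v\<in>B. \<alpha> v *\<^sub>R v)" by blast
    also have "\<dots> = (\<Sum>k\<in>UNIV. \<alpha> (g k) *\<^sub>R g k)"
      using sum.reindex_bij_betw[OF g, of "\<lambda>v. \<alpha> v *\<^sub>R v"] by simp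
    finally have "T (\<chi> k. \<alpha> (g k)) = x" by (simp add: T_def b(2))
    then show "T (SOME y. T y = x) = x" by (rule someI)
  qed
  then have "inj T" using linT linear_surjective_imp_injective by blast
  have Tinv: "T (inv T x) = x" "inv T (T y) = y" for x y
    using \<open>surj T\<close> \<open>inj T\<close> by (simp_all add: surj_f_inv_f)
  define \<beta> where "\<beta> i k = inv T (u i) $ k" for i k
  have expand: "u i = (\<Sum>k\<in>UNIV. \<beta> i k *\<^sub>R u (b k))" for i
    using Tinv(1)[of "u i"] by (simp add: T_def \<beta>_def)
  have \<beta>_b: "\<beta> (b k) l = (if l = k then 1 else 0)" for k l
  proof -
    have "T (axis k 1) = u (b k)"
      by (simp add: T_def axis_def if_distrib[of "\<lambda>x. x *\<^sub>R _"] cong: if_cong)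
    then have "inv T (u (b k)) = axis k 1" using Tinv(2)[of "axis k 1"] by simp
    then show ?thesis by (simp add: \<beta>_def axis_def)
  qed
  \<comment> \<open>Any injective numbering serves as the ordering of the basis.\<close>
  obtain rank :: "'n \<Rightarrow> nat" where rank: "inj rank"
    using finite_imp_inj_to_nat_seg[OF finite] by metis
  have "\<exists>k. \<beta> i k \<noteq> 0 \<and> (\<forall>l. \<beta> i l \<noteq> 0 \<longrightarrow> rank l \<le> rank k)" if i: "i < N" for i
  proof -
    let ?S = "{k. \<beta> i k \<noteq> 0}"
    have "?S \<noteq> {}"
    proof
      assume "?S = {}"
      then have "u i = 0" by (subst expand) simp
      then show False using norm_u[OF i] by simp
    qed
    then have "Max (rank ` ?S) \<in> rank ` ?S" by (intro Max_in) auto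
    then obtain k where "k \<in> ?S" "rank k = Max (rank ` ?S)" by auto
    then show ?thesis by (intro exI[of _ k]) auto
  qed
  then obtain \<kappa> where \<kappa>: "\<And>i. i < N \<Longrightarrow> \<beta> i (\<kappa> i) \<noteq> 0" "\<And>i l. i < N \<Longrightarrow> \<beta> i l \<noteq> 0 \<Longrightarrow> rank l \<le> rank (\<kappa> i)"
    by metis
  have "slabs_basis u N c q b \<beta> rank \<kappa>"
    by unfold_locales (rule b(1), rule expand, rule \<beta>_b, rule rank, erule \<kappa>(1), erule \<kappa>(2), assumption)
  then show ?thesis by (rule that)
qed

lemma (in weighted_slabs) critical_point_exists:
  obtains h where "h \<in> positive_par" "\<forall>i<N. gradient i h = 0"
proof -
  obtain b \<beta> rank \<kappa> where "slabs_basis u N c q b \<beta> rank \<kappa>" by (rule basis_selection)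
  then interpret slabs_basis u N c q b \<beta> rank \<kappa> .
  show ?thesis by (rule critical_point) (rule that)
qed

section \<open>Intersections of slabs as polytopes\<close>

context slabs
begin

definition normals :: "(real ^ 'n) set" where
  "normals = u ` {..<N} \<union> (\<lambda>i. - u i) ` {..<N}"

text \<open>Opposite normals share an index, so that both half-spaces of a slab receive the same
  support number.\<close>

definition normal_index :: "real ^ 'n \<Rightarrow> nat" where
  "normal_index v = (THE i. i < N \<and> (v = u i \<or> v = - u i))"

lemma normal_index: "i < N \<Longrightarrow> normal_index (u i) = i" "i < N \<Longrightarrow> normal_index (- u i) = i"
  unfolding normal_index_def using nonparallel by (auto intro!: the_equality) (metis minus_minus)+

lemma polytope_body: "polytope (body h)"
proof -
  have "body h = (\<Inter>i\<in>{..<N}. {x. u i \<bullet> x \<le> h i} \<inter> {x. u i \<bullet> x \<ge> - h i})"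
    by (force simp: body_def abs_le_iff inner_commute)
  moreover have "polyhedron \<dots>"
    by (rule polyhedron_Inter) (auto intro!: polyhedron_Int polyhedron_halfspace_le polyhedron_halfspace_ge)
  ultimately have "polyhedron (body h)" by (simp only:)
  then show ?thesis
    using bounded_body by (simp add: polytope_eq_bounded_polyhedron)
qed

lemma uminus_body: "uminus ` body h = body h"
proof -
  have "- x \<in> body h" if "x \<in> body h" for x using that by (simp add: body_def)
  then show ?thesis by (auto intro: image_eqI[of _ uminus "- _"])
qed

lemma aff_dim_body:
  assumes "\<And>i. i < N \<Longrightarrow> h i > 0"
  shows "aff_dim (body h) = int CARD('n)"
proof -
  have "open (\<Inter>i\<in>{..<N}. {x. \<bar>x \<bullet> u i\<bar> < h i})"
    by (intro open_INT ballI open_Collect_less continuous_intros) auto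
  moreover have "(\<Inter>i\<in>{..<N}. {x. \<bar>x \<bullet> u i\<bar> < h i}) \<subseteq> body h" by (auto simp: body_def intro: less_imp_le)
  moreover have "0 \<in> (\<Inter>i\<in>{..<N}. {x. \<bar>x \<bullet> u i\<bar> < h i})" using assms by simp
  ultimately have "interior (body h) \<noteq> {}" using interior_maximal by blast
  then show ?thesis using aff_dim_nonempty_interior[of "body h"] by simp
qed

lemma polytope_rep_body:
  assumes "\<And>i. i < N \<Longrightarrow> h i > 0"
  shows "polytope_rep (body h) normals (\<lambda>v. h (normal_index v))"
proof
  have "(\<forall>v\<in>normals. x \<bullet> v \<le> h (normal_index v)) \<longleftrightarrow>
      (\<forall>i<N. x \<bullet> u i \<le> h i) \<and> (\<forall>i<N. - (x \<bullet> u i) \<le> h i)" for x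
    by (simp add: normals_def ball_Un normal_index) (simp add: Ball_def)
  then show "body h = {x. \<forall>v\<in>normals. x \<bullet> v \<le> h (normal_index v)}"
    by (auto simp: body_def abs_le_iff)
qed (use assms norm_u bounded_body in \<open>auto simp: normals_def normal_index\<close>)

text \<open>For - u i the prism is the reflection of the one for u i, as the body is
  symmetric.\<close>

lemma emeasure_prism_facet_body:
  assumes h: "\<And>i. i < N \<Longrightarrow> h i > 0" and i: "i < N" and v: "v = u i \<or> v = - u i"
  shows "polytope_rep.facet_area (body h) (\<lambda>v. h (normal_index v)) v = ennreal (face_area i h)"
proof -
  interpret polytope_rep "body h" normals "\<lambda>v. h (normal_index v)"
    by (rule polytope_rep_body[OF h])
  have vv: "v \<bullet> v = 1" using v u_self[OF i] by auto
  have hv: "h (normal_index v) = h i" using v normal_index i by auto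
  have "(x + (h i - x \<bullet> v) *\<^sub>R v) \<bullet> v = h i" for x using vv by (simp add: algebra_simps)
  then have "prism v (h i) (facet v) = prism v (h i) (body h)"
    by (auto simp: prism_def facet_def hv)
  moreover have "emeasure lborel (prism v (h i) (body h)) = emeasure lborel (prism (u i) (h i) (body h))"
    using v
  proof
    assume v: "v = - u i"
    have body_minus: "- x \<in> body h \<longleftrightarrow> x \<in> body h" for x by (simp add: body_def)
    have "prism v (h i) (body h) = uminus -` prism (u i) (h i) (body h)"
    proof (intro set_eqI)
      fix x
      have "x + (h i - x \<bullet> v) *\<^sub>R v = - (- x + (h i - (- x) \<bullet> u i) *\<^sub>R u i)"
        by (simp add: v)
      then show "x \<in> prism v (h i) (body h) \<longleftrightarrow> x \<in> uminus -` prism (u i) (h i) (body h)"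
        unfolding prism_def vimage_eq mem_Collect_eq by (simp only: body_minus) (simp add: v)
    qed
    then show ?thesis
      using emeasure_lborel_uminus[OF sets_prism[OF sets_body]] by simp
  qed simp
  moreover have "emeasure lborel (prism (u i) (h i) (body h)) = ennreal (face_area i h)"
    using emeasure_prism_finite[OF bounded_body, of "u i" "h i" h]
    by (simp add: face_area_def emeasure_eq_ennreal_measure)
  ultimately show ?thesis by (simp add: facet_area_def hv)
qed

end

text \<open>One normal is kept of each antipodal pair, which makes the chosen normals pairwise
  nonparallel.\<close>

lemma half_system:
  fixes V :: "(real ^ 'n) set"
  assumes fin: "finite V" and sph: "V \<subseteq> sphere 0 1" and sym: "\<And>v. v \<in> V \<Longrightarrow> - v \<in> V"
  obtains u :: "nat \<Rightarrow> real ^ 'n" and N where "V = u ` {..<N} \<union> (\<lambda>i. - u i) ` {..<N}"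
    "\<And>i. i < N \<Longrightarrow> norm (u i) = 1"
    "\<And>i j. i < N \<Longrightarrow> j < N \<Longrightarrow> i \<noteq> j \<Longrightarrow> u i \<noteq> u j \<and> u i \<noteq> - u j"
proof -
  \<comment> \<open>The choice depends only on the set {v, - v}, hence r (- v) = r v.\<close>
  define r where "r v = (SOME x. x \<in> {v, - v})" for v :: "real ^ 'n"
  have r: "r v = v \<or> r v = - v" for v
    using someI[of "\<lambda>x. x \<in> {v, - v}" v] by (auto simp: r_def)
  have r_minus: "r (- v) = r v" for v by (simp add: r_def insert_commute)
  have rr: "r (r v) = r v" for v using r[of v] r_minus by metis
  define R where "R = r ` V"
  have RV: "R \<subseteq> V" using r sym by (auto simp: R_def) (metis)
  have "finite R" using fin by (simp add: R_def)
  then obtain u where u: "bij_betw u {0..<card R} R" using ex_bij_betw_nat_finite by blast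
  have img: "u ` {..<card R} = R" using u by (simp add: bij_betw_def lessThan_atLeast0)
  show ?thesis
  proof (rule that[of u "card R"])
    have "V = R \<union> uminus ` R"
    proof
      show "V \<subseteq> R \<union> uminus ` R"
      proof
        fix v assume v: "v \<in> V"
        then have "r v \<in> R" by (simp add: R_def)
        then show "v \<in> R \<union> uminus ` R" using r[of v] by (metis UnI1 UnI2 image_eqI minus_minus)
      qed
    qed (use RV sym in auto)
    then show "V = u ` {..<card R} \<union> (\<lambda>i. - u i) ` {..<card R}"
      using img by (simp add: image_image[symmetric, of uminus u])
    show n: "norm (u i) = 1" if "i < card R" for i
      using that img RV sph by (auto simp: subset_iff)
    show "u i \<noteq> u j \<and> u i \<noteq> - u j" if ij: "i < card R" "j < card R" "i \<noteq> j" for i j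
    proof
      show ne: "u i \<noteq> u j"
        using u ij by (auto simp: bij_betw_def inj_on_def)
      have "u i \<in> R" "u j \<in> R" using ij img by auto
      then have "r (u i) = u i" "r (u j) = u j" using rr by (auto simp: R_def)
      then show "u i \<noteq> - u j" using ne r_minus by metis
    qed
  qed
qed

text \<open>A support that does not span lies in a hyperplane, and the complement of the
  corresponding great subsphere is a null set.\<close>

lemma span_measure_support:
  fixes \<mu> :: "(real ^ 'n) measure"
  assumes M: "sets \<mu> = sets borel_sphere"
    and nc: "\<not> (\<exists>S. great_subsphere S \<and> concentrated_on \<mu> S)"
  shows "span (measure_support \<mu>) = UNIV"
proof (rule ccontr)
  assume "span (measure_support \<mu>) \<noteq> UNIV"
  then obtain a where a: "a \<noteq> 0" "span (measure_support \<mu>) \<subseteq> {x. a \<bullet> x = 0}"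
    using span_not_univ_subset_hyperplane by blast
  let ?H = "{x. a \<bullet> x = 0}" let ?S = "sphere 0 1 \<inter> ?H"
  have "great_subsphere ?S"
    unfolding great_subsphere_def
    using subspace_hyperplane[of a] dim_hyperplane[OF a(1)] by blast
  moreover have "concentrated_on \<mu> ?S"
    unfolding concentrated_on_def
  proof (rule emeasure_outside_measure_support[OF M])
    have "space \<mu> = sphere 0 1"
      using sets_eq_imp_space_eq[OF M] by (simp add: space_borel_sphere)
    then show "measure_support \<mu> \<subseteq> ?S"
      using a(2) span_superset[of "measure_support \<mu>"] by (auto simp: measure_support_def subset_iff)
    show "?S \<in> sets \<mu>"
      unfolding M borel_sphere_def sets_restrict_space
      by (auto intro!: image_eqI[where x = ?H] borel_closed closed_hyperplane)
  qed
  ultimately show False using nc by blast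
qed

theorem corollary1p3:
  fixes \<mu> :: "(real ^ 'n) measure" and p :: real
  assumes "CARD('n) \<ge> 2"
    and "p < 0"
    and "sets \<mu> = sets borel_sphere"
    and "finite_measure \<mu>"
    and "emeasure \<mu> (space \<mu>) \<noteq> 0"
    and "even_measure \<mu>"
    and "discrete_measure \<mu>"
  shows "(\<exists>K :: (real ^ 'n) set.
            polytope K \<and> aff_dim K = int CARD('n) \<and> uminus ` K = K
            \<and> Lp_surface_area_measure p K = \<mu>)
     \<longleftrightarrow> \<not> (\<exists>S. great_subsphere S \<and> concentrated_on \<mu> S)"
proof
  assume "\<exists>K :: (real ^ 'n) set. polytope K \<and> aff_dim K = int CARD('n) \<and> uminus ` K = K
    \<and> Lp_surface_area_measure p K = \<mu>"
  then show "\<not> (\<exists>S. great_subsphere S \<and> concentrated_on \<mu> S)"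
    using Lp_surface_area_measure_not_concentrated by blast
next
  assume nc: "\<not> (\<exists>S. great_subsphere S \<and> concentrated_on \<mu> S)"
  note M = assms(3)
  interpret finite_measure \<mu> by (rule assms(4))
  define V where "V = measure_support \<mu>"
  have fin: "finite V" using assms(7) by (simp add: V_def discrete_measure_def)
  have sp: "space \<mu> = sphere 0 1"
    using sets_eq_imp_space_eq[OF M] by (simp add: space_borel_sphere)
  have sph: "V \<subseteq> sphere 0 1" by (auto simp: V_def measure_support_def sp)
  have sing: "{v} \<in> sets \<mu>" if "v \<in> sphere 0 1" for v
    using that M singleton_in_borel_sphere[of v] by simp
  have even: "emeasure \<mu> {- v} = emeasure \<mu> {v}" if "v \<in> sphere 0 1" for v
    using assms(6)[unfolded even_measure_def, THEN bspec, OF sing[OF that]] by simp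
  \<comment> \<open>A support point is an atom, evenness gives its antipode the same mass, and an
    atom belongs to the support.\<close>
  have sym: "- v \<in> V" if v: "v \<in> V" for v
  proof -
    have vs: "v \<in> sphere 0 1" using v sph by blast
    have "emeasure \<mu> {v} \<noteq> 0"
      using emeasure_support_point_pos[OF M] fin v by (simp add: V_def)
    then have ne: "emeasure \<mu> {- v} \<noteq> 0" using even[OF vs] by simp
    have "emeasure \<mu> (W \<inter> space \<mu>) \<noteq> 0" if W: "open W" "- v \<in> W" for W
    proof
      assume "emeasure \<mu> (W \<inter> space \<mu>) = 0"
      moreover have "W \<inter> space \<mu> \<in> sets \<mu>"
        unfolding M borel_sphere_def sets_restrict_space sp using W(1) by (auto intro!: image_eqI[where x = W])
      moreover have "{- v} \<subseteq> W \<inter> space \<mu>" using W(2) vs sp by simp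
      ultimately have "emeasure \<mu> {- v} = 0"
        using emeasure_mono[of "{- v}" "W \<inter> space \<mu>" \<mu>] by simp
      then show False using ne by simp
    qed
    then show ?thesis using vs sp by (auto simp: V_def measure_support_def)
  qed
  obtain u :: "nat \<Rightarrow> real ^ 'n" and N where V: "V = u ` {..<N} \<union> (\<lambda>i. - u i) ` {..<N}"
    and nu: "\<And>i. i < N \<Longrightarrow> norm (u i) = 1"
    and np: "\<And>i j. i < N \<Longrightarrow> j < N \<Longrightarrow> i \<noteq> j \<Longrightarrow> u i \<noteq> u j \<and> u i \<noteq> - u j"
    using half_system[OF fin sph sym] by blast
  have "V \<subseteq> span (u ` {..<N})"
    unfolding V by (auto intro: span_base span_neg)
  then have "span V \<subseteq> span (u ` {..<N})" by (meson span_minimal subspace_span)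
  then have span: "span (u ` {..<N}) = UNIV"
    using span_measure_support[OF M nc] by (auto simp: V_def)
  define \<kappa> where "\<kappa> = enn2real (cell_measure (undefined :: 'n))"
  have \<kappa>: "cell_measure (undefined :: 'n) = ennreal \<kappa>" "\<kappa> > 0"
    using cell_measure_finite[of "undefined :: 'n"] cell_measure_pos[of "undefined :: 'n"]
    by (auto simp: \<kappa>_def enn2real_positive_iff)
  \<comment> \<open>The surface area measure of the solution is \<kappa> times the prism areas; the
    division compensates for this factor.\<close>
  define c where "c i = measure \<mu> {u i} / \<kappa>" for i
  have c: "c i > 0" if "i < N" for i
  proof -
    have "u i \<in> V" using that by (auto simp: V)
    then have "emeasure \<mu> {u i} \<noteq> 0"
      using emeasure_support_point_pos[OF M] fin by (simp add: V_def)
    then show ?thesis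
      using \<kappa>(2) by (simp add: c_def emeasure_eq_measure zero_less_measure_iff)
  qed
  interpret weighted_slabs u N c "- p"
    by unfold_locales (use nu np span c assms(2) in auto)
  obtain h where h: "h \<in> positive_par" and crit: "\<forall>i<N. gradient i h = 0"
    by (rule critical_point_exists)
  have hpos: "h i > 0" if "i < N" for i using h that by (simp add: positive_par_def)
  \<comment> \<open>With q = - p the exponent - q - 1 of the gradient becomes p - 1.\<close>
  have area: "face_area i h = c i * h i powr (p - 1)" if "i < N" for i
    using crit that by (simp add: gradient_def)
  interpret R: polytope_rep "body h" normals "\<lambda>v. h (normal_index v)"
    by (rule polytope_rep_body[OF hpos])
  have "Lp_surface_area_measure p (body h) = \<mu>"
  proof (rule finitely_supported_measure_eqI[OF sets_Lp_surface_area_measure M fin sph])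
    have Vn: "V = normals" by (simp add: V normals_def)
    show "emeasure (Lp_surface_area_measure p (body h)) (space (Lp_surface_area_measure p (body h)) - V) = 0"
      unfolding Vn by (rule R.emeasure_Lp_surface_area_measure_outside)
    show "emeasure \<mu> (space \<mu> - V) = 0"
      using emeasure_outside_measure_support[OF M, of V] finite_in_borel_sphere[OF fin sph] M
      by (simp add: V_def)
    fix v assume v: "v \<in> V"
    then obtain i where i: "i < N" "v = u i \<or> v = - u i" by (auto simp: V)
    have fa: "R.facet_area v = ennreal (face_area i h)"
      using emeasure_prism_facet_body[OF hpos i] .
    \<comment> \<open>The positive weight forces a nonempty facet, so h i is a true support number
      and enters the density as required.\<close>
    have "face_area i h > 0" using area[OF i(1)] c[OF i(1)] hpos[OF i(1)] by simp
    then have "R.facet_area v \<noteq> 0" using fa by simp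
    then have "R.facet v \<noteq> {}" by (auto simp: R.facet_area_def prism_def)
    then have supp: "support_function (body h) v = h i"
      using R.support_function_eq[of v] v i normal_index Vn by auto
    have "emeasure (Lp_surface_area_measure p (body h)) {v}
        = ennreal (h i powr (1 - p)) * (ennreal \<kappa> * ennreal (c i * h i powr (p - 1)))"
      using R.emeasure_Lp_surface_area_measure_singleton[of v p "undefined :: 'n"] v Vn
      by (simp add: supp fa area[OF i(1)] \<kappa>(1))
    also have "\<dots> = ennreal ((h i powr (1 - p) * h i powr (p - 1)) * (\<kappa> * c i))"
      using \<kappa>(2) c[OF i(1)] by (simp add: ennreal_mult[symmetric] mult_ac)
    also have "h i powr (1 - p) * h i powr (p - 1) = 1"
      using hpos[OF i(1)] by (simp add: powr_add[symmetric])
    also have "ennreal (1 * (\<kappa> * c i)) = emeasure \<mu> {u i}"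
      using \<kappa>(2) by (simp add: c_def emeasure_eq_measure)
    also have "\<dots> = emeasure \<mu> {v}" using i even[of "u i"] nu[OF i(1)] by auto
    finally show "emeasure (Lp_surface_area_measure p (body h)) {v} = emeasure \<mu> {v}" .
  qed
  then show "\<exists>K :: (real ^ 'n) set. polytope K \<and> aff_dim K = int CARD('n) \<and> uminus ` K = K
    \<and> Lp_surface_area_measure p K = \<mu>"
    by (intro exI[of _ "body h"] conjI polytope_body aff_dim_body[OF hpos] uminus_body)
qed

end
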